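(* Let $n,t,p,d$ be integers with $n\geq 2$, $2\leq t\leq n$, $n=(t+1)p+d$, $p\geq 0$ and $0\leq d\leq t$. Then the $\mathbb{N}$-graded Betti numbers of the path ideal $I_t(C_n)$ of the cycle $C_n$ are given, for all integers $i,j\ge 0$, by $$\beta_{i,j}(R/I_t(C_n))=\begin{cases} t & \text{if } j=n,\ d=0,\ i=2\left(\frac{n}{t+1}\right),\\[4pt] 1 & \text{if } j=n,\ d\neq 0,\ i=2\left(\frac{n-d}{t+1}\right)+1,\\[4pt] \dfrac{n}{n-t\left(\frac{j-i}{t-1}\right)}\dbinom{\frac{j-i}{t-1}}{\frac{ti-j}{t-1}}\dbinom{n-t\left(\frac{j-i}{t-1}\right)}{\frac{j-i}{t-1}} & \text{if } j<n,\ i\leq j\leq ti,\ (t-1)\mid (j-i)\ \text{and } 2p\geq \frac{2(j-i)}{t-1}\geq i,\\[4pt] 0 & \text{otherwise.}\end{cases}$$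
   Context: $K$ is a field and $R=K[x_1,\dots,x_n]$ with the standard grading. $C_n$ is the cycle graph on vertices $x_1,\dots,x_n$ with edges $\{x_1,x_2\},\dots,\{x_{n-1},x_n\},\{x_n,x_1\}$ (for $n=2$ this is a single edge). For a graph $G$ on $x_1,\dots,x_n$ and an integer $t\ge 2$, the path ideal $I_t(G)\subseteq R$ is the ideal generated by all monomials $x_{i_1}x_{i_2}\cdots x_{i_t}$ such that $x_{i_1},\dots,x_{i_t}$ are distinct vertices of $G$ with $\{x_{i_k},x_{i_{k+1}}\}$ an edge of $G$ for $k=1,\dots,t-1$. For a homogeneous ideal $I$ of $R$, $\beta_{i,j}(R/I)$ is the number of copies of $R(-j)$ in homological degree $i$ of the graded minimal free resolution of $R/I$ (with $R$ in homological degree $0$). Binomial coefficients satisfy $\binom{a}{b}=0$ unless $0\le b\le a$. *)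

theory Defs
  imports Complex_Main "HOL-Library.Poly_Mapping" "Jordan_Normal_Form.Matrix"
begin

text \<open>
  A polynomial is a finitely supported map from monomials (exponent vectors) to coefficients.
  The type has countably many variables; \<open>poly_ring n\<close> is the subring \<open>R = K[x\<^sub>1, \<dots>, x\<^sub>n]\<close>.
\<close>

type_synonym 'k mpoly = "(nat \<Rightarrow>\<^sub>0 nat) \<Rightarrow>\<^sub>0 'k"

definition var :: "nat \<Rightarrow> 'k::field mpoly" where
  "var i = Poly_Mapping.single (Poly_Mapping.single i 1) 1"

definition poly_ring :: "nat \<Rightarrow> 'k::field mpoly set" where
  "poly_ring n = {f. \<forall>m \<in> Poly_Mapping.keys f. Poly_Mapping.keys m \<subseteq> {1..n}}"

definition mon_deg :: "(nat \<Rightarrow>\<^sub>0 nat) \<Rightarrow> nat" where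
  "mon_deg m = (\<Sum>i \<in> Poly_Mapping.keys m. Poly_Mapping.lookup m i)"

text \<open>
  The degree is an integer: for \<open>e < 0\<close> only the zero polynomial is homogeneous of degree \<open>e\<close>.
\<close>

definition homogeneous_of_degree :: "int \<Rightarrow> 'k::field mpoly \<Rightarrow> bool" where
  "homogeneous_of_degree e f \<longleftrightarrow> (\<forall>m \<in> Poly_Mapping.keys f. int (mon_deg m) = e)"

definition ideal_gen :: "nat \<Rightarrow> 'k::field mpoly set \<Rightarrow> 'k mpoly set" where
  "ideal_gen n S =
     {\<Sum>g\<in>T. c g * g | T c. finite T \<and> T \<subseteq> S \<and> (\<forall>g\<in>T. c g \<in> poly_ring n)}"

definition irrelevant_ideal :: "nat \<Rightarrow> 'k::field mpoly set" where
  "irrelevant_ideal n = ideal_gen n (var ` {1..n})"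

text \<open>Graphs on the vertex set \<open>{1..n}\<close> are given by their set of (unordered) edges.\<close>

definition cycle_edges :: "nat \<Rightarrow> nat set set" where
  "cycle_edges n = {{i, i + 1} | i. 1 \<le> i \<and> i < n} \<union> {{n, 1}}"

definition is_path :: "nat \<Rightarrow> nat set set \<Rightarrow> nat list \<Rightarrow> bool" where
  "is_path n E xs \<longleftrightarrow>
     set xs \<subseteq> {1..n} \<and> distinct xs \<and> (\<forall>k. k + 1 < length xs \<longrightarrow> {xs ! k, xs ! (k + 1)} \<in> E)"

definition path_ideal :: "nat \<Rightarrow> nat set set \<Rightarrow> nat \<Rightarrow> 'k::field mpoly set" where
  "path_ideal n E t = ideal_gen n {prod_list (map var xs) | xs. is_path n E xs \<and> length xs = t}"

definition free_module :: "nat \<Rightarrow> nat \<Rightarrow> 'k::field mpoly vec set" where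
  "free_module n r = {v \<in> carrier_vec r. \<forall>a < r. v $ a \<in> poly_ring n}"

text \<open>
  \<open>min_graded_free_resolution n I D \<phi>\<close>: the complex
  \<open>\<dots> \<rightarrow> F\<^sub>2 \<rightarrow> F\<^sub>1 \<rightarrow> F\<^sub>0 = R\<close> is a graded minimal free resolution of \<open>R/I\<close>, for a proper
  homogeneous ideal \<open>I\<close> of \<open>R\<close>.  Here \<open>F\<^sub>i\<close> is the direct sum of the modules \<open>R(-e)\<close> for \<open>e\<close>
  in the list \<open>D i\<close>, and \<open>\<phi> i\<close> is the matrix of the map from \<open>F\<^sub>i\<^sub>+\<^sub>1\<close> to \<open>F\<^sub>i\<close> in the
  standard homogeneous bases.  The conditions on the matrix entries say that these maps are graded
  of degree 0 and that the image of \<open>F\<^sub>i\<^sub>+\<^sub>1\<close> is contained in \<open>(x\<^sub>1, \<dots>, x\<^sub>n) F\<^sub>i\<close> (minimality);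
  the last two conditions are exactness.
\<close>

definition min_graded_free_resolution ::
    "nat \<Rightarrow> 'k::field mpoly set \<Rightarrow> (nat \<Rightarrow> int list) \<Rightarrow> (nat \<Rightarrow> 'k mpoly mat) \<Rightarrow> bool" where
  "min_graded_free_resolution n I D \<phi> \<longleftrightarrow>
     D 0 = [0] \<and>
     (\<forall>i. \<phi> i \<in> carrier_mat (length (D i)) (length (D (i + 1)))) \<and>
     (\<forall>i. \<forall>b < length (D i). \<forall>a < length (D (i + 1)).
        \<phi> i $$ (b, a) \<in> poly_ring n \<and>
        homogeneous_of_degree (D (i + 1) ! a - D i ! b) (\<phi> i $$ (b, a)) \<and>
        \<phi> i $$ (b, a) \<in> irrelevant_ideal n) \<and>
     {(\<phi> 0 *\<^sub>v w) $ 0 | w. w \<in> free_module n (length (D 1))} = I \<and>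
     (\<forall>i. {v \<in> free_module n (length (D (i + 1))). \<phi> i *\<^sub>v v = 0\<^sub>v (length (D i))} =
          {\<phi> (i + 1) *\<^sub>v w | w. w \<in> free_module n (length (D (i + 2)))})"

text \<open>
  The number of copies of \<open>R(-j)\<close> in homological degree \<open>i\<close> of the graded minimal free
  resolution of \<open>R/I\<close>; it does not depend on the choice of the resolution.
\<close>

definition graded_betti :: "nat \<Rightarrow> 'k::field mpoly set \<Rightarrow> nat \<Rightarrow> int \<Rightarrow> nat" where
  "graded_betti n I i j =
     (THE b. \<exists>D \<phi>. min_graded_free_resolution n I D \<phi> \<and> b = count_list (D i) j)"

end

theory Submission
  imports Defs
begin

text \<open>
  Vertices are counted modulo \<open>n\<close>, and an arc is a set of \<open>t\<close> consecutive vertices.  A path with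
  \<open>t\<close> vertices in the cycle runs along an arc, so the ideal consists of the polynomials all of
  whose monomials have a support containing an arc (\<open>path_ideal_cycle\<close>).

  \<^bold>\<open>From modules to linear algebra.\<close>  A free resolution whose basis elements sit in squarefree
  multidegrees is the same as a finite complex of vector spaces whose cells carry subsets of the
  variables; exactness over \<open>R\<close> means exactness over \<open>K\<close> of the subcomplexes of cells with degree
  inside a given set \<open>U\<close> that contains an arc (\<open>resolution_of_multigraded\<close>).  The Taylor complex on the arcs is such a
  complex: the cells are the sets of arcs, the degree of a cell is the union of its arcs, and every
  subcomplex that contains an arc is a cone.  As long as two cells of the same degree have a nonzero
  incidence coefficient, both can be cancelled by Gaussian elimination.  This ends in a minimal
  resolution (\<open>minimal_multigraded_resolution\<close>), and it changes neither the Euler characteristic nor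
  the vanishing of homology of the strand of cells of a fixed degree \<open>W\<close>.  So if the homology of the strand
  of \<open>W\<close> in the Taylor complex is concentrated in one homological degree \<open>k\<close>, its dimension is
  read off from the Euler characteristic, and the minimal resolution has exactly that many cells of
  degree \<open>W\<close>, all of them in homological degree \<open>k\<close>.

  \<^bold>\<open>Independence of the resolution.\<close>  Two minimal graded resolutions of \<open>R/I\<close> are compared by
  homogeneous chain maps in both directions.  Their composition is homotopic to the identity, and by
  minimality the homotopy does not affect constant terms, so the constant terms are mutually inverse
  matrices in each degree (\<open>graded_betti_eqI\<close>).

  \<^bold>\<open>The strands.\<close>  The strand of \<open>W\<close> consists of the sets of arcs inside \<open>W\<close> that cover \<open>W\<close>.
  Families of covers shrink by two moves: when one arc covers all that another covers, the larger
  one may be discarded, and an arc that alone reaches some point belongs to every cover.  When \<open>W\<close>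
  misses a vertex, the cycle can be cut there, and the moves consume \<open>W\<close> from its top: \<open>t\<close> vertices
  followed by a gap need one arc, \<open>t + 1\<close> vertices need two, and if neither fits the homology is zero
  (\<open>concentrated_line\<close>).  Hence \<open>W\<close> contributes exactly when it is spelled by a word made of such
  pieces and of missing vertices; with \<open>a\<close> pieces, \<open>b\<close> of them of length \<open>t + 1\<close>, it
  contributes one cell in homological degree \<open>i = a + b\<close> with \<open>j = \<bar>W\<bar> = t a + b\<close>.  Thus
  \<open>a = (j - i)/(t - 1)\<close> and \<open>b = (t i - j)/(t - 1)\<close>.  When \<open>W\<close> is the whole cycle, the covers
  that really need arc \<open>0\<close> are sorted by the position of the last arc before it, which again leaves
  linear covering problems (\<open>concentrated_cycle_large\<close>); they give \<open>t\<close> cells if \<open>d = 0\<close> and one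
  otherwise.

  \<^bold>\<open>The count.\<close>  Words are counted by a Pascal-type recursion (\<open>card_tilings\<close>) when vertex \<open>0\<close>
  is missing.  Since every \<open>W\<close> misses \<open>n - j\<close> vertices and strands are invariant under rotation,
  \<open>n - j\<close> times the Betti number is \<open>n\<close> times that count (\<open>sum_strands_missing_0\<close>).  This is
  the factor \<open>n / (n - t a)\<close> in the formula.
\<close>

section \<open>Based complexes over a field\<close>

text \<open>
  The coefficient \<open>a \<sigma> \<tau>\<close> says how often \<open>\<tau>\<close> occurs in the boundary of \<open>\<sigma>\<close>.  All sums run over
  the set \<open>X\<close> only, so that one matrix \<open>a\<close> serves a complex and all its subquotients.
\<close>

definition complex_on :: "('c \<Rightarrow> nat) \<Rightarrow> ('c \<Rightarrow> 'c \<Rightarrow> 'k::field) \<Rightarrow> 'c set \<Rightarrow> bool" where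
  "complex_on dm a X \<longleftrightarrow> finite X \<and>
     (\<forall>\<sigma>\<in>X. \<forall>\<tau>\<in>X. a \<sigma> \<tau> \<noteq> 0 \<longrightarrow> dm \<sigma> = Suc (dm \<tau>)) \<and>
     (\<forall>\<sigma>\<in>X. \<forall>\<rho>\<in>X. (\<Sum>\<tau>\<in>X. a \<sigma> \<tau> * a \<tau> \<rho>) = 0)"

text \<open>
  Chains are functions on all cells that vanish outside \<open>X\<close> and off dimension \<open>k\<close>; they can then be
  restricted to subsets of cells and added without changing types.
\<close>

definition chain_in :: "('c \<Rightarrow> nat) \<Rightarrow> 'c set \<Rightarrow> nat \<Rightarrow> ('c \<Rightarrow> 'k::field) \<Rightarrow> bool" where
  "chain_in dm X k x \<longleftrightarrow> (\<forall>\<sigma>. x \<sigma> \<noteq> 0 \<longrightarrow> \<sigma> \<in> X \<and> dm \<sigma> = k)"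

definition exact_at :: "('c \<Rightarrow> nat) \<Rightarrow> ('c \<Rightarrow> 'c \<Rightarrow> 'k::field) \<Rightarrow> 'c set \<Rightarrow> nat \<Rightarrow> bool" where
  "exact_at dm a X k \<longleftrightarrow>
     (\<forall>x. chain_in dm X k x \<longrightarrow> (\<forall>\<tau>\<in>X. (\<Sum>\<sigma>\<in>X. x \<sigma> * a \<sigma> \<tau>) = 0) \<longrightarrow>
        (\<exists>y. chain_in dm X (Suc k) y \<and> (\<forall>\<tau>\<in>X. (\<Sum>\<sigma>\<in>X. y \<sigma> * a \<sigma> \<tau>) = x \<tau>)))"

lemma exact_atD:
  assumes "exact_at dm a X k" "chain_in dm X k x" "\<And>\<tau>. \<tau> \<in> X \<Longrightarrow> (\<Sum>\<sigma>\<in>X. x \<sigma> * a \<sigma> \<tau>) = 0"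
  shows "\<exists>y. chain_in dm X (Suc k) y \<and> (\<forall>\<tau>\<in>X. (\<Sum>\<sigma>\<in>X. y \<sigma> * a \<sigma> \<tau>) = x \<tau>)"
  using assms unfolding exact_at_def by blast

lemma exact_atI:
  assumes "\<And>x. chain_in dm X k x \<Longrightarrow> (\<And>\<tau>. \<tau> \<in> X \<Longrightarrow> (\<Sum>\<sigma>\<in>X. x \<sigma> * a \<sigma> \<tau>) = 0) \<Longrightarrow>
     \<exists>y. chain_in dm X (Suc k) y \<and> (\<forall>\<tau>\<in>X. (\<Sum>\<sigma>\<in>X. y \<sigma> * a \<sigma> \<tau>) = x \<tau>)"
  shows "exact_at dm a X k"
  using assms unfolding exact_at_def by blast

lemma exact_at_no_cells:
  assumes "\<And>\<sigma>. \<sigma> \<in> X \<Longrightarrow> dm \<sigma> \<noteq> k"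
  shows "exact_at dm a X k"
proof (rule exact_atI)
  fix x :: "'a \<Rightarrow> 'b" assume "chain_in dm X k x"
  hence "\<And>\<sigma>. x \<sigma> = 0" using assms unfolding chain_in_def by blast
  thus "\<exists>y. chain_in dm X (Suc k) y \<and> (\<forall>\<tau>\<in>X. (\<Sum>\<sigma>\<in>X. y \<sigma> * a \<sigma> \<tau>) = x \<tau>)"
    by (intro exI[of _ "\<lambda>_. 0"]) (auto simp: chain_in_def)
qed

lemma complex_on_finite: "complex_on dm a X \<Longrightarrow> finite X"
  by (simp add: complex_on_def)

lemma complex_on_dim: "complex_on dm a X \<Longrightarrow> \<sigma> \<in> X \<Longrightarrow> \<tau> \<in> X \<Longrightarrow> a \<sigma> \<tau> \<noteq> 0 \<Longrightarrow> dm \<sigma> = Suc (dm \<tau>)"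
  by (simp add: complex_on_def)

lemma complex_on_square: "complex_on dm a X \<Longrightarrow> \<sigma> \<in> X \<Longrightarrow> \<rho> \<in> X \<Longrightarrow> (\<Sum>\<tau>\<in>X. a \<sigma> \<tau> * a \<tau> \<rho>) = 0"
  by (simp add: complex_on_def)

lemma boundary_of_boundary:
  assumes "complex_on dm a X" "\<rho> \<in> X"
  shows "(\<Sum>\<tau>\<in>X. (\<Sum>\<sigma>\<in>X. y \<sigma> * a \<sigma> \<tau>) * a \<tau> \<rho>) = 0"
proof -
  have "(\<Sum>\<tau>\<in>X. (\<Sum>\<sigma>\<in>X. y \<sigma> * a \<sigma> \<tau>) * a \<tau> \<rho>) = (\<Sum>\<tau>\<in>X. \<Sum>\<sigma>\<in>X. y \<sigma> * (a \<sigma> \<tau> * a \<tau> \<rho>))"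
    by (simp add: sum_distrib_right mult.assoc)
  also have "\<dots> = (\<Sum>\<sigma>\<in>X. y \<sigma> * (\<Sum>\<tau>\<in>X. a \<sigma> \<tau> * a \<tau> \<rho>))"
    by (subst sum.swap) (simp add: sum_distrib_left)
  also have "\<dots> = 0" using complex_on_square[OF assms(1) _ assms(2)] by simp
  finally show ?thesis .
qed

lemma chain_in_boundary:
  assumes "complex_on dm a X" "chain_in dm X (Suc k) y"
  shows "chain_in dm X k (\<lambda>\<tau>. if \<tau> \<in> X then \<Sum>\<sigma>\<in>X. y \<sigma> * a \<sigma> \<tau> else 0)"
  unfolding chain_in_def
proof (intro allI impI)
  fix \<tau> assume nz: "(if \<tau> \<in> X then \<Sum>\<sigma>\<in>X. y \<sigma> * a \<sigma> \<tau> else 0) \<noteq> 0"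
  hence \<tau>: "\<tau> \<in> X" by (auto split: if_splits)
  with nz obtain \<sigma> where "\<sigma> \<in> X" "y \<sigma> * a \<sigma> \<tau> \<noteq> 0" by (meson sum.neutral)
  hence "dm \<sigma> = Suc k" "dm \<sigma> = Suc (dm \<tau>)"
    using assms(2) complex_on_dim[OF assms(1) _ \<tau>] unfolding chain_in_def by auto
  thus "\<tau> \<in> X \<and> dm \<tau> = k" using \<tau> by simp
qed

text \<open>
  If \<open>B\<close> spans a subcomplex, the rest \<open>A\<close> carries the quotient complex, and the long exact
  sequence gives exactness of the whole from exactness of both parts.
\<close>

lemma exact_at_extension:
  assumes cx: "complex_on dm a X" and X: "X = A \<union> B" "A \<inter> B = {}"
    and sub: "\<And>\<sigma> \<tau>. \<sigma> \<in> B \<Longrightarrow> \<tau> \<in> A \<Longrightarrow> a \<sigma> \<tau> = 0"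
    and exA: "exact_at dm a A k" and exB: "exact_at dm a B k"
  shows "exact_at dm a X k"
proof (rule exact_atI)
  fix x assume x: "chain_in dm X k x" and cyc: "\<And>\<tau>. \<tau> \<in> X \<Longrightarrow> (\<Sum>\<sigma>\<in>X. x \<sigma> * a \<sigma> \<tau>) = 0"
  have fin: "finite A" "finite B" using complex_on_finite[OF cx] X by auto
  have splitX: "(\<Sum>\<sigma>\<in>X. f \<sigma>) = (\<Sum>\<sigma>\<in>A. f \<sigma>) + (\<Sum>\<sigma>\<in>B. f \<sigma>)" for f :: "'a \<Rightarrow> 'b"
    unfolding X(1) using fin X(2) by (simp add: sum.union_disjoint)
  have onA: "(\<Sum>\<sigma>\<in>X. f \<sigma> * a \<sigma> \<tau>) = (\<Sum>\<sigma>\<in>A. f \<sigma> * a \<sigma> \<tau>)" if "\<tau> \<in> A" for f \<tau>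
    unfolding splitX using sub that by simp
  \<comment> \<open>Fill the image of \<open>x\<close> in the quotient; the difference \<open>x2\<close> lives on the subcomplex.\<close>
  let ?xA = "\<lambda>\<sigma>. if \<sigma> \<in> A then x \<sigma> else 0"
  have c1: "chain_in dm A k ?xA" using x by (auto simp: chain_in_def)
  have c2: "(\<Sum>\<sigma>\<in>A. ?xA \<sigma> * a \<sigma> \<tau>) = 0" if "\<tau> \<in> A" for \<tau>
    using cyc[of \<tau>] onA[OF that, of x] that X by simp
  obtain y where y: "chain_in dm A (Suc k) y"
    and yA: "\<And>\<tau>. \<tau> \<in> A \<Longrightarrow> (\<Sum>\<sigma>\<in>A. y \<sigma> * a \<sigma> \<tau>) = ?xA \<tau>"
    using exact_atD[OF exA c1 c2] by blast
  have yX: "chain_in dm X (Suc k) y" using y X by (auto simp: chain_in_def)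
  define dy where "dy = (\<lambda>\<tau>. if \<tau> \<in> X then \<Sum>\<sigma>\<in>X. y \<sigma> * a \<sigma> \<tau> else 0)"
  define x2 where "x2 = (\<lambda>\<tau>. x \<tau> - dy \<tau>)"
  have dy: "chain_in dm X k dy" unfolding dy_def by (rule chain_in_boundary[OF cx yX])
  have zeroA: "x2 \<tau> = 0" if "\<tau> \<in> A" for \<tau>
    using yA[OF that] onA[OF that, of y] that X by (simp add: x2_def dy_def)
  have x2: "chain_in dm B k x2"
    unfolding chain_in_def
  proof (intro allI impI)
    fix \<sigma> assume nz: "x2 \<sigma> \<noteq> 0"
    hence "x \<sigma> \<noteq> 0 \<or> dy \<sigma> \<noteq> 0" by (auto simp: x2_def)
    hence "\<sigma> \<in> X \<and> dm \<sigma> = k" using x dy unfolding chain_in_def by blast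
    thus "\<sigma> \<in> B \<and> dm \<sigma> = k" using zeroA nz X by auto
  qed
  have c3: "(\<Sum>\<tau>\<in>B. x2 \<tau> * a \<tau> \<rho>) = 0" if "\<rho> \<in> B" for \<rho>
  proof -
    have \<rho>: "\<rho> \<in> X" using that X by simp
    have "(\<Sum>\<tau>\<in>B. x2 \<tau> * a \<tau> \<rho>) = (\<Sum>\<tau>\<in>X. x2 \<tau> * a \<tau> \<rho>)" unfolding splitX using zeroA by simp
    also have "\<dots> = (\<Sum>\<tau>\<in>X. x \<tau> * a \<tau> \<rho>) - (\<Sum>\<tau>\<in>X. dy \<tau> * a \<tau> \<rho>)"
      by (simp add: x2_def left_diff_distrib sum_subtractf)
    also have "(\<Sum>\<tau>\<in>X. dy \<tau> * a \<tau> \<rho>) = 0"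
      using boundary_of_boundary[OF cx \<rho>, of y] by (simp add: dy_def)
    finally show ?thesis using cyc[OF \<rho>] by simp
  qed
  obtain z where z: "chain_in dm B (Suc k) z"
    and zB: "\<And>\<tau>. \<tau> \<in> B \<Longrightarrow> (\<Sum>\<sigma>\<in>B. z \<sigma> * a \<sigma> \<tau>) = x2 \<tau>"
    using exact_atD[OF exB x2 c3] by blast
  have z0: "z \<sigma> = 0" if "\<sigma> \<in> A" for \<sigma> using z that X unfolding chain_in_def by blast
  have "chain_in dm X (Suc k) (\<lambda>\<sigma>. y \<sigma> + z \<sigma>)"
    unfolding chain_in_def
  proof (intro allI impI)
    fix \<sigma> assume "y \<sigma> + z \<sigma> \<noteq> 0"
    hence "y \<sigma> \<noteq> 0 \<or> z \<sigma> \<noteq> 0" by auto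
    thus "\<sigma> \<in> X \<and> dm \<sigma> = Suc k" using y z X unfolding chain_in_def by blast
  qed
  moreover have "(\<Sum>\<sigma>\<in>X. (y \<sigma> + z \<sigma>) * a \<sigma> \<tau>) = x \<tau>" if \<tau>: "\<tau> \<in> X" for \<tau>
  proof -
    have "(\<Sum>\<sigma>\<in>X. (y \<sigma> + z \<sigma>) * a \<sigma> \<tau>) = dy \<tau> + (\<Sum>\<sigma>\<in>X. z \<sigma> * a \<sigma> \<tau>)"
      using \<tau> by (simp add: dy_def distrib_right sum.distrib)
    also have "(\<Sum>\<sigma>\<in>X. z \<sigma> * a \<sigma> \<tau>) = (\<Sum>\<sigma>\<in>B. z \<sigma> * a \<sigma> \<tau>)" unfolding splitX using z0 by simp
    also have "\<dots> = x2 \<tau>"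
    proof (cases "\<tau> \<in> B")
      case False
      hence "\<tau> \<in> A" using \<tau> X by simp
      thus ?thesis using sub zeroA by simp
    qed (rule zB)
    finally show ?thesis by (simp add: x2_def)
  qed
  ultimately show "\<exists>y. chain_in dm X (Suc k) y \<and> (\<forall>\<tau>\<in>X. (\<Sum>\<sigma>\<in>X. y \<sigma> * a \<sigma> \<tau>) = x \<tau>)" by blast
qed

lemma complex_on_upper:
  assumes cx: "complex_on dm a X" and mono: "\<And>\<sigma> \<tau>. \<sigma> \<in> X \<Longrightarrow> \<tau> \<in> X \<Longrightarrow> a \<sigma> \<tau> \<noteq> 0 \<Longrightarrow> f \<sigma> \<le> (f \<tau> :: nat)"
  shows "complex_on dm a {\<sigma>\<in>X. r \<le> f \<sigma>}"
proof -
  have "(\<Sum>\<tau>\<in>{\<sigma>\<in>X. r \<le> f \<sigma>}. a \<sigma> \<tau> * a \<tau> \<rho>) = (\<Sum>\<tau>\<in>X. a \<sigma> \<tau> * a \<tau> \<rho>)"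
    if "\<sigma> \<in> X" "r \<le> f \<sigma>" for \<sigma> \<rho>
  proof (rule sum.mono_neutral_left[OF complex_on_finite[OF cx]])
    show "\<forall>\<tau>\<in>X - {\<sigma>\<in>X. r \<le> f \<sigma>}. a \<sigma> \<tau> * a \<tau> \<rho> = 0"
    proof
      fix \<tau> assume "\<tau> \<in> X - {\<sigma>\<in>X. r \<le> f \<sigma>}"
      hence "a \<sigma> \<tau> = 0" using mono[of \<sigma> \<tau>] that by fastforce
      thus "a \<sigma> \<tau> * a \<tau> \<rho> = 0" by simp
    qed
  qed auto
  thus ?thesis using cx unfolding complex_on_def by simp
qed

text \<open>
  The filtration by a function that does not decrease along the differential reduces
  exactness to exactness of its fibres, by iterating the long exact sequence.
\<close>

lemma exact_at_fibres:
  assumes cx: "complex_on dm a X" and mono: "\<And>\<sigma> \<tau>. \<sigma> \<in> X \<Longrightarrow> \<tau> \<in> X \<Longrightarrow> a \<sigma> \<tau> \<noteq> 0 \<Longrightarrow> f \<sigma> \<le> (f \<tau> :: nat)"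
    and ex: "\<And>r. exact_at dm a {\<sigma>\<in>X. f \<sigma> = r} k"
  shows "exact_at dm a X k"
proof -
  have fin: "finite X" by (rule complex_on_finite[OF cx])
  define M where "M = Suc (Max (insert 0 (f ` X)))"
  have M: "f \<sigma> < M" if "\<sigma> \<in> X" for \<sigma>
    unfolding M_def using Max_ge[of "insert 0 (f ` X)" "f \<sigma>"] fin that by (simp add: less_Suc_eq_le)
  have "exact_at dm a {\<sigma>\<in>X. M - r \<le> f \<sigma>} k" for r
  proof (induction r)
    case 0
    have "{\<sigma>\<in>X. M - 0 \<le> f \<sigma>} = {}" using M by force
    thus ?case by (metis empty_iff exact_at_no_cells)
  next
    case (Suc r)
    show ?case
    proof (cases "M - r = 0")
      case True
      hence "M - Suc r = M - r" by simp
      thus ?thesis using Suc by simp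
    next
      case False
      hence E: "M - r = Suc (M - Suc r)" by simp
      show ?thesis
      proof (rule exact_at_extension[where A = "{\<sigma>\<in>X. f \<sigma> = M - Suc r}" and B = "{\<sigma>\<in>X. M - r \<le> f \<sigma>}"])
        show "complex_on dm a {\<sigma>\<in>X. M - Suc r \<le> f \<sigma>}" by (rule complex_on_upper[where f = f, OF cx mono])
        show "{\<sigma>\<in>X. M - Suc r \<le> f \<sigma>} = {\<sigma>\<in>X. f \<sigma> = M - Suc r} \<union> {\<sigma>\<in>X. M - r \<le> f \<sigma>}"
          using E by auto
        show "{\<sigma>\<in>X. f \<sigma> = M - Suc r} \<inter> {\<sigma>\<in>X. M - r \<le> f \<sigma>} = {}" using E by auto
        show "a \<sigma> \<tau> = 0" if "\<sigma> \<in> {\<sigma>\<in>X. M - r \<le> f \<sigma>}" "\<tau> \<in> {\<sigma>\<in>X. f \<sigma> = M - Suc r}" for \<sigma> \<tau>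
          using mono[of \<sigma> \<tau>] that E by force
      qed (use ex Suc in auto)
    qed
  qed
  from this[of M] show ?thesis by simp
qed

text \<open>An isomorphism of complexes that rescales the basis cells by signs.\<close>

lemma exact_at_transfer:
  assumes bij: "bij_betw F X Y" and dm: "\<And>\<sigma>. \<sigma> \<in> X \<Longrightarrow> dm' (F \<sigma>) = dm \<sigma> + c"
    and a: "\<And>\<sigma> \<tau>. \<sigma> \<in> X \<Longrightarrow> \<tau> \<in> X \<Longrightarrow> a' (F \<sigma>) (F \<tau>) = e * g \<sigma> * a \<sigma> \<tau> * g \<tau>"
    and e: "e * e = 1" and g: "\<And>\<sigma>. \<sigma> \<in> X \<Longrightarrow> g \<sigma> * g \<sigma> = 1"
    and ex: "exact_at dm a X k"
  shows "exact_at dm' a' Y (k + c)"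
proof (rule exact_atI)
  fix x assume x: "chain_in dm' Y (k + c) x" and cyc: "\<And>\<tau>. \<tau> \<in> Y \<Longrightarrow> (\<Sum>\<sigma>\<in>Y. x \<sigma> * a' \<sigma> \<tau>) = 0"
  have FY: "F \<sigma> \<in> Y" if "\<sigma> \<in> X" for \<sigma> using bij that by (auto simp: bij_betw_def)
  define G where "G = inv_into X F"
  have GX: "G \<sigma> \<in> X" and FG: "F (G \<sigma>) = \<sigma>" if "\<sigma> \<in> Y" for \<sigma>
    unfolding G_def using bij_betw_inv_into_right[OF bij that] inv_into_into[of \<sigma> F X] bij that
    by (auto simp: bij_betw_def)
  have GF: "G (F \<sigma>) = \<sigma>" if "\<sigma> \<in> X" for \<sigma> unfolding G_def by (rule bij_betw_inv_into_left[OF bij that])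
  have sumY: "(\<Sum>\<sigma>\<in>Y. f \<sigma>) = (\<Sum>\<sigma>\<in>X. f (F \<sigma>))" for f :: "_ \<Rightarrow> 'c"
    by (rule sum.reindex_bij_betw[OF bij, symmetric])
  define x0 where "x0 = (\<lambda>\<sigma>. if \<sigma> \<in> X then x (F \<sigma>) * g \<sigma> else 0)"
  have x0: "chain_in dm X k x0"
    unfolding chain_in_def
  proof (intro allI impI)
    fix \<sigma> assume "x0 \<sigma> \<noteq> 0"
    hence \<sigma>: "\<sigma> \<in> X" "x (F \<sigma>) \<noteq> 0" by (auto simp: x0_def split: if_splits)
    thus "\<sigma> \<in> X \<and> dm \<sigma> = k" using x dm[OF \<sigma>(1)] unfolding chain_in_def by auto
  qed
  have c0: "(\<Sum>\<sigma>\<in>X. x0 \<sigma> * a \<sigma> \<tau>) = 0" if \<tau>: "\<tau> \<in> X" for \<tau>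
  proof -
    have "0 = (\<Sum>\<sigma>\<in>X. x (F \<sigma>) * a' (F \<sigma>) (F \<tau>))" using cyc[OF FY[OF \<tau>]] sumY by simp
    also have "\<dots> = (\<Sum>\<sigma>\<in>X. (e * g \<tau>) * (x0 \<sigma> * a \<sigma> \<tau>))"
      by (rule sum.cong) (auto simp: a \<tau> x0_def algebra_simps)
    also have "\<dots> = (e * g \<tau>) * (\<Sum>\<sigma>\<in>X. x0 \<sigma> * a \<sigma> \<tau>)" by (simp add: sum_distrib_left)
    finally show ?thesis using e g[OF \<tau>] by fastforce
  qed
  obtain y where y: "chain_in dm X (Suc k) y" "\<And>\<tau>. \<tau> \<in> X \<Longrightarrow> (\<Sum>\<sigma>\<in>X. y \<sigma> * a \<sigma> \<tau>) = x0 \<tau>"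
    using exact_atD[OF ex x0 c0] by blast
  define y' where "y' = (\<lambda>\<sigma>. if \<sigma> \<in> Y then e * g (G \<sigma>) * y (G \<sigma>) else 0)"
  have "chain_in dm' Y (Suc (k + c)) y'"
    unfolding chain_in_def
  proof (intro allI impI)
    fix \<sigma> assume "y' \<sigma> \<noteq> 0"
    hence \<sigma>: "\<sigma> \<in> Y" "y (G \<sigma>) \<noteq> 0" by (auto simp: y'_def split: if_splits)
    thus "\<sigma> \<in> Y \<and> dm' \<sigma> = Suc (k + c)"
      using y(1) dm[OF GX[OF \<sigma>(1)]] FG[OF \<sigma>(1)] unfolding chain_in_def by auto
  qed
  moreover have "(\<Sum>\<sigma>\<in>Y. y' \<sigma> * a' \<sigma> \<tau>) = x \<tau>" if \<tau>: "\<tau> \<in> Y" for \<tau>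
  proof -
    define \<rho> where "\<rho> = G \<tau>"
    have \<rho>: "\<rho> \<in> X" "\<tau> = F \<rho>" using GX FG \<tau> by (auto simp: \<rho>_def)
    have "(\<Sum>\<sigma>\<in>Y. y' \<sigma> * a' \<sigma> \<tau>) = (\<Sum>\<sigma>\<in>X. (e * g \<sigma> * y \<sigma>) * (e * g \<sigma> * a \<sigma> \<rho> * g \<rho>))"
      unfolding sumY \<rho>(2) by (rule sum.cong) (auto simp: a \<rho> y'_def FY GF)
    also have "\<dots> = (\<Sum>\<sigma>\<in>X. (e * e) * (g \<sigma> * g \<sigma>) * (y \<sigma> * a \<sigma> \<rho>) * g \<rho>)"
      by (rule sum.cong) (auto simp: algebra_simps)
    also have "\<dots> = (\<Sum>\<sigma>\<in>X. y \<sigma> * a \<sigma> \<rho>) * g \<rho>" by (simp add: e g sum_distrib_right)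
    also have "\<dots> = x (F \<rho>) * (g \<rho> * g \<rho>)" using y(2)[OF \<rho>(1)] \<rho> by (simp add: x0_def mult.assoc)
    finally show ?thesis using g \<rho> by simp
  qed
  ultimately show "\<exists>y. chain_in dm' Y (Suc (k + c)) y \<and> (\<forall>\<tau>\<in>Y. (\<Sum>\<sigma>\<in>Y. y \<sigma> * a' \<sigma> \<tau>) = x \<tau>)" by blast
qed

text \<open>
  Gaussian elimination: when \<open>a \<sigma>0 \<tau>0\<close> is a unit, both cells can be removed, at the cost of the
  zig-zag correction through \<open>\<sigma>0 \<leftarrow> \<tau>0\<close>.
\<close>

definition cancel :: "('c \<Rightarrow> 'c \<Rightarrow> 'k::field) \<Rightarrow> 'c \<Rightarrow> 'c \<Rightarrow> 'c \<Rightarrow> 'c \<Rightarrow> 'k" where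
  "cancel a \<sigma>0 \<tau>0 \<sigma> \<tau> = a \<sigma> \<tau> - a \<sigma> \<tau>0 * inverse (a \<sigma>0 \<tau>0) * a \<sigma>0 \<tau>"

text \<open>
  The corrected matrix vanishes in the column of \<open>\<tau>0\<close> and in the row of \<open>\<sigma>0\<close>, so its square may be
  computed over all of \<open>X\<close>, where it reduces to four instances of \<open>a\<^sup>2 = 0\<close>.
\<close>

lemma complex_on_cancel:
  assumes cx: "complex_on dm a X" and in_X: "\<sigma>0 \<in> X" "\<tau>0 \<in> X" and nz: "a \<sigma>0 \<tau>0 \<noteq> 0"
  shows "complex_on dm (cancel a \<sigma>0 \<tau>0) (X - {\<sigma>0, \<tau>0})"
proof -
  let ?a = "cancel a \<sigma>0 \<tau>0" and ?X = "X - {\<sigma>0, \<tau>0}" and ?c = "inverse (a \<sigma>0 \<tau>0)"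
  have fin: "finite X" by (rule complex_on_finite[OF cx])
  have "dm \<sigma> = Suc (dm \<tau>)" if "\<sigma> \<in> ?X" "\<tau> \<in> ?X" "?a \<sigma> \<tau> \<noteq> 0" for \<sigma> \<tau>
  proof (cases "a \<sigma> \<tau> = 0")
    case True
    hence "a \<sigma> \<tau>0 \<noteq> 0" "a \<sigma>0 \<tau> \<noteq> 0" using that by (auto simp: cancel_def)
    hence "dm \<sigma> = Suc (dm \<tau>0)" "dm \<sigma>0 = Suc (dm \<tau>)"
      using complex_on_dim[OF cx, of \<sigma> \<tau>0] complex_on_dim[OF cx, of \<sigma>0 \<tau>] in_X that by auto
    moreover have "dm \<sigma>0 = Suc (dm \<tau>0)" using complex_on_dim[OF cx in_X nz] .
    ultimately show ?thesis by simp
  next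
    case False thus ?thesis using complex_on_dim[OF cx] that by simp
  qed
  moreover have "(\<Sum>\<tau>\<in>?X. ?a \<sigma> \<tau> * ?a \<tau> \<rho>) = 0" if \<sigma>: "\<sigma> \<in> X" and \<rho>: "\<rho> \<in> X" for \<sigma> \<rho>
  proof -
    have "?a \<sigma> \<tau> * ?a \<tau> \<rho> = 0" if "\<tau> \<in> {\<sigma>0, \<tau>0}" for \<tau>
      using that nz by (auto simp: cancel_def)
    hence "(\<Sum>\<tau>\<in>?X. ?a \<sigma> \<tau> * ?a \<tau> \<rho>) = (\<Sum>\<tau>\<in>X. ?a \<sigma> \<tau> * ?a \<tau> \<rho>)"
      by (intro sum.mono_neutral_left) (use fin in auto)
    also have "\<dots> = (\<Sum>\<tau>\<in>X. a \<sigma> \<tau> * a \<tau> \<rho>) - (\<Sum>\<tau>\<in>X. a \<sigma> \<tau> * a \<tau> \<tau>0) * (?c * a \<sigma>0 \<rho>)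
        - (a \<sigma> \<tau>0 * ?c) * (\<Sum>\<tau>\<in>X. a \<sigma>0 \<tau> * a \<tau> \<rho>)
        + (a \<sigma> \<tau>0 * ?c) * (\<Sum>\<tau>\<in>X. a \<sigma>0 \<tau> * a \<tau> \<tau>0) * (?c * a \<sigma>0 \<rho>)"
      unfolding sum_distrib_left sum_distrib_right sum_subtractf[symmetric] sum.distrib[symmetric]
      by (rule sum.cong) (auto simp: cancel_def algebra_simps)
    also have "\<dots> = 0" by (simp only: complex_on_square[OF cx] \<sigma> \<rho> in_X) simp
    finally show ?thesis .
  qed
  ultimately show ?thesis unfolding complex_on_def using fin by simp
qed

text \<open>
  A cycle of the smaller complex becomes a cycle of the larger one after adding the multiple of \<open>\<sigma>0\<close>
  that kills its boundary at \<open>\<tau>0\<close>; its boundary at \<open>\<sigma>0\<close> then vanishes because the boundary of a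
  boundary does.
\<close>

lemma exact_at_cancel:
  assumes cx: "complex_on dm a X" and in_X: "\<sigma>0 \<in> X" "\<tau>0 \<in> X" and nz: "a \<sigma>0 \<tau>0 \<noteq> 0"
    and ex: "exact_at dm a X k"
  shows "exact_at dm (cancel a \<sigma>0 \<tau>0) (X - {\<sigma>0, \<tau>0}) k"
proof (rule exact_atI)
  let ?a = "cancel a \<sigma>0 \<tau>0" and ?X = "X - {\<sigma>0, \<tau>0}" and ?c = "inverse (a \<sigma>0 \<tau>0)"
  fix x' assume x': "chain_in dm ?X k x'" and cyc: "\<And>\<tau>. \<tau> \<in> ?X \<Longrightarrow> (\<Sum>\<sigma>\<in>?X. x' \<sigma> * ?a \<sigma> \<tau>) = 0"
  have fin: "finite X" by (rule complex_on_finite[OF cx])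
  have d0: "dm \<sigma>0 = Suc (dm \<tau>0)" using complex_on_dim[OF cx in_X] nz by simp
  hence ne: "\<sigma>0 \<noteq> \<tau>0" by auto
  have a\<tau>\<tau>: "a \<tau>0 \<tau>0 = 0" using complex_on_dim[OF cx in_X(2,2)] by fastforce
  have splitX: "(\<Sum>\<sigma>\<in>X. f \<sigma>) = f \<sigma>0 + f \<tau>0 + (\<Sum>\<sigma>\<in>?X. f \<sigma>)" for f :: "'a \<Rightarrow> 'b"
  proof -
    have "X = insert \<sigma>0 (insert \<tau>0 ?X)" using in_X by auto
    hence "(\<Sum>\<sigma>\<in>X. f \<sigma>) = (\<Sum>\<sigma>\<in>insert \<sigma>0 (insert \<tau>0 ?X). f \<sigma>)" by simp
    thus ?thesis using fin ne by (simp add: add.assoc)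
  qed
  have sum': "(\<Sum>\<sigma>\<in>?X. f \<sigma> * ?a \<sigma> \<tau>)
      = (\<Sum>\<sigma>\<in>?X. f \<sigma> * a \<sigma> \<tau>) - (\<Sum>\<sigma>\<in>?X. f \<sigma> * a \<sigma> \<tau>0) * ?c * a \<sigma>0 \<tau>" for f \<tau>
    unfolding sum_distrib_left sum_distrib_right sum_subtractf[symmetric]
    by (rule sum.cong) (auto simp: cancel_def algebra_simps)
  define p where "p = (\<Sum>\<sigma>\<in>?X. x' \<sigma> * a \<sigma> \<tau>0)"
  have x'0: "x' \<sigma>0 = 0" "x' \<tau>0 = 0" using x' unfolding chain_in_def by auto
  define x where "x = (\<lambda>\<sigma>. if \<sigma> = \<sigma>0 then - p * ?c else x' \<sigma>)"
  have sumx: "(\<Sum>\<sigma>\<in>X. x \<sigma> * a \<sigma> \<tau>) = (\<Sum>\<sigma>\<in>?X. x' \<sigma> * a \<sigma> \<tau>) - p * ?c * a \<sigma>0 \<tau>" for \<tau>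
  proof -
    have "(\<Sum>\<sigma>\<in>?X. x \<sigma> * a \<sigma> \<tau>) = (\<Sum>\<sigma>\<in>?X. x' \<sigma> * a \<sigma> \<tau>)" by (rule sum.cong) (auto simp: x_def)
    thus ?thesis unfolding splitX using ne x'0 by (simp add: x_def)
  qed
  have xc: "chain_in dm X k x"
    unfolding chain_in_def
  proof (intro allI impI)
    fix \<sigma> assume nz': "x \<sigma> \<noteq> 0"
    show "\<sigma> \<in> X \<and> dm \<sigma> = k"
    proof (cases "\<sigma> = \<sigma>0")
      case True
      hence "p \<noteq> 0" using nz' by (auto simp: x_def)
      then obtain \<tau> where "\<tau> \<in> ?X" "x' \<tau> * a \<tau> \<tau>0 \<noteq> 0" unfolding p_def by (meson sum.neutral)
      hence "dm \<tau> = k" "dm \<tau> = Suc (dm \<tau>0)" using x' complex_on_dim[OF cx _ in_X(2)] unfolding chain_in_def by auto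
      thus ?thesis using True in_X d0 by simp
    qed (use nz' x' in \<open>auto simp: x_def chain_in_def\<close>)
  qed
  have off: "(\<Sum>\<sigma>\<in>X. x \<sigma> * a \<sigma> \<tau>) = 0" if "\<tau> \<in> X" "\<tau> \<noteq> \<sigma>0" for \<tau>
  proof (cases "\<tau> = \<tau>0")
    case True thus ?thesis unfolding sumx using nz by (simp add: p_def)
  next
    case False
    thus ?thesis unfolding sumx using cyc[of \<tau>] sum'[of x' \<tau>] that by (simp add: p_def)
  qed
  have on: "(\<Sum>\<sigma>\<in>X. x \<sigma> * a \<sigma> \<sigma>0) = 0"
  proof -
    have "0 = (\<Sum>\<tau>\<in>X. (\<Sum>\<sigma>\<in>X. x \<sigma> * a \<sigma> \<tau>) * a \<tau> \<tau>0)"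
      by (rule boundary_of_boundary[OF cx in_X(2), symmetric])
    also have "\<dots> = (\<Sum>\<tau>\<in>{\<sigma>0}. (\<Sum>\<sigma>\<in>X. x \<sigma> * a \<sigma> \<tau>) * a \<tau> \<tau>0)"
      by (rule sum.mono_neutral_right) (use fin in_X off in auto)
    finally show ?thesis using nz by simp
  qed
  have cx0: "(\<Sum>\<sigma>\<in>X. x \<sigma> * a \<sigma> \<tau>) = 0" if "\<tau> \<in> X" for \<tau>
    using off[OF that] on by (cases "\<tau> = \<sigma>0") auto
  obtain y0 where y0: "chain_in dm X (Suc k) y0" and by0: "\<And>\<tau>. \<tau> \<in> X \<Longrightarrow> (\<Sum>\<sigma>\<in>X. y0 \<sigma> * a \<sigma> \<tau>) = x \<tau>"
    using exact_atD[OF ex xc cx0] by blast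
  \<comment> \<open>Subtracting a multiple of the boundary of \<open>\<sigma>0\<close> removes the \<open>\<tau>0\<close>-component.\<close>
  define y where "y = (\<lambda>\<sigma>. if \<sigma> \<in> X then y0 \<sigma> - y0 \<tau>0 * ?c * a \<sigma>0 \<sigma> else 0)"
  have y\<tau>: "y \<tau>0 = 0" using nz in_X by (simp add: y_def)
  have yc: "chain_in dm X (Suc k) y"
    unfolding chain_in_def
  proof (intro allI impI)
    fix \<sigma> assume nz': "y \<sigma> \<noteq> 0"
    hence \<sigma>: "\<sigma> \<in> X" by (auto simp: y_def split: if_splits)
    have "y0 \<sigma> \<noteq> 0 \<or> (y0 \<tau>0 \<noteq> 0 \<and> a \<sigma>0 \<sigma> \<noteq> 0)" using nz' \<sigma> by (auto simp: y_def)
    thus "\<sigma> \<in> X \<and> dm \<sigma> = Suc k"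
    proof
      assume h: "y0 \<tau>0 \<noteq> 0 \<and> a \<sigma>0 \<sigma> \<noteq> 0"
      hence "dm \<tau>0 = Suc k" "dm \<sigma>0 = Suc (dm \<sigma>)"
        using y0 complex_on_dim[OF cx in_X(1) \<sigma>] unfolding chain_in_def by auto
      thus ?thesis using \<sigma> d0 by simp
    qed (use y0 in \<open>auto simp: chain_in_def\<close>)
  qed
  have bdy: "(\<Sum>\<sigma>\<in>X. y \<sigma> * a \<sigma> \<tau>) = x \<tau>" if \<tau>: "\<tau> \<in> X" for \<tau>
  proof -
    have "(\<Sum>\<sigma>\<in>X. y \<sigma> * a \<sigma> \<tau>) = (\<Sum>\<sigma>\<in>X. y0 \<sigma> * a \<sigma> \<tau>) - y0 \<tau>0 * ?c * (\<Sum>\<sigma>\<in>X. a \<sigma>0 \<sigma> * a \<sigma> \<tau>)"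
      unfolding sum_distrib_left sum_subtractf[symmetric]
      by (rule sum.cong) (auto simp: y_def algebra_simps)
    thus ?thesis using by0[OF \<tau>] complex_on_square[OF cx in_X(1) \<tau>] by simp
  qed
  define y' where "y' = (\<lambda>\<sigma>. if \<sigma> \<in> ?X then y \<sigma> else 0)"
  have "chain_in dm ?X (Suc k) y'" using yc unfolding chain_in_def y'_def by auto
  moreover have "(\<Sum>\<sigma>\<in>?X. y' \<sigma> * ?a \<sigma> \<tau>) = x' \<tau>" if \<tau>: "\<tau> \<in> ?X" for \<tau>
  proof -
    have "x \<tau>0 = 0" using ne x'0 by (simp add: x_def)
    hence "y \<sigma>0 * a \<sigma>0 \<tau>0 + (\<Sum>\<sigma>\<in>?X. y \<sigma> * a \<sigma> \<tau>0) = 0"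
      using bdy[OF in_X(2)] unfolding splitX by (simp add: a\<tau>\<tau>)
    hence s: "(\<Sum>\<sigma>\<in>?X. y \<sigma> * a \<sigma> \<tau>0) * ?c = - y \<sigma>0" using nz by (simp add: field_simps add_eq_0_iff)
    have "(\<Sum>\<sigma>\<in>?X. y' \<sigma> * ?a \<sigma> \<tau>) = (\<Sum>\<sigma>\<in>?X. y \<sigma> * ?a \<sigma> \<tau>)" by (rule sum.cong) (auto simp: y'_def)
    also have "\<dots> = (\<Sum>\<sigma>\<in>?X. y \<sigma> * a \<sigma> \<tau>) + y \<sigma>0 * a \<sigma>0 \<tau>" unfolding sum' s by simp
    also have "\<dots> = (\<Sum>\<sigma>\<in>X. y \<sigma> * a \<sigma> \<tau>)" unfolding splitX using y\<tau> by simp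
    also have "\<dots> = x' \<tau>" using bdy \<tau> by (auto simp: x_def)
    finally show ?thesis .
  qed
  ultimately show "\<exists>y. chain_in dm ?X (Suc k) y \<and> (\<forall>\<tau>\<in>?X. (\<Sum>\<sigma>\<in>?X. y \<sigma> * ?a \<sigma> \<tau>) = x' \<tau>)" by blast
qed

section \<open>The simplicial differential on families of finite sets\<close>

definition pos_sign :: "'a::linorder \<Rightarrow> 'a set \<Rightarrow> 'k::field" where
  "pos_sign v \<tau> = (-1) ^ card {u\<in>\<tau>. u < v}"

text \<open>
  At most one summand is nonzero; summing over all \<open>v\<close> avoids choosing the vertex that is removed.
\<close>

definition bd :: "'a::linorder set \<Rightarrow> 'a set \<Rightarrow> 'k::field" where
  "bd \<sigma> \<tau> = (\<Sum>v\<in>\<sigma>. if \<tau> = \<sigma> - {v} then pos_sign v \<tau> else 0)"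

lemma bd_nonzeroE:
  assumes "bd \<sigma> \<tau> \<noteq> (0 :: 'k::field)"
  obtains v where "v \<notin> \<tau>" "\<sigma> = insert v \<tau>"
proof -
  obtain v where "v \<in> \<sigma>" "(if \<tau> = \<sigma> - {v} then pos_sign v \<tau> else 0) \<noteq> (0 :: 'k)"
    using assms unfolding bd_def by (rule sum.not_neutral_contains_not_neutral)
  hence "v \<notin> \<tau>" "\<sigma> = insert v \<tau>" by (auto split: if_splits)
  thus ?thesis by (rule that)
qed

lemma bd_insert:
  assumes "v \<notin> \<tau>" "finite \<tau>"
  shows "bd (insert v \<tau>) \<tau> = (pos_sign v \<tau> :: 'k::field)"
proof -
  have "(\<tau> = insert v \<tau> - {u}) = (u = v)" if "u \<in> insert v \<tau>" for u using assms that by auto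
  hence "bd (insert v \<tau>) \<tau> = (\<Sum>u\<in>insert v \<tau>. if u = v then pos_sign v \<tau> else 0 :: 'k)"
    unfolding bd_def by (intro sum.cong) auto
  thus ?thesis using assms by (simp add: sum.delta)
qed

lemma pos_sign_sq: "pos_sign v \<tau> * pos_sign v \<tau> = 1"
  unfolding pos_sign_def by (simp add: power_mult_distrib[symmetric])

lemma pos_sign_insert:
  assumes "finite \<tau>" "u \<notin> \<tau>"
  shows "pos_sign v (insert u \<tau>) = (if u < v then - pos_sign v \<tau> else pos_sign v \<tau>)"
proof -
  have "{w\<in>insert u \<tau>. w < v} = (if u < v then insert u {w\<in>\<tau>. w < v} else {w\<in>\<tau>. w < v})" by auto
  thus ?thesis using assms by (simp add: pos_sign_def)
qed

text \<open>
  Boundaries are computed by listing the vertices that can be added to \<open>\<tau>\<close>.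
\<close>

lemma sum_bd:
  assumes fin: "finite X" and \<tau>: "finite \<tau>"
  shows "(\<Sum>\<sigma>\<in>X. x \<sigma> * bd \<sigma> \<tau>) = (\<Sum>v | v \<notin> \<tau> \<and> insert v \<tau> \<in> X. x (insert v \<tau>) * pos_sign v \<tau>)"
proof -
  let ?V = "{v. v \<notin> \<tau> \<and> insert v \<tau> \<in> X}"
  have inj: "inj_on (\<lambda>v. insert v \<tau>) ?V" by (auto simp: inj_on_def)
  have "(\<Sum>\<sigma>\<in>X. x \<sigma> * bd \<sigma> \<tau>) = (\<Sum>\<sigma>\<in>(\<lambda>v. insert v \<tau>) ` ?V. x \<sigma> * bd \<sigma> \<tau>)"
  proof (rule sum.mono_neutral_right[OF fin])
    show "\<forall>\<sigma>\<in>X - (\<lambda>v. insert v \<tau>) ` ?V. x \<sigma> * bd \<sigma> \<tau> = 0"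
      by (auto elim!: bd_nonzeroE)
  qed auto
  also have "\<dots> = (\<Sum>v\<in>?V. x (insert v \<tau>) * bd (insert v \<tau>) \<tau>)" by (simp add: sum.reindex[OF inj])
  also have "\<dots> = (\<Sum>v\<in>?V. x (insert v \<tau>) * pos_sign v \<tau>)"
    by (rule sum.cong) (auto simp: bd_insert \<tau>)
  finally show ?thesis .
qed

text \<open>
  The cells of a relative simplicial complex: a difference of two simplicial complexes.
\<close>

definition convex_family :: "'a set set \<Rightarrow> bool" where
  "convex_family X \<longleftrightarrow> finite X \<and> (\<forall>\<sigma>\<in>X. finite \<sigma>) \<and>
     (\<forall>\<sigma>\<in>X. \<forall>\<rho>\<in>X. \<forall>\<tau>. \<rho> \<subseteq> \<tau> \<and> \<tau> \<subseteq> \<sigma> \<longrightarrow> \<tau> \<in> X)"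

text \<open>
  A face of codimension two is reached by removing its two extra vertices in either order, with
  opposite signs; convexity puts both intermediate faces into the family or neither.
\<close>

lemma complex_on_bd:
  assumes "convex_family X"
  shows "complex_on card bd X"
proof -
  have fin: "finite X" and cells: "\<And>\<sigma>. \<sigma> \<in> X \<Longrightarrow> finite \<sigma>"
    and conv: "\<And>\<sigma> \<rho> \<tau>. \<sigma> \<in> X \<Longrightarrow> \<rho> \<in> X \<Longrightarrow> \<rho> \<subseteq> \<tau> \<Longrightarrow> \<tau> \<subseteq> \<sigma> \<Longrightarrow> \<tau> \<in> X"
    using assms unfolding convex_family_def by blast+
  have "card \<sigma> = Suc (card \<tau>)" if "\<sigma> \<in> X" "\<tau> \<in> X" "bd \<sigma> \<tau> \<noteq> (0::'b)" for \<sigma> \<tau>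
    using that cells by (auto elim!: bd_nonzeroE)
  moreover have "(\<Sum>\<tau>\<in>X. bd \<sigma> \<tau> * bd \<tau> \<rho>) = (0::'b)" if \<sigma>: "\<sigma> \<in> X" and \<rho>: "\<rho> \<in> X" for \<sigma> \<rho>
  proof -
    let ?V = "{v. v \<notin> \<rho> \<and> insert v \<rho> \<in> X}"
    have fr: "finite \<rho>" using cells \<rho> .
    have eq: "(\<Sum>\<tau>\<in>X. bd \<sigma> \<tau> * bd \<tau> \<rho>) = (\<Sum>v\<in>?V. bd \<sigma> (insert v \<rho>) * pos_sign v \<rho> :: 'b)"
      by (rule sum_bd[OF fin fr])
    show ?thesis
    proof (cases "\<exists>v\<in>?V. bd \<sigma> (insert v \<rho>) \<noteq> (0::'b)")
      case False thus ?thesis unfolding eq by (intro sum.neutral) auto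
    next
      case True
      then obtain v where v: "v \<in> ?V" "bd \<sigma> (insert v \<rho>) \<noteq> (0::'b)" by blast
      then obtain w where w: "w \<notin> insert v \<rho>" "\<sigma> = insert w (insert v \<rho>)" by (auto elim: bd_nonzeroE)
      have wV: "w \<in> ?V" using conv[OF \<sigma> \<rho>, of "insert w \<rho>"] w by auto
      have only: "bd \<sigma> (insert u \<rho>) = (0::'b)" if u: "u \<in> ?V - {v, w}" for u
      proof (rule ccontr)
        assume "bd \<sigma> (insert u \<rho>) \<noteq> (0::'b)"
        hence "u \<in> \<sigma>" by (auto elim: bd_nonzeroE)
        thus False using u w(2) by auto
      qed
      have "(\<Sum>u\<in>?V. bd \<sigma> (insert u \<rho>) * pos_sign u \<rho> :: 'b) = (\<Sum>u\<in>{v, w}. bd \<sigma> (insert u \<rho>) * pos_sign u \<rho>)"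
      proof (rule sum.mono_neutral_right)
        have "finite ((\<lambda>v. insert v \<rho>) ` ?V)" by (rule finite_subset[OF _ fin]) auto
        thus "finite ?V" by (rule finite_imageD) (auto simp: inj_on_def)
      qed (use v wV only in auto)
      also have "\<dots> = bd (insert w (insert v \<rho>)) (insert v \<rho>) * pos_sign v \<rho>
          + bd (insert v (insert w \<rho>)) (insert w \<rho>) * pos_sign w \<rho>"
      proof -
        have "v \<noteq> w" using w by auto
        thus ?thesis unfolding w(2) by (simp add: insert_commute[of v w])
      qed
      also have "\<dots> = 0"
        using v(1) w fr wV by (auto simp: bd_insert pos_sign_insert)
      finally show ?thesis unfolding eq .
    qed
  qed
  ultimately show ?thesis unfolding complex_on_def using fin by blast
qed

text \<open>
  A family that is closed under adding and removing one fixed vertex \<open>v\<close> is a relative cone;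
  coning with \<open>v\<close> is a contracting homotopy.
\<close>

lemma exact_at_cone:
  assumes fin: "finite X" and cells: "\<And>\<sigma>. \<sigma> \<in> X \<Longrightarrow> finite \<sigma>"
    and tog: "\<And>\<sigma>. \<sigma> \<in> X \<Longrightarrow> insert v \<sigma> \<in> X \<and> \<sigma> - {v} \<in> X"
  shows "exact_at card bd X k"
proof (rule exact_atI)
  fix x :: "'a set \<Rightarrow> 'b"
  assume x: "chain_in card X k x" and cyc: "\<And>\<tau>. \<tau> \<in> X \<Longrightarrow> (\<Sum>\<sigma>\<in>X. x \<sigma> * bd \<sigma> \<tau>) = 0"
  \<comment> \<open>The cone over \<open>x\<close> with apex \<open>v\<close>, restricted to the cells of \<open>X\<close>.\<close>
  define y where "y = (\<lambda>\<sigma>. if v \<in> \<sigma> \<and> \<sigma> \<in> X then pos_sign v (\<sigma> - {v}) * x (\<sigma> - {v}) else 0)"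
  have "chain_in card X (Suc k) y"
    unfolding chain_in_def
  proof (intro allI impI)
    fix \<sigma> assume "y \<sigma> \<noteq> 0"
    hence "v \<in> \<sigma>" "\<sigma> \<in> X" "x (\<sigma> - {v}) \<noteq> 0" by (auto simp: y_def split: if_splits)
    thus "\<sigma> \<in> X \<and> card \<sigma> = Suc k"
      using x cells[of \<sigma>] unfolding chain_in_def by (metis card.remove)
  qed
  moreover have "(\<Sum>\<sigma>\<in>X. y \<sigma> * bd \<sigma> \<tau>) = x \<tau>" if \<tau>: "\<tau> \<in> X" for \<tau>
  proof -
    have f\<tau>: "finite \<tau>" by (rule cells[OF \<tau>])
    have finV: "finite {w. w \<notin> \<rho> \<and> insert w \<rho> \<in> X}" for \<rho>
    proof -
      have "finite ((\<lambda>v. insert v \<rho>) ` {w. w \<notin> \<rho> \<and> insert w \<rho> \<in> X})" by (rule finite_subset[OF _ fin]) auto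
      thus ?thesis by (rule finite_imageD) (auto simp: inj_on_def)
    qed
    have sum: "(\<Sum>\<sigma>\<in>X. y \<sigma> * bd \<sigma> \<tau>) = (\<Sum>w | w \<notin> \<tau> \<and> insert w \<tau> \<in> X. y (insert w \<tau>) * pos_sign w \<tau>)"
      by (rule sum_bd[OF fin f\<tau>])
    show ?thesis
    proof (cases "v \<in> \<tau>")
      case False
      have "(\<Sum>w | w \<notin> \<tau> \<and> insert w \<tau> \<in> X. y (insert w \<tau>) * pos_sign w \<tau>)
          = (\<Sum>w\<in>{v}. y (insert w \<tau>) * pos_sign w \<tau>)"
        by (rule sum.mono_neutral_right) (use finV False tog[OF \<tau>] in \<open>auto simp: y_def\<close>)
      also have "\<dots> = x \<tau> * (pos_sign v \<tau> * pos_sign v \<tau>)"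
        using tog[OF \<tau>] False by (simp add: y_def algebra_simps)
      finally show ?thesis unfolding sum by (simp add: pos_sign_sq)
    next
      case True
      define \<rho> where "\<rho> = \<tau> - {v}"
      have \<rho>: "v \<notin> \<rho>" "\<tau> = insert v \<rho>" "\<rho> \<in> X" "finite \<rho>"
        using True tog[OF \<tau>] f\<tau> by (auto simp: \<rho>_def)
      let ?W = "{w. w \<notin> \<tau> \<and> insert w \<tau> \<in> X}"
      have W: "{w. w \<notin> \<rho> \<and> insert w \<rho> \<in> X} = insert v ?W"
      proof (intro Set.set_eqI iffI)
        fix w assume "w \<in> {w. w \<notin> \<rho> \<and> insert w \<rho> \<in> X}"
        thus "w \<in> insert v ?W" using tog[of "insert w \<rho>"] \<rho> by (auto simp: insert_commute)
      next
        fix w assume w: "w \<in> insert v ?W"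
        show "w \<in> {w. w \<notin> \<rho> \<and> insert w \<rho> \<in> X}"
        proof (cases "w = v")
          case False
          hence "insert w \<tau> - {v} = insert w \<rho>" "w \<notin> \<rho>" using w \<rho> by auto
          thus ?thesis using tog[of "insert w \<tau>"] w False by auto
        qed (use \<rho> \<tau> in auto)
      qed
      have "0 = (\<Sum>w | w \<notin> \<rho> \<and> insert w \<rho> \<in> X. x (insert w \<rho>) * pos_sign w \<rho>)"
        using cyc[OF \<rho>(3)] by (simp add: sum_bd[OF fin \<rho>(4)])
      also have "\<dots> = x \<tau> * pos_sign v \<rho> + (\<Sum>w\<in>?W. x (insert w \<rho>) * pos_sign w \<rho>)"
        unfolding W using finV[of \<tau>] True \<rho> by simp
      finally have c: "(\<Sum>w\<in>?W. x (insert w \<rho>) * pos_sign w \<rho>) = - (x \<tau> * pos_sign v \<rho>)"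
        by (simp add: eq_neg_iff_add_eq_0 add.commute)
      have "(\<Sum>w\<in>?W. y (insert w \<tau>) * pos_sign w \<tau>)
          = (\<Sum>w\<in>?W. - pos_sign v \<rho> * (x (insert w \<rho>) * pos_sign w \<rho>))"
      proof (rule sum.cong[OF refl])
        fix w assume w: "w \<in> ?W"
        have e: "insert w \<tau> - {v} = insert w \<rho>" using w \<rho> by auto
        have w': "w \<notin> \<rho>" "w \<noteq> v" using w \<rho> by auto
        have "y (insert w \<tau>) = pos_sign v (insert w \<rho>) * x (insert w \<rho>)"
          using w True unfolding y_def e by simp
        moreover have "pos_sign v (insert w \<rho>) * pos_sign w (insert v \<rho>) = - (pos_sign v \<rho> * pos_sign w \<rho> :: 'b)"
          using w' \<rho>(1,4) by (auto simp: pos_sign_insert)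
        ultimately show "y (insert w \<tau>) * pos_sign w \<tau> = - pos_sign v \<rho> * (x (insert w \<rho>) * pos_sign w \<rho>)"
          unfolding \<rho>(2) by (simp add: algebra_simps)
      qed
      also have "\<dots> = x \<tau> * (pos_sign v \<rho> * pos_sign v \<rho>)"
        unfolding sum_distrib_left[symmetric] c by (simp add: algebra_simps)
      finally show ?thesis unfolding sum by (simp add: pos_sign_sq)
    qed
  qed
  ultimately show "\<exists>y. chain_in card X (Suc k) y \<and> (\<forall>\<tau>\<in>X. (\<Sum>\<sigma>\<in>X. y \<sigma> * bd \<sigma> \<tau>) = x \<tau>)" by blast
qed

text \<open>
  Homology over \<open>K\<close> of dimension \<open>b\<close> in degree \<open>k\<close> and zero elsewhere; the dimension is
  recorded through the Euler characteristic.
\<close>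

definition concentrated :: "'k::field itself \<Rightarrow> 'a::linorder set set \<Rightarrow> nat \<Rightarrow> nat \<Rightarrow> bool" where
  "concentrated K X k b \<longleftrightarrow> convex_family X \<and>
     (\<forall>l. l \<noteq> k \<longrightarrow> exact_at card (bd :: 'a set \<Rightarrow> 'a set \<Rightarrow> 'k) X l) \<and>
     (\<Sum>\<sigma>\<in>X. (-1) ^ card \<sigma>) = (-1) ^ k * int b"

lemma concentrated_exact:
  "concentrated (K :: 'k::field itself) X k b \<Longrightarrow> l \<noteq> k \<Longrightarrow> exact_at card (bd :: 'a set \<Rightarrow> 'a set \<Rightarrow> 'k) X l"
  for X :: "'a::linorder set set"
  by (simp add: concentrated_def)

lemma concentrated_euler: "concentrated K X k b \<Longrightarrow> (\<Sum>\<sigma>\<in>X. (-1) ^ card \<sigma>) = (-1) ^ k * int b"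
  by (simp add: concentrated_def)

lemma concentrated_cone:
  assumes X: "convex_family X" and tog: "\<And>\<sigma>. \<sigma> \<in> X \<Longrightarrow> insert v \<sigma> \<in> X \<and> \<sigma> - {v} \<in> X"
  shows "concentrated K X k 0"
proof -
  have fin: "finite X" and cells: "\<And>\<sigma>. \<sigma> \<in> X \<Longrightarrow> finite \<sigma>" using X by (auto simp: convex_family_def)
  let ?A = "{\<sigma>\<in>X. v \<notin> \<sigma>}" and ?B = "{\<sigma>\<in>X. v \<in> \<sigma>}"
  have bij: "bij_betw (insert v) ?A ?B"
    by (rule bij_betw_byWitness[where f' = "\<lambda>\<sigma>. \<sigma> - {v}"]) (use tog in auto)
  have "(\<Sum>\<sigma>\<in>?B. (-1) ^ card \<sigma> :: int) = (\<Sum>\<sigma>\<in>?A. (-1) ^ card (insert v \<sigma>))"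
    by (rule sum.reindex_bij_betw[OF bij, symmetric])
  also have "\<dots> = (\<Sum>\<sigma>\<in>?A. - ((-1) ^ card \<sigma>))" by (rule sum.cong) (auto simp: cells)
  finally have B: "(\<Sum>\<sigma>\<in>?B. (-1) ^ card \<sigma> :: int) = - (\<Sum>\<sigma>\<in>?A. (-1) ^ card \<sigma>)"
    by (simp add: sum_negf)
  have "X = ?A \<union> ?B" by auto
  hence "(\<Sum>\<sigma>\<in>X. (-1) ^ card \<sigma> :: int) = (\<Sum>\<sigma>\<in>?A \<union> ?B. (-1) ^ card \<sigma>)" by simp
  also have "\<dots> = (\<Sum>\<sigma>\<in>?A. (-1) ^ card \<sigma>) + (\<Sum>\<sigma>\<in>?B. (-1) ^ card \<sigma>)"
    by (rule sum.union_disjoint) (use fin in auto)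
  finally show ?thesis
    unfolding concentrated_def using X B by (simp add: exact_at_cone[OF fin cells tog])
qed

lemma concentrated_single:
  assumes "finite \<sigma>"
  shows "concentrated K {\<sigma>} (card \<sigma>) 1"
  unfolding concentrated_def convex_family_def using assms
  by (auto intro!: exact_at_no_cells)

lemma convex_family_fibre:
  assumes X: "convex_family X" and mono: "\<And>\<sigma> \<tau>. \<sigma> \<in> X \<Longrightarrow> \<tau> \<in> X \<Longrightarrow> \<tau> \<subseteq> \<sigma> \<Longrightarrow> f \<sigma> \<le> (f \<tau> :: nat)"
  shows "convex_family {\<sigma>\<in>X. f \<sigma> = r}"
  unfolding convex_family_def
proof (intro conjI ballI allI impI)
  fix \<sigma> \<rho> \<tau> assume h: "\<sigma> \<in> {\<sigma>\<in>X. f \<sigma> = r}" "\<rho> \<in> {\<sigma>\<in>X. f \<sigma> = r}" "\<rho> \<subseteq> \<tau> \<and> \<tau> \<subseteq> \<sigma>"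
  hence "\<tau> \<in> X" using X unfolding convex_family_def by blast
  moreover have "f \<sigma> \<le> f \<tau>" "f \<tau> \<le> f \<rho>" using mono[of \<sigma> \<tau>] mono[of \<tau> \<rho>] h \<open>\<tau> \<in> X\<close> by auto
  ultimately show "\<tau> \<in> {\<sigma>\<in>X. f \<sigma> = r}" using h by auto
qed (use X in \<open>auto simp: convex_family_def\<close>)

text \<open>
  The cluster lemma of discrete Morse theory in homological form: a family is assembled from the
  fibres of a monotone map, and concentration in a common degree adds up.
\<close>

lemma concentrated_fibres:
  assumes X: "convex_family X" and mono: "\<And>\<sigma> \<tau>. \<sigma> \<in> X \<Longrightarrow> \<tau> \<in> X \<Longrightarrow> \<tau> \<subseteq> \<sigma> \<Longrightarrow> f \<sigma> \<le> (f \<tau> :: nat)"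
    and R: "finite R" "f ` X \<subseteq> R" and conc: "\<And>r. r \<in> R \<Longrightarrow> concentrated K {\<sigma>\<in>X. f \<sigma> = r} k (b r)"
  shows "concentrated (K :: 'k::field itself) X k (\<Sum>r\<in>R. b r)"
proof -
  have fin: "finite X" using X by (simp add: convex_family_def)
  have "exact_at card (bd :: 'a set \<Rightarrow> 'a set \<Rightarrow> 'k) X l" if l: "l \<noteq> k" for l
  proof (rule exact_at_fibres[where f = f])
    show "complex_on card (bd :: 'a set \<Rightarrow> 'a set \<Rightarrow> 'k) X" by (rule complex_on_bd[OF X])
    show "f \<sigma> \<le> f \<tau>" if "\<sigma> \<in> X" "\<tau> \<in> X" "bd \<sigma> \<tau> \<noteq> (0::'k)" for \<sigma> \<tau>
      using that by (auto elim!: bd_nonzeroE intro: mono)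
    show "exact_at card (bd :: 'a set \<Rightarrow> 'a set \<Rightarrow> 'k) {\<sigma> \<in> X. f \<sigma> = r} l" for r
    proof (cases "r \<in> R")
      case True show ?thesis by (rule concentrated_exact[OF conc[OF True] l])
    next
      case False
      hence "{\<sigma> \<in> X. f \<sigma> = r} = {}" using R by auto
      thus ?thesis by (metis empty_iff exact_at_no_cells)
    qed
  qed
  moreover have "(\<Sum>\<sigma>\<in>X. (-1) ^ card \<sigma>) = (-1) ^ k * int (\<Sum>r\<in>R. b r)"
  proof -
    have "(\<Sum>\<sigma>\<in>X. (-1) ^ card \<sigma>) = (\<Sum>r\<in>R. \<Sum>\<sigma>\<in>{\<sigma>\<in>X. f \<sigma> = r}. (-1) ^ card \<sigma> :: int)"
      by (rule sum.group[OF fin R, symmetric])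
    also have "\<dots> = (\<Sum>r\<in>R. (-1) ^ k * int (b r))"
      by (rule sum.cong[OF refl]) (rule concentrated_euler[OF conc])
    finally show ?thesis by (simp add: sum_distrib_left)
  qed
  ultimately show ?thesis unfolding concentrated_def using X by blast
qed

lemma convex_family_insert:
  assumes Y: "convex_family Y" and h: "\<And>\<sigma>. \<sigma> \<in> Y \<Longrightarrow> h \<notin> \<sigma>"
  shows "convex_family (insert h ` Y)"
  unfolding convex_family_def
proof (intro conjI ballI allI impI)
  fix \<sigma> \<rho> \<tau> assume "\<sigma> \<in> insert h ` Y" "\<rho> \<in> insert h ` Y" and t: "\<rho> \<subseteq> \<tau> \<and> \<tau> \<subseteq> \<sigma>"
  then obtain \<sigma>' \<rho>' where s: "\<sigma> = insert h \<sigma>'" "\<sigma>' \<in> Y" "\<rho> = insert h \<rho>'" "\<rho>' \<in> Y" by blast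
  hence "\<rho>' \<subseteq> \<tau> - {h}" "\<tau> - {h} \<subseteq> \<sigma>'" "h \<in> \<tau>" using t h by blast+
  hence "\<tau> - {h} \<in> Y" "\<tau> = insert h (\<tau> - {h})" using Y s unfolding convex_family_def by blast+
  thus "\<tau> \<in> insert h ` Y" by blast
qed (use Y in \<open>auto simp: convex_family_def\<close>)

text \<open>
  Adding a new vertex \<open>h\<close> to all cells shifts the degree by one; the signs change by the position of
  \<open>h\<close>, which is a rescaling of the basis.
\<close>

lemma concentrated_insert:
  assumes conc: "concentrated (K :: 'k::field itself) Y k b" and h: "\<And>\<sigma>. \<sigma> \<in> Y \<Longrightarrow> h \<notin> \<sigma>"
  shows "concentrated K (insert h ` Y) (Suc k) b"
proof -
  have Y: "convex_family Y" using conc by (simp add: concentrated_def)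
  have cells: "finite \<sigma>" if "\<sigma> \<in> Y" for \<sigma> using Y that by (auto simp: convex_family_def)
  have inj: "inj_on (insert h) Y"
    unfolding inj_on_def using h by (metis insert_ident)
  have ex: "exact_at card (bd :: 'a set \<Rightarrow> 'a set \<Rightarrow> 'k) (insert h ` Y) (l + 1)" if "l \<noteq> k" for l
  proof (rule exact_at_transfer[where F = "insert h" and X = Y and e = "-1" and g = "pos_sign h" and dm = card and a = bd])
    show "bij_betw (insert h) Y (insert h ` Y)" using inj by (rule inj_on_imp_bij_betw)
    show "card (insert h \<sigma>) = card \<sigma> + 1" if "\<sigma> \<in> Y" for \<sigma> using that cells h by simp
    show "pos_sign h \<sigma> * pos_sign h \<sigma> = (1::'k)" for \<sigma> by (rule pos_sign_sq)
    show "bd (insert h \<sigma>) (insert h \<tau>) = -1 * pos_sign h \<sigma> * bd \<sigma> \<tau> * (pos_sign h \<tau> :: 'k)"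
      if st: "\<sigma> \<in> Y" "\<tau> \<in> Y" for \<sigma> \<tau>
    proof (cases "\<exists>v. v \<notin> \<tau> \<and> \<sigma> = insert v \<tau>")
      case True
      then obtain v where v: "v \<notin> \<tau>" "\<sigma> = insert v \<tau>" by blast
      have f: "finite \<tau>" "h \<notin> \<tau>" "h \<noteq> v" using cells h st v by auto
      have "bd (insert h \<sigma>) (insert h \<tau>) = (pos_sign v (insert h \<tau>) :: 'k)"
        unfolding v(2) insert_commute[of h v] by (rule bd_insert) (use v f in auto)
      moreover have "bd \<sigma> \<tau> = (pos_sign v \<tau> :: 'k)" unfolding v(2) by (rule bd_insert) (use v f in auto)
      moreover have "pos_sign h \<sigma> * pos_sign h \<tau> = (if v < h then -1 else 1 :: 'k)"
        unfolding v(2) using v f by (simp add: pos_sign_insert pos_sign_sq)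
      ultimately show ?thesis using v f by (auto simp: pos_sign_insert algebra_simps)
    next
      case False
      hence "bd \<sigma> \<tau> = (0::'k)" by (meson bd_nonzeroE)
      moreover have "bd (insert h \<sigma>) (insert h \<tau>) = (0::'k)"
      proof (rule ccontr)
        assume "bd (insert h \<sigma>) (insert h \<tau>) \<noteq> (0::'k)"
        then obtain v where v: "v \<notin> insert h \<tau>" "insert h \<sigma> = insert v (insert h \<tau>)" by (rule bd_nonzeroE)
        have "insert h \<sigma> = insert h (insert v \<tau>)" unfolding v(2) by (rule insert_commute)
        moreover have "h \<notin> \<sigma>" "h \<notin> insert v \<tau>" using h[OF st(1)] h[OF st(2)] v(1) by auto
        ultimately have "\<sigma> = insert v \<tau>" by (simp add: insert_ident)
        thus False using False v by blast
      qed
      ultimately show ?thesis by simp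
    qed
  qed (use concentrated_exact[OF conc that] in auto)
  have "exact_at card (bd :: 'a set \<Rightarrow> 'a set \<Rightarrow> 'k) (insert h ` Y) l" if l: "l \<noteq> Suc k" for l
  proof (cases l)
    case 0
    have "card \<sigma> \<noteq> 0" if "\<sigma> \<in> insert h ` Y" for \<sigma> using that cells by (auto simp: card_gt_0_iff)
    thus ?thesis unfolding 0 by (rule exact_at_no_cells)
  next
    case (Suc l')
    thus ?thesis using ex[of l'] l by simp
  qed
  moreover have "(\<Sum>\<sigma>\<in>insert h ` Y. (-1) ^ card \<sigma>) = (-1) ^ Suc k * int b"
  proof -
    have "(\<Sum>\<sigma>\<in>insert h ` Y. (-1) ^ card \<sigma> :: int) = (\<Sum>\<sigma>\<in>Y. - ((-1) ^ card \<sigma>))"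
      unfolding sum.reindex[OF inj] by (rule sum.cong) (use cells h in auto)
    thus ?thesis by (simp add: sum_negf concentrated_euler[OF conc])
  qed
  ultimately show ?thesis unfolding concentrated_def using convex_family_insert[OF Y h] by blast
qed

text \<open>
  Relabelling the vertices by a map that does not preserve their order changes the differential
  only by the signs of the sorting permutations of the cells, so homology does not notice.
\<close>

lemma concentrated_relabel:
  fixes \<rho> :: "'a::linorder \<Rightarrow> 'b::linorder"
  assumes conc: "concentrated (K :: 'k::field itself) X k b" and inj: "inj_on \<rho> (\<Union>X)"
  shows "concentrated K ((`) \<rho> ` X) k b"
proof -
  have X: "convex_family X" using conc by (simp add: concentrated_def)
  have cells: "finite \<sigma>" if "\<sigma> \<in> X" for \<sigma> using X that by (auto simp: convex_family_def)
  have injX: "inj_on ((`) \<rho>) X" unfolding inj_on_def using inj_on_image_eq_iff[OF inj] by blast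
  have injs: "inj_on \<rho> \<sigma>" if "\<sigma> \<in> X" for \<sigma> using inj that by (meson Union_upper inj_on_subset)
  \<comment> \<open>The sign of the permutation that sorts the image of a cell, by counting inversions.\<close>
  define invs where "invs = (\<lambda>\<sigma>. {(u, v). u \<in> \<sigma> \<and> v \<in> \<sigma> \<and> u < v \<and> \<rho> v < \<rho> u})"
  define g where "g = (\<lambda>\<sigma>. (-1) ^ card (invs \<sigma>) :: 'k)"
  have finv: "finite (invs \<sigma>)" if "finite \<sigma>" for \<sigma>
    by (rule finite_subset[of _ "\<sigma> \<times> \<sigma>"]) (use that in \<open>auto simp: invs_def\<close>)
  have gsq: "g \<sigma> * g \<sigma> = 1" for \<sigma> unfolding g_def by (simp add: power_mult_distrib[symmetric])
  have key: "bd (\<rho> ` \<sigma>) (\<rho> ` \<tau>) = 1 * g \<sigma> * bd \<sigma> \<tau> * g \<tau>" if st: "\<sigma> \<in> X" "\<tau> \<in> X" for \<sigma> \<tau>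
  proof (cases "\<exists>v. v \<notin> \<tau> \<and> \<sigma> = insert v \<tau>")
    case True
    then obtain v where v: "v \<notin> \<tau>" "\<sigma> = insert v \<tau>" by blast
    have f: "finite \<tau>" using cells st by simp
    have rv: "\<rho> v \<notin> \<rho> ` \<tau>" using injs[OF st(1)] v by (auto simp: inj_on_def)
    let ?A = "{u\<in>\<tau>. u < v \<and> \<rho> u < \<rho> v}" and ?P = "{u\<in>\<tau>. u < v \<and> \<rho> v < \<rho> u}"
      and ?Q = "{u\<in>\<tau>. v < u \<and> \<rho> u < \<rho> v}"
    have ne: "\<rho> u \<noteq> \<rho> v" "u \<noteq> v" if "u \<in> \<tau>" for u
      using rv v imageI[OF that, of \<rho>] that by (fastforce, blast)
    have AP: "{u\<in>\<tau>. u < v} = ?A \<union> ?P" using ne by (auto simp: neq_iff)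
    have A: "card {u\<in>\<tau>. u < v} = card ?A + card ?P"
      unfolding AP by (rule card_Un_disjoint) (use f in auto)
    have AQ: "{u\<in>\<tau>. \<rho> u < \<rho> v} = ?A \<union> ?Q" using ne by (auto simp: neq_iff)
    have B: "card {u\<in>\<tau>. \<rho> u < \<rho> v} = card ?A + card ?Q"
      unfolding AQ by (rule card_Un_disjoint) (use f in auto)
    have "{w\<in>\<rho> ` \<tau>. w < \<rho> v} = \<rho> ` {u\<in>\<tau>. \<rho> u < \<rho> v}" by auto
    hence C: "card {w\<in>\<rho> ` \<tau>. w < \<rho> v} = card ?A + card ?Q"
      unfolding B[symmetric] by (simp add: card_image inj_on_subset[OF injs[OF st(2)]])
    have "invs \<sigma> = invs \<tau> \<union> ((\<lambda>u. (u, v)) ` ?P \<union> (\<lambda>u. (v, u)) ` ?Q)"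
      unfolding v(2) invs_def by auto
    moreover have "card ((\<lambda>u. (u, v)) ` ?P \<union> (\<lambda>u. (v, u)) ` ?Q) = card ?P + card ?Q"
      using f by (subst card_Un_disjoint) (auto simp: card_image inj_on_def)
    moreover have "invs \<tau> \<inter> ((\<lambda>u. (u, v)) ` ?P \<union> (\<lambda>u. (v, u)) ` ?Q) = {}" using v by (auto simp: invs_def)
    ultimately have D: "card (invs \<sigma>) = card (invs \<tau>) + (card ?P + card ?Q)"
      using finv[OF f] f by (simp add: card_Un_disjoint)
    have "bd (\<rho> ` \<sigma>) (\<rho> ` \<tau>) = (pos_sign (\<rho> v) (\<rho> ` \<tau>) :: 'k)"
      unfolding v(2) image_insert by (rule bd_insert) (use rv f in auto)
    also have "\<dots> = (-1) ^ (card ?A + card ?Q)" unfolding pos_sign_def C ..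
    also have "\<dots> = (-1) ^ (card ?A + card ?Q) * ((-1) ^ card (invs \<tau>) * (-1) ^ card (invs \<tau>)) * ((-1) ^ card ?P * (-1) ^ card ?P)"
      by (simp add: power_mult_distrib[symmetric])
    also have "\<dots> = g \<sigma> * pos_sign v \<tau> * g \<tau>"
      unfolding g_def D pos_sign_def A by (simp add: power_add)
    also have "pos_sign v \<tau> = bd \<sigma> \<tau>" unfolding v(2) by (rule bd_insert[symmetric]) (use v f in auto)
    finally show ?thesis by simp
  next
    case False
    hence "bd \<sigma> \<tau> = (0::'k)" by (meson bd_nonzeroE)
    moreover have "bd (\<rho> ` \<sigma>) (\<rho> ` \<tau>) = (0::'k)"
    proof (rule ccontr)
      assume "bd (\<rho> ` \<sigma>) (\<rho> ` \<tau>) \<noteq> (0::'k)"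
      then obtain w where w: "w \<notin> \<rho> ` \<tau>" "\<rho> ` \<sigma> = insert w (\<rho> ` \<tau>)" by (rule bd_nonzeroE)
      then obtain v where v: "v \<in> \<sigma>" "w = \<rho> v" by blast
      have "\<rho> ` \<sigma> = \<rho> ` insert v \<tau>" using w v by simp
      moreover have "insert v \<tau> \<subseteq> \<Union>X" "\<sigma> \<subseteq> \<Union>X" using st v by auto
      ultimately have "\<sigma> = insert v \<tau>" using inj_on_image_eq_iff[OF inj] by blast
      moreover have "v \<notin> \<tau>" using w v by auto
      ultimately show False using False by blast
    qed
    ultimately show ?thesis by simp
  qed
  have card: "card (\<rho> ` \<sigma>) = card \<sigma>" if "\<sigma> \<in> X" for \<sigma> by (rule card_image[OF injs[OF that]])
  have ex: "exact_at card (bd :: 'b set \<Rightarrow> 'b set \<Rightarrow> 'k) ((`) \<rho> ` X) (l + 0)" if "l \<noteq> k" for l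
  proof (rule exact_at_transfer[where F = "(`) \<rho>" and X = X and e = 1 and g = g and dm = card and a = bd])
    show "bij_betw ((`) \<rho>) X ((`) \<rho> ` X)" using injX by (rule inj_on_imp_bij_betw)
    show "card (\<rho> ` \<sigma>) = card \<sigma> + 0" if "\<sigma> \<in> X" for \<sigma> using card[OF that] by simp
    show "exact_at card (bd :: 'a set \<Rightarrow> 'a set \<Rightarrow> 'k) X l" by (rule concentrated_exact[OF conc that])
  qed (use key gsq in auto)
  have "convex_family ((`) \<rho> ` X)"
    unfolding convex_family_def
  proof (intro conjI ballI allI impI)
    fix \<sigma> \<rho>' \<tau> assume "\<sigma> \<in> (`) \<rho> ` X" "\<rho>' \<in> (`) \<rho> ` X" and t: "\<rho>' \<subseteq> \<tau> \<and> \<tau> \<subseteq> \<sigma>"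
    then obtain s r where s: "s \<in> X" "\<sigma> = \<rho> ` s" "r \<in> X" "\<rho>' = \<rho> ` r" by blast
    define q where "q = {u\<in>s. \<rho> u \<in> \<tau>}"
    have q: "\<tau> = \<rho> ` q" using t s by (auto simp: q_def)
    have "r \<subseteq> s"
    proof
      fix u assume u: "u \<in> r"
      hence "\<rho> u \<in> \<rho> ` s" using t s by blast
      then obtain w where w: "w \<in> s" "\<rho> u = \<rho> w" by blast
      have "u = w" by (rule inj_onD[OF inj w(2)]) (use u w s in auto)
      thus "u \<in> s" using w by simp
    qed
    hence "r \<subseteq> q" using t s by (auto simp: q_def)
    hence "q \<in> X" using X s unfolding convex_family_def q_def by blast
    thus "\<tau> \<in> (`) \<rho> ` X" using q by blast
  qed (use X in \<open>auto simp: convex_family_def\<close>)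
  moreover have "(\<Sum>\<sigma>\<in>(`) \<rho> ` X. (-1) ^ card \<sigma>) = (-1) ^ k * int b"
    unfolding sum.reindex[OF injX] using card by (simp add: concentrated_euler[OF conc])
  ultimately show ?thesis unfolding concentrated_def using ex by (metis add.right_neutral)
qed

section \<open>Covering families\<close>

definition cover_family :: "('a \<Rightarrow> 'b set) \<Rightarrow> 'a set \<Rightarrow> 'b set \<Rightarrow> 'a set set" where
  "cover_family A G W = {S. S \<subseteq> G \<and> W \<subseteq> (\<Union>s\<in>S. A s)}"

lemma cover_family_cong:
  assumes "\<And>g. g \<in> G \<Longrightarrow> A g \<inter> W = B g \<inter> W"
  shows "cover_family A G W = cover_family B G W"
proof -
  have "(W \<subseteq> (\<Union>s\<in>S. A s)) = (W \<subseteq> (\<Union>s\<in>S. B s))" if "S \<subseteq> G" for S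
  proof -
    have "(v \<in> (\<Union>s\<in>S. A s)) = (v \<in> (\<Union>s\<in>S. B s))" if "v \<in> W" for v
      using assms \<open>S \<subseteq> G\<close> that by blast
    thus ?thesis by blast
  qed
  thus ?thesis unfolding cover_family_def by blast
qed

lemma convex_cover_family:
  assumes "finite G"
  shows "convex_family (cover_family A G W)"
proof -
  have "finite (cover_family A G W)"
    by (rule finite_subset[of _ "Pow G"]) (use assms in \<open>auto simp: cover_family_def\<close>)
  moreover have "finite \<sigma>" if "\<sigma> \<in> cover_family A G W" for \<sigma>
    using that assms finite_subset by (auto simp: cover_family_def)
  ultimately show ?thesis unfolding convex_family_def cover_family_def by blast
qed

text \<open>
  An element that covers nothing can be added and removed freely.
\<close>

lemma concentrated_cover_useless:
  assumes "finite G" "g \<in> G" "A g \<inter> W = {}"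
  shows "concentrated K (cover_family A G W) k 0"
proof (rule concentrated_cone[where v = g])
  show "convex_family (cover_family A G W)" by (rule convex_cover_family[OF assms(1)])
  fix S assume "S \<in> cover_family A G W"
  hence S: "S \<subseteq> G" "W \<subseteq> (\<Union>s\<in>S. A s)" by (auto simp: cover_family_def)
  have "W \<subseteq> (\<Union>s\<in>S - {g}. A s)" using S(2) assms(3) by blast
  thus "insert g S \<in> cover_family A G W \<and> S - {g} \<in> cover_family A G W"
    using S assms(2) unfolding cover_family_def by blast
qed

lemma concentrated_cover_uncovered:
  assumes "finite G" "w \<in> W" "\<And>g. g \<in> G \<Longrightarrow> w \<notin> A g"
  shows "concentrated K (cover_family A G W) k 0"
proof -
  have "cover_family A G W = {}" using assms unfolding cover_family_def by blast
  thus ?thesis using concentrated_cone[of "{}"] by (simp add: convex_family_def)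
qed

text \<open>
  If \<open>g\<close> covers everything that \<open>h\<close> does, then covers containing \<open>g\<close> may freely add or drop
  \<open>h\<close> and form a cone; only the covers without \<open>g\<close> matter.
\<close>

lemma concentrated_cover_dominating:
  assumes G: "finite G" "g \<in> G" "h \<in> G" "h \<noteq> g" and dom: "A h \<inter> W \<subseteq> A g"
    and conc: "concentrated K (cover_family A (G - {g}) W) k b"
  shows "concentrated K (cover_family A G W) k b"
proof -
  let ?X = "cover_family A G W" and ?f = "\<lambda>S. if g \<in> S then 0 else 1 :: nat"
  have X: "convex_family ?X" by (rule convex_cover_family[OF G(1)])
  have mono: "?f \<sigma> \<le> ?f \<tau>" if "\<tau> \<subseteq> \<sigma>" for \<sigma> \<tau> using that by auto
  have f0: "concentrated K {S\<in>?X. ?f S = 0} k 0"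
  proof (rule concentrated_cone[where v = h])
    show "convex_family {S\<in>?X. ?f S = 0}" by (rule convex_family_fibre[OF X]) (rule mono)
    fix S assume "S \<in> {S\<in>?X. ?f S = 0}"
    hence S: "S \<subseteq> G" "W \<subseteq> (\<Union>s\<in>S. A s)" "g \<in> S" by (auto simp: cover_family_def split: if_splits)
    have "W \<subseteq> (\<Union>s\<in>S - {h}. A s)"
    proof
      fix w assume w: "w \<in> W"
      then obtain s where s: "s \<in> S" "w \<in> A s" using S by blast
      show "w \<in> (\<Union>s\<in>S - {h}. A s)"
      proof (cases "s = h")
        case True
        hence "w \<in> A g" using dom w s by blast
        thus ?thesis using S G by blast
      qed (use s in blast)
    qed
    thus "insert h S \<in> {S\<in>?X. ?f S = 0} \<and> S - {h} \<in> {S\<in>?X. ?f S = 0}"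
      using S G by (auto simp: cover_family_def)
  qed
  have "{S\<in>?X. ?f S = 1} = cover_family A (G - {g}) W" by (auto simp: cover_family_def)
  hence f1: "concentrated K {S\<in>?X. ?f S = 1} k b" using conc by simp
  have "concentrated K ?X k (\<Sum>r\<in>{0, 1 :: nat}. if r = 0 then 0 else b)"
  proof (rule concentrated_fibres[OF X, where f = ?f])
    fix r :: nat assume "r \<in> {0, 1}"
    hence "r = 0 \<or> r = 1" by simp
    thus "concentrated K {S\<in>?X. ?f S = r} k (if r = 0 then 0 else b)"
    proof
      assume r: "r = 0"
      show ?thesis unfolding r using f0 by (simp only: simp_thms if_True)
    next
      assume r: "r = 1"
      show ?thesis unfolding r using f1 by (simp only: one_neq_zero if_False)
    qed
  qed (use mono in auto)
  thus ?thesis by simp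
qed

lemma concentrated_cover_dominating_set:
  assumes "finite D" "finite G" "D \<subseteq> G" "h \<in> G" "h \<notin> D" "\<And>g. g \<in> D \<Longrightarrow> A h \<inter> W \<subseteq> A g"
    and "concentrated K (cover_family A (G - D) W) k b"
  shows "concentrated K (cover_family A G W) k b"
  using assms
proof (induction D arbitrary: G rule: finite_induct)
  case (insert g D)
  have "concentrated K (cover_family A (G - {g}) W) k b"
  proof (rule insert.IH)
    show "D \<subseteq> G - {g}" using insert.prems insert.hyps by blast
    have "G - {g} - D = G - insert g D" by blast
    thus "concentrated K (cover_family A (G - {g} - D) W) k b" using insert.prems by simp
  qed (use insert.prems in auto)
  thus ?case
    by (rule concentrated_cover_dominating[rotated 5]) (use insert.prems in auto)
qed simp

lemma concentrated_cover_forced: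
  assumes "finite G" "g \<in> G" "w \<in> W" "w \<in> A g" "\<And>s. s \<in> G \<Longrightarrow> w \<in> A s \<Longrightarrow> s = g"
    and "concentrated K (cover_family A (G - {g}) (W - A g)) k b"
  shows "concentrated K (cover_family A G W) (Suc k) b"
proof -
  have "cover_family A G W = insert g ` cover_family A (G - {g}) (W - A g)"
  proof (intro Set.set_eqI iffI)
    fix S assume "S \<in> cover_family A G W"
    hence S: "S \<subseteq> G" "W \<subseteq> (\<Union>s\<in>S. A s)" by (auto simp: cover_family_def)
    then obtain s where "s \<in> S" "w \<in> A s" using assms(3) by blast
    hence "g \<in> S" using assms(5) S by blast
    moreover have "S - {g} \<in> cover_family A (G - {g}) (W - A g)"
      using S unfolding cover_family_def by blast
    ultimately show "S \<in> insert g ` cover_family A (G - {g}) (W - A g)"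
      by (metis image_eqI insert_Diff)
  qed (use assms(2) in \<open>auto simp: cover_family_def\<close>)
  moreover have "concentrated K (insert g ` cover_family A (G - {g}) (W - A g)) (Suc k) b"
    by (rule concentrated_insert[OF assms(6)]) (auto simp: cover_family_def)
  ultimately show ?thesis by simp
qed

lemma concentrated_cover_empty: "concentrated K (cover_family A {} {}) 0 1"
proof -
  have "cover_family A {} {} = {{}}" by (auto simp: cover_family_def)
  thus ?thesis using concentrated_single[of "{}"] by simp
qed

text \<open>
  Two different degrees of concentration leave no homology at all.
\<close>

lemma concentrated_zero:
  fixes X :: "'a::linorder set set"
  assumes "concentrated (K :: 'k::field itself) X (Suc (Suc 0)) 0" "concentrated K X (Suc 0) 0"
  shows "concentrated K X k 0"
proof -
  have "exact_at card (bd :: 'a set \<Rightarrow> 'a set \<Rightarrow> 'k) X l" for l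
    using concentrated_exact[OF assms(1), of l] concentrated_exact[OF assms(2), of l] by (cases "l = 1") auto
  thus ?thesis using assms(1) unfolding concentrated_def by simp
qed

section \<open>Covers by intervals\<close>

text \<open>
  Among the intervals of length \<open>t\<close> that reach the topmost point \<open>w\<close>, the highest one is
  dominated by all others, so only it survives, and it is forced.
\<close>

lemma concentrated_interval_step:
  fixes h w t :: nat
  assumes G: "finite G" "h \<in> G" "\<And>g. g \<in> G \<Longrightarrow> g \<le> h" and W: "w \<in> W" "\<And>v. v \<in> W \<Longrightarrow> v \<le> w"
    and hw: "h \<le> w" "w < h + t"
    and conc: "concentrated K (cover_family (\<lambda>g. {g..<g + t}) {g\<in>G. g + t \<le> w} {v\<in>W. v < h}) k b"
  shows "concentrated K (cover_family (\<lambda>g. {g..<g + t}) G W) (Suc k) b"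
proof (rule concentrated_cover_dominating_set[where D = "{g\<in>G. w < g + t \<and> g \<noteq> h}" and h = h])
  let ?D = "{g\<in>G. w < g + t \<and> g \<noteq> h}"
  show "{h..<h + t} \<inter> W \<subseteq> {g..<g + t}" if "g \<in> ?D" for g
  proof
    fix v assume "v \<in> {h..<h + t} \<inter> W"
    thus "v \<in> {g..<g + t}" using G(3)[of g] W(2)[of v] that by auto
  qed
  show "concentrated K (cover_family (\<lambda>g. {g..<g + t}) (G - ?D) W) (Suc k) b"
  proof (rule concentrated_cover_forced[where g = h and w = w])
    have "G - ?D - {h} = {g\<in>G. g + t \<le> w}" using hw by auto
    moreover have "W - {h..<h + t} = {v\<in>W. v < h}" using W(2) hw by force
    ultimately show "concentrated K (cover_family (\<lambda>g. {g..<g + t}) (G - ?D - {h}) (W - {h..<h + t})) k b"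
      using conc by simp
  qed (use G W hw in auto)
qed (use G in auto)

text \<open>
  Words in three letters, read from the top vertex \<open>N - 1\<close> down to \<open>0\<close>: a missing vertex,
  \<open>t\<close> vertices followed by a missing one, or \<open>t + 1\<close> vertices.  The set \<open>W\<close> collects the vertices
  present, \<open>a\<close> counts the long letters and \<open>b\<close> those without missing vertex.  The last letter
  is never one of the latter, so vertex \<open>0\<close> is missing.
\<close>

fun tilings :: "nat \<Rightarrow> nat \<Rightarrow> nat \<Rightarrow> nat \<Rightarrow> nat set set" where
  "tilings t 0 a b = (if a = 0 \<and> b = 0 then {{}} else {})"
| "tilings t (Suc N) a b = tilings t N a b
     \<union> (if t \<le> N \<and> a \<noteq> 0 then (\<lambda>W. W \<union> {Suc N - t..N}) ` tilings t (N - t) (a - 1) b else {})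
     \<union> (if t < N \<and> a \<noteq> 0 \<and> b \<noteq> 0 then (\<lambda>W. W \<union> {N - t..N}) ` tilings t (N - t) (a - 1) (b - 1) else {})"

lemma tilings_subset: "W \<in> tilings t N a b \<Longrightarrow> W \<subseteq> {1..<N}"
proof (induction t N a b arbitrary: W rule: tilings.induct)
  case (2 t N a b)
  from "2.prems" consider "W \<in> tilings t N a b"
    | W' where "t \<le> N" "a \<noteq> 0" "W' \<in> tilings t (N - t) (a - 1) b" "W = W' \<union> {Suc N - t..N}"
    | W' where "t < N" "a \<noteq> 0" "b \<noteq> 0" "W' \<in> tilings t (N - t) (a - 1) (b - 1)" "W = W' \<union> {N - t..N}"
    by (auto split: if_splits)
  thus ?case
  proof cases
    case 1
    have "W \<subseteq> {1..<N}" by (rule "2.IH"(1)[OF 1])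
    thus ?thesis by auto
  next
    case 2
    have "W' \<subseteq> {1..<N - t}" by (rule "2.IH"(2)) (use 2 in auto)
    hence "\<And>v. v \<in> W' \<Longrightarrow> 1 \<le> v \<and> v < N - t" by auto
    thus ?thesis using 2(1) unfolding 2(4) by fastforce
  next
    case 3
    have "W' \<subseteq> {1..<N - t}" by (rule "2.IH"(3)) (use 3 in auto)
    hence "\<And>v. v \<in> W' \<Longrightarrow> 1 \<le> v \<and> v < N - t" by auto
    thus ?thesis using 3(1) unfolding 3(5) by fastforce
  qed
qed (auto split: if_splits)

lemma card_tilings_element: "W \<in> tilings t N a b \<Longrightarrow> card W = t * a + b"
proof (induction t N a b arbitrary: W rule: tilings.induct)
  case (2 t N a b)
  from "2.prems" consider "W \<in> tilings t N a b"
    | W' where "t \<le> N" "a \<noteq> 0" "W' \<in> tilings t (N - t) (a - 1) b" "W = W' \<union> {Suc N - t..N}"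
    | W' where "t < N" "a \<noteq> 0" "b \<noteq> 0" "W' \<in> tilings t (N - t) (a - 1) (b - 1)" "W = W' \<union> {N - t..N}"
    by (auto split: if_splits)
  thus ?case
  proof cases
    case 1
    show ?thesis by (rule "2.IH"(1)[OF 1])
  next
    case 2
    have s: "W' \<subseteq> {1..<N - t}" by (rule tilings_subset[OF 2(3)])
    have "card W' = t * (a - 1) + b" by (rule "2.IH"(2)) (use 2 in auto)
    moreover have "card W = card W' + card {Suc N - t..N}"
      unfolding 2(4) by (rule card_Un_disjoint) (use s finite_subset[OF s] in force)+
    moreover have "t * a = t * (a - 1) + t" using 2(2) by (cases a) auto
    ultimately show ?thesis using 2(1) by simp
  next
    case 3
    have s: "W' \<subseteq> {1..<N - t}" by (rule tilings_subset[OF 3(4)])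
    have "card W' = t * (a - 1) + (b - 1)" by (rule "2.IH"(3)) (use 3 in auto)
    moreover have "card W = card W' + card {N - t..N}"
      unfolding 3(5) by (rule card_Un_disjoint) (use s finite_subset[OF s] in force)+
    moreover have "t * a = t * (a - 1) + t" using 3(2) by (cases a) auto
    ultimately show ?thesis using 3(1,3) by simp
  qed
qed (auto split: if_splits)

text \<open>
  The intervals inside \<open>W\<close> cover \<open>W\<close> in an essentially unique way when \<open>W\<close> comes from a word:
  a letter with \<open>t\<close> vertices needs one interval, a letter with \<open>t + 1\<close> vertices two.
\<close>

lemma concentrated_line:
  assumes t: "0 < t"
  shows "W \<subseteq> {1..<N} \<Longrightarrow>
    (\<exists>a b. W \<in> tilings t N a b \<and>
       concentrated K (cover_family (\<lambda>g. {g..<g + t}) {g. {g..<g + t} \<subseteq> W} W) (a + b) 1) \<or>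
    ((\<forall>k. concentrated K (cover_family (\<lambda>g. {g..<g + t}) {g. {g..<g + t} \<subseteq> W} W) k 0) \<and>
       (\<forall>a b. W \<notin> tilings t N a b))"
proof (induction N arbitrary: W rule: less_induct)
  case (less N)
  let ?I = "\<lambda>g. {g..<g + t}"
  let ?G = "\<lambda>W. {g. ?I g \<subseteq> W}"
  have inG: "g \<in> V" if "g \<in> ?G V" for g V using that t by auto
  have fin: "finite W" using less.prems finite_subset by blast
  have finG: "finite (?G W)" by (rule finite_subset[OF _ fin]) (use inG in blast)
  show ?case
  proof (cases N)
    case 0
    hence W: "W = {}" using less.prems by auto
    have G: "?G W = {}" using inG[of _ W] unfolding W by blast
    have "W \<in> tilings t N 0 0" using 0 W by simp
    moreover have "concentrated K (cover_family ?I (?G W) W) (0 + 0) 1"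
      unfolding G unfolding W using concentrated_cover_empty by simp
    ultimately show ?thesis by blast
  next
    case (Suc M)
    have Wle: "v \<le> M" "1 \<le> v" if "v \<in> W" for v using less.prems that Suc by auto
    show ?thesis
    proof (cases "M \<in> W")
      case False
      have "W \<subseteq> {1..<M}"
      proof
        fix v assume v: "v \<in> W"
        moreover have "v \<noteq> M" using v False by blast
        ultimately show "v \<in> {1..<M}" using Wle[OF v] by auto
      qed
      moreover have "W \<in> tilings t (Suc M) a b \<longleftrightarrow> W \<in> tilings t M a b" for a b
        using False t by (auto split: if_splits)
      ultimately show ?thesis using less.IH[of M W] Suc by auto
    next
      case M: True
      have notM: "W \<notin> tilings t M a b" for a b using tilings_subset[of W t M a b] M by force
      have gmax: "g \<le> Suc M - t" "t \<le> Suc M" if "g \<in> ?G W" for g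
      proof -
        have "g + t - 1 \<in> ?I g" using t by auto
        hence "g + t - 1 \<le> M" using that Wle by blast
        thus "g \<le> Suc M - t" "t \<le> Suc M" by auto
      qed
      show ?thesis
      proof (cases "t \<le> M \<and> {Suc M - t..M} \<subseteq> W")
        case False
        have "concentrated K (cover_family ?I (?G W) W) k 0" for k
        proof (rule concentrated_cover_uncovered[OF finG M])
          fix g assume g: "g \<in> ?G W"
          show "M \<notin> ?I g"
          proof
            assume "M \<in> ?I g"
            hence e: "g + t = Suc M" using gmax[OF g] by auto
            have "{Suc M - t..M} \<subseteq> W"
            proof
              fix v assume "v \<in> {Suc M - t..M}"
              hence "v \<in> ?I g" using e by auto
              thus "v \<in> W" using g by blast
            qed
            moreover have "1 \<le> g" using Wle inG[OF g] by blast
            hence "t \<le> M" using e by linarith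
            ultimately show False using False by blast
          qed
        qed
        moreover have "W \<notin> tilings t N a b" for a b
        proof
          assume "W \<in> tilings t N a b"
          hence "t \<le> M \<and> {Suc M - t..M} \<subseteq> W"
            unfolding Suc using notM by (auto split: if_splits)
          thus False using False by blast
        qed
        ultimately show ?thesis by blast
      next
        case C: True
        \<comment> \<open>The interval from \<open>?h\<close> is forced, and \<open>?W1\<close> remains; its top vertex is \<open>M - t\<close> or lower.\<close>
        let ?h = "Suc M - t"
        let ?W1 = "{v\<in>W. v < ?h}" and ?G1 = "{g\<in>?G W. g + t \<le> M}"
        let ?V = "{v\<in>W. v < M - t}"
        have h: "?h \<in> ?G W" using C by auto
        have step: "concentrated K (cover_family ?I (?G W) W) (Suc k) b"
          if "concentrated K (cover_family ?I ?G1 ?W1) k b" for k b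
          by (rule concentrated_interval_step[OF finG h _ M _ _ _ that])
            (use gmax Wle t C in auto)
        have Vsub: "?V \<subseteq> {1..<M - t}" using Wle by auto
        have dec: "W' = ?V" if s: "W' \<subseteq> {1..<M - t}" and e: "W = W' \<union> {Suc M - t..M}" for W'
        proof -
          have "v < M - t" if "v \<in> W'" for v using that s by auto
          thus ?thesis unfolding e by auto
        qed
        have dec': "W' = ?V" if s: "W' \<subseteq> {1..<M - t}" and e: "W = W' \<union> {M - t..M}" for W'
        proof -
          have "v < M - t" if "v \<in> W'" for v using that s by auto
          thus ?thesis unfolding e by auto
        qed
        have IH: "(\<exists>a b. ?V \<in> tilings t (M - t) a b \<and> concentrated K (cover_family ?I (?G ?V) ?V) (a + b) 1) \<or>
            ((\<forall>k. concentrated K (cover_family ?I (?G ?V) ?V) k 0) \<and> (\<forall>a b. ?V \<notin> tilings t (M - t) a b))"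
          by (rule less.IH[OF _ Vsub]) (use Suc in auto)
        show ?thesis
        proof (cases "M - t \<in> W")
          case False
          \<comment> \<open>The first letter is \<open>t\<close> vertices and a gap; the interval covers it.\<close>
          have W1: "?W1 = ?V"
          proof -
            have "v < M - t" if "v \<in> W" "v < Suc M - t" for v
              using that False C by (cases "v = M - t") auto
            thus ?thesis by auto
          qed
          have G1: "?G1 = ?G ?V"
          proof (intro Set.set_eqI iffI)
            fix g assume g: "g \<in> ?G1"
            have "M - t \<notin> ?I g" using g False by blast
            moreover have "g \<le> M - t" using g by auto
            ultimately have "g + t \<le> M - t" using g by auto
            thus "g \<in> ?G ?V" using g by auto
          next
            fix g assume g: "g \<in> ?G ?V"
            moreover have "g + t - 1 \<in> ?I g" using t by auto
            ultimately have "g + t - 1 \<in> ?V" by blast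
            thus "g \<in> ?G1" using g by auto
          qed
          have WV: "W = ?V \<union> {Suc M - t..M}"
          proof (intro Set.set_eqI iffI)
            fix v assume "v \<in> W"
            thus "v \<in> ?V \<union> {Suc M - t..M}" using Wle[of v] W1 by (cases "v < ?h") auto
          qed (use C in auto)
          have til: "W \<in> tilings t N a b \<longleftrightarrow> a \<noteq> 0 \<and> ?V \<in> tilings t (M - t) (a - 1) b" for a b
          proof
            assume "W \<in> tilings t N a b"
            moreover have "W \<noteq> W' \<union> {M - t..M}" for W' using False by auto
            ultimately obtain W' where W': "a \<noteq> 0" "W' \<in> tilings t (M - t) (a - 1) b" "W = W' \<union> {Suc M - t..M}"
              unfolding Suc using notM by (auto split: if_splits)
            thus "a \<noteq> 0 \<and> ?V \<in> tilings t (M - t) (a - 1) b" using dec[OF tilings_subset W'(3)] by metis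
          next
            assume "a \<noteq> 0 \<and> ?V \<in> tilings t (M - t) (a - 1) b"
            thus "W \<in> tilings t N a b" unfolding Suc using C WV by auto
          qed
          from IH show ?thesis
          proof
            assume "\<exists>a b. ?V \<in> tilings t (M - t) a b \<and> concentrated K (cover_family ?I (?G ?V) ?V) (a + b) 1"
            then obtain a b where ab: "?V \<in> tilings t (M - t) a b"
              "concentrated K (cover_family ?I (?G ?V) ?V) (a + b) 1" by blast
            have "concentrated K (cover_family ?I (?G W) W) (Suc a + b) 1"
              unfolding add_Suc by (rule step) (use ab G1 W1 in simp)
            moreover have "W \<in> tilings t N (Suc a) b" using til[of "Suc a" b] ab by simp
            ultimately show ?thesis by blast
          next
            assume h: "(\<forall>k. concentrated K (cover_family ?I (?G ?V) ?V) k 0) \<and> (\<forall>a b. ?V \<notin> tilings t (M - t) a b)"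
            have one: "concentrated K (cover_family ?I (?G W) W) (Suc k) 0" for k
              by (rule step) (use h G1 W1 in simp)
            have "concentrated K (cover_family ?I (?G W) W) k 0" for k
              by (rule concentrated_zero) (rule one)+
            moreover have "W \<notin> tilings t N a b" for a b using til[of a b] h by blast
            ultimately show ?thesis by blast
          qed
        next
          case T: True
          hence Mt: "1 \<le> M - t" using Wle by blast
          \<comment> \<open>The first letter is full: a second interval, starting at its bottom vertex \<open>M - t\<close>, is forced.\<close>
          let ?h1 = "M - t"
          let ?W2 = "{v\<in>?W1. v < ?h1}" and ?G2 = "{g\<in>?G1. g + t \<le> M - t}"
          have sub: "{M - t..M} \<subseteq> W"
          proof
            fix v assume "v \<in> {M - t..M}"
            thus "v \<in> W" using T C by (cases "v = M - t") auto
          qed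
          have h1: "?h1 \<in> ?G1" using sub Mt by auto
          have w1: "?h1 \<in> ?W1" using T Mt by auto
          have step2: "concentrated K (cover_family ?I ?G1 ?W1) (Suc k) b"
            if "concentrated K (cover_family ?I ?G2 ?W2) k b" for k b
            by (rule concentrated_interval_step[OF _ h1 _ w1 _ _ _ that])
              (use finG t in auto)
          have W2: "?W2 = ?V" by auto
          have G2: "?G2 = ?G ?V"
          proof (intro Set.set_eqI iffI)
            fix g assume g: "g \<in> ?G ?V"
            moreover have "g + t - 1 \<in> ?I g" using t by auto
            ultimately have "g + t - 1 \<in> ?V" by blast
            thus "g \<in> ?G2" using g by auto
          qed auto
          have WV: "W = ?V \<union> {M - t..M}" using sub Wle by force
          have til: "W \<in> tilings t N a b \<longleftrightarrow> a \<noteq> 0 \<and> b \<noteq> 0 \<and> ?V \<in> tilings t (M - t) (a - 1) (b - 1)" for a b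
          proof
            assume "W \<in> tilings t N a b"
            moreover have "W \<noteq> W' \<union> {Suc M - t..M}" if "W' \<in> tilings t (M - t) a' b'" for W' a' b'
              using T tilings_subset[OF that] Mt by auto
            ultimately obtain W' where W': "a \<noteq> 0" "b \<noteq> 0" "W' \<in> tilings t (M - t) (a - 1) (b - 1)" "W = W' \<union> {M - t..M}"
              unfolding Suc using notM by (auto split: if_splits)
            thus "a \<noteq> 0 \<and> b \<noteq> 0 \<and> ?V \<in> tilings t (M - t) (a - 1) (b - 1)" using dec'[OF tilings_subset W'(4)] by metis
          next
            assume "a \<noteq> 0 \<and> b \<noteq> 0 \<and> ?V \<in> tilings t (M - t) (a - 1) (b - 1)"
            thus "W \<in> tilings t N a b" unfolding Suc using Mt WV by auto
          qed
          from IH show ?thesis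
          proof
            assume "\<exists>a b. ?V \<in> tilings t (M - t) a b \<and> concentrated K (cover_family ?I (?G ?V) ?V) (a + b) 1"
            then obtain a b where ab: "?V \<in> tilings t (M - t) a b"
              "concentrated K (cover_family ?I (?G ?V) ?V) (a + b) 1" by blast
            have "concentrated K (cover_family ?I (?G W) W) (Suc a + Suc b) 1"
              unfolding add_Suc add_Suc_right by (rule step, rule step2) (use ab G2 W2 in simp)
            moreover have "W \<in> tilings t N (Suc a) (Suc b)" using til[of "Suc a" "Suc b"] ab by simp
            ultimately show ?thesis by blast
          next
            assume h: "(\<forall>k. concentrated K (cover_family ?I (?G ?V) ?V) k 0) \<and> (\<forall>a b. ?V \<notin> tilings t (M - t) a b)"
            \<comment> \<open>The steps only give concentration in positive degrees; two of these together give vanishing.\<close>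
            have two: "concentrated K (cover_family ?I (?G W) W) (Suc (Suc k)) 0" for k
              by (rule step, rule step2) (use h G2 W2 in simp)
            have one1: "concentrated K (cover_family ?I ?G1 ?W1) (Suc k) 0" for k
              by (rule step2) (use h G2 W2 in simp)
            have "concentrated K (cover_family ?I ?G1 ?W1) 0 0"
              by (rule concentrated_zero) (rule one1)+
            hence one: "concentrated K (cover_family ?I (?G W) W) (Suc 0) 0" by (rule step)
            have "concentrated K (cover_family ?I (?G W) W) k 0" for k
              by (rule concentrated_zero[OF two one])
            moreover have "W \<notin> tilings t N a b" for a b using til[of a b] h by blast
            ultimately show ?thesis by blast
          qed
        qed
      qed
    qed
  qed
qed

section \<open>Covers of the cycle by arcs\<close>

definition arc :: "nat \<Rightarrow> nat \<Rightarrow> nat \<Rightarrow> nat set" where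
  "arc n t s = (\<lambda>u. (s + u) mod n) ` {..<t}"

lemma arc_iff:
  assumes "s < n" "t \<le> n"
  shows "v \<in> arc n t s \<longleftrightarrow> v < n \<and> (s \<le> v \<and> v < s + t \<or> v + n < s + t)"
proof
  assume "v \<in> arc n t s"
  then obtain u where u: "u < t" "v = (s + u) mod n" by (auto simp: arc_def)
  show "v < n \<and> (s \<le> v \<and> v < s + t \<or> v + n < s + t)"
  proof (cases "s + u < n")
    case True thus ?thesis using u by simp
  next
    case False
    hence "v = s + u - n" using u assms by (simp add: mod_if)
    thus ?thesis using False u assms by auto
  qed
next
  assume v: "v < n \<and> (s \<le> v \<and> v < s + t \<or> v + n < s + t)"
  show "v \<in> arc n t s"
  proof (cases "s \<le> v \<and> v < s + t")
    case True
    hence "v = (s + (v - s)) mod n" "v - s < t" using v by auto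
    thus ?thesis unfolding arc_def by blast
  next
    case False
    hence "s + (v + n - s) = v + n" "v + n - s < t" using v assms by auto
    hence "v = (s + (v + n - s)) mod n" "v + n - s < t" using v by auto
    thus ?thesis unfolding arc_def by blast
  qed
qed

text \<open>
  The linear covering problems left over by the cycle: two steps from the top shorten the problem by
  \<open>t + 1\<close>, until either nothing remains to be covered (one cell), or a useless interval or an uncovered
  point remains (no homology).
\<close>

lemma concentrated_pairs:
  assumes y: "1 \<le> y" "y \<le> t" and d: "d \<le> t"
  shows "concentrated K (cover_family (\<lambda>g. {g..<g + t}) {t + 1 - y..<(t + 1) * Suc q + d - y} {t..<(t + 1) * Suc q + d - y})
     (if d = 0 then 2 * q else 2 * q + 1) (if d = 0 \<or> d = y then 1 else 0)"
proof (induction q)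
  case 0
  let ?G = "{t + 1 - y..<t + 1 + d - y}" and ?W = "{t..<t + 1 + d - y}" and ?I = "\<lambda>g. {g..<g + t}"
  have "concentrated K (cover_family ?I ?G ?W) (if d = 0 then 0 else 1) (if d = 0 \<or> d = y then 1 else 0)"
  proof -
    consider "d = 0" | "d \<noteq> 0" "d < y" | "d \<noteq> 0" "y \<le> d" by linarith
    thus ?thesis
    proof cases
      case 1
      hence "?G = {}" "?W = {}" using y by auto
      thus ?thesis using 1 concentrated_cover_empty by simp
    next
      case 2
      hence "?W = {}" "t + 1 - y \<in> ?G" using y by auto
      thus ?thesis using 2 concentrated_cover_useless[of ?G "t + 1 - y" ?I ?W] by simp
    next
      case 3
      let ?w = "t + d - y"
      have "{g\<in>?G. g + t \<le> ?w} = {}" using d y by auto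
      moreover have "{v\<in>?W. v < ?w} = {t..<?w}" using 3 y by auto
      moreover have "concentrated K (cover_family ?I {} {t..<?w}) 0 (if d = y then 1 else 0)"
      proof (cases "d = y")
        case True thus ?thesis using concentrated_cover_empty by simp
      next
        case False
        hence "t \<in> {t..<?w}" using 3 by auto
        thus ?thesis using False concentrated_cover_uncovered[of "{}" t "{t..<?w}" ?I] by simp
      qed
      ultimately have "concentrated K (cover_family ?I {g\<in>?G. g + t \<le> ?w} {v\<in>?W. v < ?w}) 0 (if d = y then 1 else 0)"
        by (simp only:)
      hence "concentrated K (cover_family ?I ?G ?W) (Suc 0) (if d = y then 1 else 0)"
        by (rule concentrated_interval_step[rotated -1]) (use 3 y d in auto)
      thus ?thesis using 3 by simp
    qed
  qed
  moreover have "(t + 1) * Suc 0 + d = t + 1 + d" by simp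
  moreover have "(if d = 0 then 2 * 0 else 2 * 0 + 1) = (if d = 0 then 0 else 1 :: nat)" by simp
  ultimately show ?case by (simp only:)
next
  case (Suc q)
  define e where "e = (t + 1) * Suc q + d"
  have e: "(t + 1) * Suc (Suc q) + d = e + t + 1" "t + 1 \<le> e" by (simp_all add: e_def)
  let ?G = "{t + 1 - y..<e + t + 1 - y}" and ?W = "{t..<e + t + 1 - y}" and ?I = "\<lambda>g. {g..<g + t}"
  let ?w = "e + t - y"
  let ?G1 = "{g\<in>?G. g + t \<le> ?w}" and ?W1 = "{v\<in>?W. v < ?w}"
  let ?h = "e - y" and ?w1 = "e + t - y - 1"
  have G2: "{g\<in>?G1. g + t \<le> ?w1} = {t + 1 - y..<e - y}" using e y by auto
  have W2: "{v\<in>?W1. v < ?h} = {t..<e - y}" using e y by auto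
  have "concentrated K (cover_family ?I {g\<in>?G1. g + t \<le> ?w1} {v\<in>?W1. v < ?h})
      (if d = 0 then 2 * q else 2 * q + 1) (if d = 0 \<or> d = y then 1 else 0)"
    unfolding G2 W2 using Suc.IH by (simp only: e_def)
  hence "concentrated K (cover_family ?I ?G1 ?W1)
      (Suc (if d = 0 then 2 * q else 2 * q + 1)) (if d = 0 \<or> d = y then 1 else 0)"
    by (rule concentrated_interval_step[rotated -1]) (use e y in auto)
  hence "concentrated K (cover_family ?I ?G ?W)
      (Suc (Suc (if d = 0 then 2 * q else 2 * q + 1))) (if d = 0 \<or> d = y then 1 else 0)"
    by (rule concentrated_interval_step[rotated -1]) (use e y in auto)
  moreover have "Suc (Suc (if d = 0 then 2 * q else 2 * q + 1)) = (if d = 0 then 2 * Suc q else 2 * Suc q + 1)" by simp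
  ultimately show ?case by (simp only: e(1))
qed

text \<open>
  Arc \<open>0\<close> can be toggled except in covers that need it.  In those, if \<open>n - y\<close> is the last other
  start, then vertex \<open>t - y\<close> is reached by arc \<open>0\<close> only; cutting there leaves a linear covering
  problem for every \<open>y\<close>.
\<close>

lemma concentrated_cycle_large:
  assumes t: "2 \<le> t" and n: "n = (t + 1) * Suc q + d" and d: "d \<le> t"
  shows "concentrated K (cover_family (arc n t) {..<n} {..<n})
     (if d = 0 then 2 * Suc q else 2 * Suc q + 1) (if d = 0 then t else 1)"
proof -
  let ?X = "cover_family (arc n t) {..<n} {..<n}"
  let ?I = "\<lambda>g. {g..<g + t}"
  have tn: "t < n" using n by simp
  have X: "convex_family ?X" by (rule convex_cover_family) simp
  have mem: "v \<in> arc n t s \<longleftrightarrow> v < n \<and> (s \<le> v \<and> v < s + t \<or> v + n < s + t)" if "s < n" for s v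
    using arc_iff[OF that] tn by simp
  have inX: "S \<in> ?X \<longleftrightarrow> S \<subseteq> {..<n} \<and> (\<forall>v<n. \<exists>s\<in>S. v \<in> arc n t s)" for S
    unfolding cover_family_def by auto
  have finS: "finite S" if "S \<in> ?X" for S using that inX finite_subset by blast
  have up: "insert s S \<in> ?X" if "S \<in> ?X" "s < n" for s S using that unfolding inX by blast
  \<comment> \<open>Fibre \<open>0\<close> holds the covers that do not need arc \<open>0\<close>; the others are sorted by their last arc.\<close>
  define needed where "needed = (\<lambda>S. 0 \<in> S \<and> S - {0} \<notin> ?X)"
  define f where "f = (\<lambda>S. if needed S then n - Max S else 0)"
  have Maxn: "Max S < n" if "S \<in> ?X" for S
  proof -
    have "S \<noteq> {}" using that tn inX by force
    thus ?thesis using Max_in[OF finS[OF that]] that inX by blast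
  qed
  have Max_ge_n: "n - t \<le> Max S" if S: "S \<in> ?X" for S
  proof -
    have "n - 1 < n" using tn by simp
    then obtain s where s: "s \<in> S" "n - 1 \<in> arc n t s" using S unfolding inX by blast
    have "s < n" using s S inX by blast
    hence "n - t \<le> s" using s(2) mem by auto
    thus ?thesis using Max_ge[OF finS[OF S] s(1)] by simp
  qed
  have mono: "f \<sigma> \<le> f \<tau>" if st: "\<sigma> \<in> ?X" "\<tau> \<in> ?X" "\<tau> \<subseteq> \<sigma>" for \<sigma> \<tau>
  proof (cases "needed \<sigma>")
    case True
    have "\<tau> \<subseteq> \<sigma> - {0} \<Longrightarrow> \<sigma> - {0} \<in> ?X" using st unfolding inX by blast
    hence "0 \<in> \<tau>" using True st by (auto simp: needed_def)
    moreover have "\<tau> - {0} \<in> ?X \<Longrightarrow> \<sigma> - {0} \<in> ?X" using st unfolding inX by blast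
    ultimately have "needed \<tau>" using True by (auto simp: needed_def)
    moreover have "Max \<tau> \<le> Max \<sigma>"
      by (rule Max_mono[OF st(3) _ finS[OF st(1)]]) (use \<open>0 \<in> \<tau>\<close> in auto)
    ultimately show ?thesis using True by (simp add: f_def)
  qed (simp add: f_def)
  \<comment> \<open>Toggling arc \<open>0\<close> makes this fibre a cone.\<close>
  have fibre0: "concentrated K {S\<in>?X. f S = 0} k 0" for k
  proof (rule concentrated_cone[where v = 0])
    show "convex_family {S\<in>?X. f S = 0}" by (rule convex_family_fibre[OF X]) (rule mono)
    fix S assume "S \<in> {S\<in>?X. f S = 0}"
    hence S: "S \<in> ?X" "\<not> needed S" using Maxn[of S] by (auto simp: f_def split: if_splits)
    have "S - {0} \<in> ?X" using S by (cases "0 \<in> S") (auto simp: needed_def)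
    moreover have "insert 0 S \<in> ?X" using up S tn by simp
    moreover have "insert 0 S - {0} = S - {0}" by auto
    ultimately show "insert 0 S \<in> {S\<in>?X. f S = 0} \<and> S - {0} \<in> {S\<in>?X. f S = 0}"
      by (auto simp: f_def needed_def)
  qed
  have fibre: "{S\<in>?X. f S = y} = insert 0 ` insert (n - y) ` cover_family ?I {t + 1 - y..<n - y} {t..<n - y}"
    if y: "1 \<le> y" "y \<le> t" for y
  proof (intro Set.set_eqI iffI)
    fix S assume "S \<in> {S\<in>?X. f S = y}"
    hence SX: "S \<in> ?X" and nd: "needed S" and fy: "n - Max S = y" using y by (auto simp: f_def split: if_splits)
    have max: "Max S = n - y" using fy Maxn[OF SX] by simp
    have ny: "n - y \<in> S" using Max_in[OF finS[OF SX]] nd max by (auto simp: needed_def)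
    have le: "s \<le> n - y" "s < n" if "s \<in> S" for s
      using Max_ge[OF finS[OF SX] that] max that SX inX by auto
    define S' where "S' = S - {0, n - y}"
    \<comment> \<open>An arc starting at \<open>1, \<dots>, t - y\<close> would cover, together with arc \<open>n - y\<close>, all of arc \<open>0\<close>.\<close>
    have low: "t + 1 - y \<le> g" if g: "g \<in> S'" for g
    proof (rule ccontr)
      assume "\<not> t + 1 - y \<le> g"
      hence gy: "g + y \<le> t" "g \<noteq> 0" "g \<in> S" "g < n" using g le by (auto simp: S'_def)
      have "S - {0} \<in> ?X"
        unfolding inX
      proof (intro conjI allI impI)
        fix v assume v: "v < n"
        then obtain s where s: "s \<in> S" "v \<in> arc n t s" using SX unfolding inX by blast
        show "\<exists>s\<in>S - {0}. v \<in> arc n t s"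
        proof (cases "s = 0")
          case True
          hence vt: "v < t" using s mem[of 0 v] tn by auto
          show ?thesis
          proof (cases "v + y < t")
            case True
            hence "v \<in> arc n t (n - y)" using mem[of "n - y" v] v y tn by auto
            thus ?thesis using ny y tn by (intro bexI[of _ "n - y"]) auto
          next
            case False
            hence "v \<in> arc n t g" using mem[of g v] v vt gy by auto
            thus ?thesis using gy by blast
          qed
        qed (use s in blast)
      qed (use SX inX in auto)
      thus False using nd by (simp add: needed_def)
    qed
    have "S' \<in> cover_family ?I {t + 1 - y..<n - y} {t..<n - y}"
      unfolding cover_family_def
    proof (intro CollectI conjI subsetI)
      fix g assume g: "g \<in> S'"
      have "g \<le> n - y" "g \<noteq> n - y" using g le by (auto simp: S'_def)
      thus "g \<in> {t + 1 - y..<n - y}" using low[OF g] by auto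
    next
      fix v assume v: "v \<in> {t..<n - y}"
      hence "v < n" by auto
      then obtain s where s: "s \<in> S" "v \<in> arc n t s" using SX unfolding inX by blast
      have iv: "s \<le> v \<and> v < s + t" using s le[OF s(1)] mem[of s v] v tn by auto
      hence "s \<in> S'" using s v by (auto simp: S'_def)
      thus "v \<in> (\<Union>s\<in>S'. ?I s)" using iv by auto
    qed
    moreover have "S = insert 0 (insert (n - y) S')" using nd ny by (auto simp: S'_def needed_def)
    ultimately show "S \<in> insert 0 ` insert (n - y) ` cover_family ?I {t + 1 - y..<n - y} {t..<n - y}" by blast
  next
    fix S assume "S \<in> insert 0 ` insert (n - y) ` cover_family ?I {t + 1 - y..<n - y} {t..<n - y}"
    then obtain S' where S': "S = insert 0 (insert (n - y) S')" "S' \<in> cover_family ?I {t + 1 - y..<n - y} {t..<n - y}"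
      by blast
    have rng: "t + 1 - y \<le> g" "g < n - y" if "g \<in> S'" for g
      using S'(2) that unfolding cover_family_def by auto
    have SX: "S \<in> ?X"
      unfolding inX
    proof (intro conjI allI impI)
      show "S \<subseteq> {..<n}" using rng tn y unfolding S'(1) by fastforce
      fix v assume v: "v < n"
      consider "v < t" | "t \<le> v" "v < n - y" | "n - y \<le> v" by linarith
      thus "\<exists>s\<in>S. v \<in> arc n t s"
      proof cases
        case 1 thus ?thesis using mem[of 0 v] v tn S'(1) by auto
      next
        case 2
        then obtain g where g: "g \<in> S'" "v \<in> ?I g" using S'(2) unfolding cover_family_def by fastforce
        hence "v \<in> arc n t g" using mem[of g v] v rng[OF g(1)] by auto
        thus ?thesis using g S'(1) by blast
      next
        case 3
        hence "v \<in> arc n t (n - y)" using mem[of "n - y" v] v y tn by auto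
        thus ?thesis using S'(1) by blast
      qed
    qed
    have "S - {0} \<notin> ?X"
    proof
      assume "S - {0} \<in> ?X"
      \<comment> \<open>Vertex \<open>t - y\<close> lies above the end of arc \<open>n - y\<close> and below the start of all others, none of which wraps that far.\<close>
      moreover have "t - y < n" using tn by simp
      ultimately obtain s where s: "s \<in> S - {0}" "t - y \<in> arc n t s" unfolding inX by blast
      show False
      proof (cases "s = n - y")
        case True thus ?thesis using s(2) mem[of "n - y" "t - y"] y tn by auto
      next
        case False
        hence sS: "s \<in> S'" using s S'(1) by blast
        hence "s < n" using rng(2) by fastforce
        thus ?thesis using s(2) mem[of s "t - y"] rng[OF sS] y tn by auto
      qed
    qed
    moreover have "Max S = n - y"
    proof (rule Max_eqI)
      show "s \<le> n - y" if "s \<in> S" for s using that rng[of s] S'(1) by auto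
    qed (use finS[OF SX] S'(1) in auto)
    moreover have "0 \<in> S" using S'(1) by simp
    ultimately show "S \<in> {S\<in>?X. f S = y}" using SX y tn by (simp add: f_def needed_def)
  qed
  let ?k = "if d = 0 then 2 * Suc q else 2 * Suc q + 1"
  have "concentrated K {S\<in>?X. f S = y} ?k (if y = 0 then 0 else if d = 0 \<or> d = y then 1 else 0)" if "y \<in> {..t}" for y
  proof (cases "y = 0")
    case True
    have "concentrated K {S\<in>?X. f S = y} ?k 0" unfolding True by (rule fibre0)
    thus ?thesis using True by (simp only: simp_thms if_True)
  next
    case False
    hence y: "1 \<le> y" "y \<le> t" using that by auto
    let ?b = "if d = 0 \<or> d = y then 1 else 0 :: nat"
    have "concentrated K (cover_family ?I {t + 1 - y..<n - y} {t..<n - y}) (if d = 0 then 2 * q else 2 * q + 1) ?b"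
      unfolding n by (rule concentrated_pairs[OF y d])
    hence "concentrated K (insert (n - y) ` cover_family ?I {t + 1 - y..<n - y} {t..<n - y})
        (Suc (if d = 0 then 2 * q else 2 * q + 1)) ?b"
      by (rule concentrated_insert) (auto simp: cover_family_def)
    hence "concentrated K (insert 0 ` insert (n - y) ` cover_family ?I {t + 1 - y..<n - y} {t..<n - y})
        (Suc (Suc (if d = 0 then 2 * q else 2 * q + 1))) ?b"
      by (rule concentrated_insert) (use y tn in \<open>force simp: cover_family_def\<close>)
    moreover have "Suc (Suc (if d = 0 then 2 * q else 2 * q + 1)) = ?k" by simp
    ultimately have "concentrated K {S\<in>?X. f S = y} ?k ?b" unfolding fibre[OF y] by (simp only:)
    thus ?thesis using False by (simp only: if_False)
  qed
  note fib = this
  have "concentrated K ?X ?k (\<Sum>y\<in>{..t}. if y = 0 then 0 else if d = 0 \<or> d = y then 1 else 0)"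
  proof (rule concentrated_fibres[OF X mono _ _ fib])
    show "f ` ?X \<subseteq> {..t}"
    proof
      fix r assume "r \<in> f ` ?X"
      then obtain S where "S \<in> ?X" "r = f S" by blast
      thus "r \<in> {..t}" using Max_ge_n[of S] tn by (auto simp: f_def)
    qed
  qed auto
  \<comment> \<open>Each of the \<open>t\<close> positions contributes if \<open>d = 0\<close>, and only the position \<open>d\<close> otherwise.\<close>
  moreover have "(\<Sum>y\<in>{..t}. if y = 0 then 0 else if d = 0 \<or> d = y then 1 else 0 :: nat) = (if d = 0 then t else 1)"
  proof (cases "d = 0")
    case True
    have "(\<Sum>y\<in>{..t}. if y = 0 then 0 else if d = 0 \<or> d = y then 1 else 0 :: nat) = (\<Sum>y\<in>{1..t}. 1)"
      by (rule sum.mono_neutral_cong_right) (use True in auto)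
    thus ?thesis using True by simp
  next
    case False
    have "(\<Sum>y\<in>{..t}. if y = 0 then 0 else if d = 0 \<or> d = y then 1 else 0 :: nat) = (\<Sum>y\<in>{..t}. if y = d then 1 else 0)"
      by (rule sum.cong) (use False in auto)
    thus ?thesis using False d by simp
  qed
  ultimately show ?thesis by simp
qed

text \<open>
  For \<open>t = n\<close> each arc is the whole cycle, so every nonempty set of arcs is a cover; toggling arc \<open>0\<close>
  leaves only the cover \<open>{0}\<close>.
\<close>

lemma concentrated_cycle_small:
  assumes n: "2 \<le> n"
  shows "concentrated K (cover_family (arc n n) {..<n} {..<n}) 1 1"
proof -
  let ?X = "cover_family (arc n n) {..<n} {..<n}"
  have full: "arc n n s = {..<n}" if "s < n" for s by (auto simp: arc_iff[OF that])
  have inX: "S \<in> ?X \<longleftrightarrow> S \<subseteq> {..<n} \<and> S \<noteq> {}" for S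
  proof
    assume "S \<subseteq> {..<n} \<and> S \<noteq> {}"
    hence S: "S \<subseteq> {..<n}" and "S \<noteq> {}" by auto
    then obtain s where "s \<in> S" "s < n" by blast
    hence "{..<n} \<subseteq> (\<Union>s\<in>S. arc n n s)" using full[of s] by blast
    thus "S \<in> ?X" using S unfolding cover_family_def by blast
  next
    assume "S \<in> ?X"
    moreover have "0 \<in> {..<n}" using n by simp
    ultimately show "S \<subseteq> {..<n} \<and> S \<noteq> {}" unfolding cover_family_def by blast
  qed
  have X: "convex_family ?X" by (rule convex_cover_family) simp
  let ?f = "\<lambda>S. if S = {0} then 1 else 0 :: nat"
  have mono: "?f \<sigma> \<le> ?f \<tau>" if "\<sigma> \<in> ?X" "\<tau> \<in> ?X" "\<tau> \<subseteq> \<sigma>" for \<sigma> \<tau>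
    using that inX by auto
  have "concentrated K ?X 1 (\<Sum>r\<in>{0, 1 :: nat}. if r = 0 then 0 else 1)"
  proof (rule concentrated_fibres[OF X mono])
    fix r :: nat assume "r \<in> {0, 1}"
    hence "r = 0 \<or> r = 1" by simp
    thus "concentrated K {S\<in>?X. ?f S = r} 1 (if r = 0 then 0 else 1)"
    proof
      assume r: "r = 0"
      have "concentrated K {S\<in>?X. ?f S = 0} 1 0"
      proof (rule concentrated_cone[where v = 0])
        show "convex_family {S\<in>?X. ?f S = 0}" by (rule convex_family_fibre[OF X mono])
        fix S assume "S \<in> {S\<in>?X. ?f S = 0}"
        hence S: "S \<subseteq> {..<n}" "S \<noteq> {}" "S \<noteq> {0}" using inX by (auto split: if_splits)
        hence "S - {0} \<noteq> {}" "insert 0 S \<noteq> {0}" by auto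
        thus "insert 0 S \<in> {S\<in>?X. ?f S = 0} \<and> S - {0} \<in> {S\<in>?X. ?f S = 0}"
          using S n unfolding mem_Collect_eq inX by auto
      qed
      thus ?thesis unfolding r by (simp only: simp_thms if_True)
    next
      assume r: "r = 1"
      have "{S\<in>?X. ?f S = 1} = {{0}}" using inX n by auto
      hence "concentrated K {S\<in>?X. ?f S = 1} 1 1" using concentrated_single[of "{0}" K] by simp
      thus ?thesis unfolding r by (simp only: one_neq_zero if_False)
    qed
  qed auto
  thus ?thesis by simp
qed

text \<open>The cells of the Taylor complex whose least common multiple has support \<open>W\<close>.\<close>

definition strand :: "nat \<Rightarrow> nat \<Rightarrow> nat set \<Rightarrow> nat set set" where
  "strand n t W = {S. S \<subseteq> {..<n} \<and> (\<Union>s\<in>S. arc n t s) = W}"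

lemma strand_eq_cover: "strand n t W = cover_family (arc n t) {s. s < n \<and> arc n t s \<subseteq> W} W"
  unfolding strand_def cover_family_def by auto

lemma concentrated_strand_full:
  assumes "2 \<le> t" "t \<le> n" "n = (t + 1) * p + d" "d \<le> t"
  shows "concentrated K (strand n t {..<n}) (if d = 0 then 2 * p else 2 * p + 1) (if d = 0 then t else 1)"
proof -
  have "{s. s < n \<and> arc n t s \<subseteq> {..<n}} = {..<n}" using arc_iff[OF _ assms(2)] by auto
  hence e: "strand n t {..<n} = cover_family (arc n t) {..<n} {..<n}" unfolding strand_eq_cover by simp
  show ?thesis
  proof (cases p)
    case 0
    hence tn: "t = n" and d: "d \<noteq> 0" using assms by auto
    have "concentrated K (cover_family (arc n n) {..<n} {..<n}) 1 1"
      by (rule concentrated_cycle_small) (use assms in simp)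
    hence "concentrated K (strand n t {..<n}) 1 1" unfolding e unfolding tn .
    thus ?thesis using d 0 by simp
  next
    case (Suc q)
    show ?thesis unfolding e Suc by (rule concentrated_cycle_large[OF assms(1) assms(3)[unfolded Suc] assms(4)])
  qed
qed

text \<open>
  If vertex \<open>0\<close> is missing, the arcs inside \<open>W\<close> do not wrap around and are intervals.
\<close>

lemma concentrated_strand_proper:
  assumes t: "2 \<le> t" "t \<le> n" and W: "W \<subseteq> {1..<n}"
  shows "(\<exists>a b. W \<in> tilings t n a b \<and> concentrated K (strand n t W) (a + b) 1) \<or>
    ((\<forall>k. concentrated K (strand n t W) k 0) \<and> (\<forall>a b. W \<notin> tilings t n a b))"
proof -
  have arc_int: "arc n t s = {s..<s + t}" if "s < n" "arc n t s \<subseteq> W" for s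
  proof -
    have "0 \<notin> W" using W by auto
    hence "0 \<notin> arc n t s" using that(2) by blast
    hence "\<not> (n < s + t)" using arc_iff[OF that(1) t(2), of 0] that(1) by simp
    thus ?thesis by (auto simp: arc_iff[OF that(1) t(2)])
  qed
  have G: "{s. s < n \<and> arc n t s \<subseteq> W} = {s. {s..<s + t} \<subseteq> W}"
  proof (intro Set.set_eqI iffI)
    fix s assume "s \<in> {s. s < n \<and> arc n t s \<subseteq> W}"
    hence s: "s < n" "arc n t s \<subseteq> W" by auto
    thus "s \<in> {s. {s..<s + t} \<subseteq> W}" using arc_int[OF s] by simp
  next
    fix s assume s: "s \<in> {s. {s..<s + t} \<subseteq> W}"
    moreover have "s + t - 1 \<in> {s..<s + t}" using t by auto
    ultimately have "s + t - 1 \<in> W" by blast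
    hence "s + t - 1 < n" using W by auto
    hence sn: "s < n" "s + t \<le> n" using t by auto
    hence "arc n t s = {s..<s + t}" by (auto simp: arc_iff[OF sn(1) t(2)])
    thus "s \<in> {s. s < n \<and> arc n t s \<subseteq> W}" using s \<open>s < n\<close> by simp
  qed
  have "strand n t W = cover_family (\<lambda>g. {g..<g + t}) {s. s < n \<and> arc n t s \<subseteq> W} W"
    unfolding strand_eq_cover by (rule cover_family_cong) (use arc_int in auto)
  hence "strand n t W = cover_family (\<lambda>g. {g..<g + t}) {s. {s..<s + t} \<subseteq> W} W" unfolding G .
  thus ?thesis using concentrated_line[OF _ W, of t K] t by simp
qed

section \<open>Rotating the cycle\<close>

definition rot :: "nat \<Rightarrow> nat \<Rightarrow> nat \<Rightarrow> nat" where
  "rot n c v = (v + c) mod n"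

lemma rot_lt: "0 < n \<Longrightarrow> rot n c v < n"
  by (simp add: rot_def)

lemma rot_inverse:
  assumes "v < n" "c \<le> n"
  shows "rot n (n - c) (rot n c v) = v"
proof -
  have "rot n (n - c) (rot n c v) = (v + c + (n - c)) mod n" unfolding rot_def by (rule mod_add_left_eq)
  also have "v + c + (n - c) = v + n" using assms by simp
  finally show ?thesis using assms by simp
qed

lemma bij_rot: "c \<le> n \<Longrightarrow> bij_betw (rot n c) {..<n} {..<n}"
proof (rule bij_betw_byWitness[where f' = "rot n (n - c)"])
  assume c: "c \<le> n"
  show "\<forall>v\<in>{..<n}. rot n (n - c) (rot n c v) = v" using c by (simp add: rot_inverse)
  show "\<forall>v\<in>{..<n}. rot n c (rot n (n - c) v) = v" using c rot_inverse[of _ n "n - c"] by simp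
qed (auto simp: rot_lt)

lemma rot_arc: "rot n c ` arc n t s = arc n t (rot n c s)"
proof -
  have "rot n c ((s + u) mod n) = (rot n c s + u) mod n" for u
    unfolding rot_def mod_add_left_eq by (simp add: ac_simps)
  thus ?thesis unfolding arc_def image_image by simp
qed

lemma concentrated_rot:
  assumes c: "c \<le> n" and W: "W \<subseteq> {..<n}" and conc: "concentrated K (strand n t W) k b"
  shows "concentrated K (strand n t (rot n c ` W)) k b"
proof -
  have inj: "inj_on (rot n c) {..<n}" using bij_rot[OF c] by (simp add: bij_betw_def)
  have arcs: "(\<Union>s\<in>rot n c ` S. arc n t s) = rot n c ` (\<Union>s\<in>S. arc n t s)" for S
    by (simp add: image_UN rot_arc)
  have arcn: "arc n t s \<subseteq> {..<n}" if "s < n" for s using that by (auto simp: arc_def)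
  have "strand n t (rot n c ` W) = (`) (rot n c) ` strand n t W"
  proof (intro Set.set_eqI iffI)
    fix S assume "S \<in> strand n t (rot n c ` W)"
    hence S: "S \<subseteq> {..<n}" "(\<Union>s\<in>S. arc n t s) = rot n c ` W" by (auto simp: strand_def)
    then obtain S' where S': "S' \<subseteq> {..<n}" "S = rot n c ` S'"
      using bij_rot[OF c] by (metis bij_betw_imp_surj_on subset_imageE)
    have "rot n c ` (\<Union>s\<in>S'. arc n t s) = rot n c ` W" using S(2) unfolding S'(2) arcs .
    moreover have "(\<Union>s\<in>S'. arc n t s) \<subseteq> {..<n}" using S'(1) arcn by blast
    ultimately have "(\<Union>s\<in>S'. arc n t s) = W"
      using inj_on_image_eq_iff[OF inj, of "\<Union>s\<in>S'. arc n t s" W] W by blast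
    hence "S' \<in> strand n t W" using S'(1) unfolding strand_def by blast
    thus "S \<in> (`) (rot n c) ` strand n t W" unfolding S'(2) by (rule imageI)
  next
    fix S assume "S \<in> (`) (rot n c) ` strand n t W"
    then obtain S' where S': "S' \<subseteq> {..<n}" "(\<Union>s\<in>S'. arc n t s) = W" "S = rot n c ` S'"
      by (auto simp: strand_def)
    have "rot n c s < n" if "s \<in> S'" for s
    proof -
      have "0 < n" using that S'(1) by (cases n) auto
      thus ?thesis by (rule rot_lt)
    qed
    hence "S \<subseteq> {..<n}" using S'(3) by auto
    moreover have "(\<Union>s\<in>S. arc n t s) = rot n c ` W" unfolding S'(3) arcs S'(2) ..
    ultimately show "S \<in> strand n t (rot n c ` W)" by (simp add: strand_def)
  qed
  moreover have "concentrated K ((`) (rot n c) ` strand n t W) k b"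
  proof (rule concentrated_relabel[OF conc])
    show "inj_on (rot n c) (\<Union>(strand n t W))" by (rule inj_on_subset[OF inj]) (auto simp: strand_def)
  qed
  ultimately show ?thesis by simp
qed

section \<open>Counting words\<close>

lemma finite_tilings: "finite (tilings t N a b)"
proof (rule finite_subset)
  show "tilings t N a b \<subseteq> Pow {1..<N}" by (intro subsetI PowI tilings_subset)
qed simp

text \<open>
  The three kinds of first letter are told apart by whether \<open>N\<close> and \<open>N - t\<close> are in the set.
\<close>

lemma card_tilings_Suc:
  assumes t: "0 < t"
  shows "card (tilings t (Suc N) a b) = card (tilings t N a b)
     + (if t \<le> N \<and> a \<noteq> 0 then card (tilings t (N - t) (a - 1) b) else 0)
     + (if t < N \<and> a \<noteq> 0 \<and> b \<noteq> 0 then card (tilings t (N - t) (a - 1) (b - 1)) else 0)"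
proof -
  let ?A = "tilings t N a b"
  let ?h = "\<lambda>W. W \<union> {Suc N - t..N}" and ?g = "\<lambda>W. W \<union> {N - t..N}"
  let ?B = "if t \<le> N \<and> a \<noteq> 0 then ?h ` tilings t (N - t) (a - 1) b else {}"
  let ?C = "if t < N \<and> a \<noteq> 0 \<and> b \<noteq> 0 then ?g ` tilings t (N - t) (a - 1) (b - 1) else {}"
  have lt: "v < N - t" if "W \<in> tilings t (N - t) a' b'" "v \<in> W" for W a' b' v
    using tilings_subset[OF that(1)] that(2) by auto
  have restr: "{v\<in>?h W. v < N - t} = W" "{v\<in>?g W. v < N - t} = W" if "W \<in> tilings t (N - t) a' b'" for W a' b'
    using lt[OF that] by auto
  have inj: "inj_on ?h (tilings t (N - t) a' b')" "inj_on ?g (tilings t (N - t) a' b')" for a' b'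
    by (rule inj_on_inverseI[where g = "\<lambda>W. {v\<in>W. v < N - t}"], rule restr, assumption)+
  have "N \<notin> W" if "W \<in> ?A" for W using tilings_subset[OF that] by auto
  moreover have "N \<in> W" if "W \<in> ?B \<union> ?C" for W using that t by (auto split: if_splits)
  ultimately have AB: "?A \<inter> (?B \<union> ?C) = {}" by blast
  have "N - t \<notin> W" if "W \<in> ?B" for W
    using that lt t by (auto split: if_splits)
  moreover have "N - t \<in> W" if "W \<in> ?C" for W using that by (auto split: if_splits)
  ultimately have BC: "?B \<inter> ?C = {}" by blast
  have fin: "finite ?B" "finite ?C" by (simp_all add: finite_tilings)
  have "card (tilings t (Suc N) a b) = card (?A \<union> (?B \<union> ?C))" by (simp only: tilings.simps Un_assoc)
  also have "\<dots> = card ?A + card (?B \<union> ?C)" by (rule card_Un_disjoint[OF finite_tilings _ AB]) (use fin in simp)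
  also have "card (?B \<union> ?C) = card ?B + card ?C" by (rule card_Un_disjoint[OF fin BC])
  also have "card ?B = (if t \<le> N \<and> a \<noteq> 0 then card (tilings t (N - t) (a - 1) b) else 0)"
    by (simp add: card_image inj)
  also have "card ?C = (if t < N \<and> a \<noteq> 0 \<and> b \<noteq> 0 then card (tilings t (N - t) (a - 1) (b - 1)) else 0)"
    by (simp add: card_image inj)
  finally show ?thesis by simp
qed

declare tilings.simps [simp del]

text \<open>
  Pascal's rule for the three binomials that change in the recursion for words.
\<close>

lemma binomial_product_step:
  "(Suc m choose Suc a) * (Suc a choose b) + (Suc m choose a) * (a choose b) =
     (m choose Suc a) * (Suc a choose b) + (m choose a) * (a choose b)
     + ((m choose a) * (a choose b) + (if a = 0 then 0 else (m choose (a - 1)) * ((a - 1) choose b)))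
     + (if b = 0 then 0 else (m choose a) * (a choose (b - 1))
        + (if a = 0 then 0 else (m choose (a - 1)) * ((a - 1) choose (b - 1))))"
proof -
  have 1: "(Suc m choose Suc a) = (m choose Suc a) + (m choose a)" by simp
  have 2: "(Suc a choose b) = (a choose b) + (if b = 0 then 0 else a choose (b - 1))" by (cases b) auto
  have 3: "(Suc m choose a) * (a choose b) = (m choose a) * (a choose b) + (if a = 0 then 0 else (m choose (a - 1)) * (a choose b))"
    by (cases a) (auto simp: distrib_right)
  have 4: "(a choose b) = ((a - 1) choose b) + (if b = 0 then 0 else (a - 1) choose (b - 1))" if "a \<noteq> 0"
    using that by (cases a; cases b) auto
  show ?thesis
  proof (cases "a = 0")
    case True
    thus ?thesis unfolding 1 2 3 by (simp add: distrib_left distrib_right)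
  next
    case False
    have 5: "(m choose (a - 1)) * (a choose b) = (m choose (a - 1)) * ((a - 1) choose b)
        + (if b = 0 then 0 else (m choose (a - 1)) * ((a - 1) choose (b - 1)))"
      by (subst 4[OF False]) (simp add: distrib_left)
    show ?thesis unfolding 1 3 using False 5 by (cases "b = 0") (simp_all add: 2 distrib_left distrib_right)
  qed
qed

text \<open>
  A word has \<open>L = N - t a\<close> letters, of which \<open>a\<close> are long and \<open>b\<close> of these are full.  The last
  letter, at vertex \<open>0\<close>, is a single missing vertex or a long letter with a gap; for each of these the
  kinds of the other \<open>L - 1\<close> letters are chosen freely.
\<close>

lemma card_tilings:
  assumes t: "2 \<le> t" and N: "1 \<le> N"
  shows "card (tilings t N a b) = (if t * a + 1 \<le> N
     then ((N - t * a - 1) choose a) * (a choose b)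
       + (if a = 0 then 0 else ((N - t * a - 1) choose (a - 1)) * ((a - 1) choose b)) else 0)"
  using N
proof (induction N arbitrary: a b rule: less_induct)
  case (less N)
  then obtain M where M: "N = Suc M" by (cases N) auto
  show ?case
  proof (cases "M = 0")
    case True
    have "t * a + 1 \<le> 1 \<longleftrightarrow> a = 0" using t by auto
    thus ?thesis using True M t by (auto simp: tilings.simps)
  next
    case False
    hence IH1: "card (tilings t M a b) = (if t * a + 1 \<le> M
      then ((M - t * a - 1) choose a) * (a choose b)
       + (if a = 0 then 0 else ((M - t * a - 1) choose (a - 1)) * ((a - 1) choose b)) else 0)"
      using less.IH[of M a b] M by simp
    have rec: "card (tilings t N a b) = card (tilings t M a b)
      + (if t \<le> M \<and> a \<noteq> 0 then card (tilings t (M - t) (a - 1) b) else 0)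
      + (if t < M \<and> a \<noteq> 0 \<and> b \<noteq> 0 then card (tilings t (M - t) (a - 1) (b - 1)) else 0)"
      unfolding M by (rule card_tilings_Suc) (use t in simp)
    show ?thesis
    proof (cases a)
      case 0
      thus ?thesis using rec IH1 M t False by simp
    next
      case (Suc a')
      have ta: "t * a = t * a' + t" using Suc by simp
      consider "M < t" | "M = t" | "t < M" by linarith
      thus ?thesis
      proof cases
        case 1 thus ?thesis using rec IH1 M t ta Suc by simp
      next
        case 2
        have "card (tilings t 0 a' b) = (if a' = 0 \<and> b = 0 then 1 else 0)" by (simp add: tilings.simps)
        moreover have "t * a + 1 \<le> Suc t \<longleftrightarrow> a' = 0" using ta t by simp
        ultimately show ?thesis using rec IH1 M 2 t Suc by (cases b) auto
      next
        case 3
        have IH2: "card (tilings t (M - t) a' b'') = (if t * a' + 1 \<le> M - t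
            then ((M - t - t * a' - 1) choose a') * (a' choose b'')
            + (if a' = 0 then 0 else ((M - t - t * a' - 1) choose (a' - 1)) * ((a' - 1) choose b'')) else 0)" for b''
          using less.IH[of "M - t" a' b''] 3 M t by simp
        have cond: "t * a' + 1 \<le> M - t \<longleftrightarrow> t * a + 1 \<le> M" using ta 3 by linarith
        have eq: "M - t - t * a' - 1 = M - t * a - 1" using ta by simp
        show ?thesis
        proof (cases "t * a + 1 \<le> M")
          case False
          have "t * a + 1 \<le> N \<Longrightarrow> N - t * a - 1 = 0" using False M by simp
          moreover have "t * a + 1 \<le> N \<Longrightarrow> a' \<noteq> 0" using False M ta 3 by (intro notI) simp
          ultimately show ?thesis using rec IH1 IH2 cond False M t Suc by auto
        next
          case True
          define m where "m = M - t * a - 1"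
          have N1: "N - t * a - 1 = Suc m" using True M by (simp add: m_def)
          have r: "card (tilings t N a b) = (m choose Suc a') * (Suc a' choose b) + (m choose a') * (a' choose b)
              + ((m choose a') * (a' choose b) + (if a' = 0 then 0 else (m choose (a' - 1)) * ((a' - 1) choose b)))
              + (if b = 0 then 0 else (m choose a') * (a' choose (b - 1)) + (if a' = 0 then 0 else (m choose (a' - 1)) * ((a' - 1) choose (b - 1))))"
          proof -
            have r1: "card (tilings t M a b) = (m choose Suc a') * (Suc a' choose b) + (m choose a') * (a' choose b)"
              using IH1 True Suc by (simp add: m_def)
            have r2: "card (tilings t (M - t) a' b'') = (m choose a') * (a' choose b'')
                + (if a' = 0 then 0 else (m choose (a' - 1)) * ((a' - 1) choose b''))" for b''
              unfolding IH2 using True cond eq by (simp add: m_def)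
            have "card (tilings t N a b) = card (tilings t M a b) + card (tilings t (M - t) a' b)
                + (if b = 0 then 0 else card (tilings t (M - t) a' (b - 1)))"
              unfolding rec using 3 Suc by simp
            thus ?thesis unfolding r1 r2 by simp
          qed
          have c: "card (tilings t N a b) = (Suc m choose Suc a') * (Suc a' choose b) + (Suc m choose a') * (a' choose b)"
            unfolding r binomial_product_step ..
          have le: "t * a + 1 \<le> N" using True M by simp
          show ?thesis unfolding c N1 using le Suc by simp
        qed
      qed
    qed
  qed
qed

section \<open>Squarefree multigraded resolutions as complexes over the field\<close>

text \<open>
  A free resolution whose basis cells sit in squarefree degrees \<open>m \<sigma>\<close> is determined by its matrix
  of coefficients \<open>a\<close>.  Here \<open>good U\<close> says that the product of the variables in \<open>U\<close> lies in the
  ideal; for such \<open>U\<close> the cells of degree inside \<open>U\<close> must form an exact complex over the field, while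
  for any other \<open>U\<close> only \<open>base\<close>, the generator of \<open>R\<close> itself, has degree inside \<open>U\<close>.
\<close>

definition multigraded_resolution ::
  "('c \<Rightarrow> nat) \<Rightarrow> ('c \<Rightarrow> 'v set) \<Rightarrow> ('v set \<Rightarrow> bool) \<Rightarrow> 'c \<Rightarrow> 'c set \<Rightarrow> ('c \<Rightarrow> 'c \<Rightarrow> 'k::field) \<Rightarrow> bool" where
  "multigraded_resolution dm m good base C a \<longleftrightarrow> complex_on dm a C \<and>
     (\<forall>\<sigma>\<in>C. \<forall>\<tau>\<in>C. a \<sigma> \<tau> \<noteq> 0 \<longrightarrow> m \<tau> \<subseteq> m \<sigma>) \<and>
     (\<forall>U k. good U \<longrightarrow> exact_at dm a {\<sigma>\<in>C. m \<sigma> \<subseteq> U} k) \<and>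
     base \<in> C \<and> dm base = 0 \<and> m base = {} \<and> (\<forall>\<sigma>\<in>C. \<sigma> \<noteq> base \<longrightarrow> dm \<sigma> \<noteq> 0 \<and> good (m \<sigma>))"

lemma exact_at_cong:
  assumes "\<And>\<sigma> \<tau>. \<sigma> \<in> X \<Longrightarrow> \<tau> \<in> X \<Longrightarrow> a \<sigma> \<tau> = b \<sigma> \<tau>"
  shows "exact_at dm a X k \<longleftrightarrow> exact_at dm b X k"
proof -
  have "(\<Sum>\<sigma>\<in>X. x \<sigma> * a \<sigma> \<tau>) = (\<Sum>\<sigma>\<in>X. x \<sigma> * b \<sigma> \<tau>)" if "\<tau> \<in> X" for x \<tau>
    by (rule sum.cong) (use assms that in auto)
  thus ?thesis unfolding exact_at_def by simp
qed

lemma complex_on_convex: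
  assumes cx: "complex_on dm a X" and Y: "Y \<subseteq> X"
    and conv: "\<And>\<sigma> \<tau> \<rho>. \<sigma> \<in> Y \<Longrightarrow> \<rho> \<in> Y \<Longrightarrow> \<tau> \<in> X \<Longrightarrow> a \<sigma> \<tau> \<noteq> 0 \<Longrightarrow> a \<tau> \<rho> \<noteq> 0 \<Longrightarrow> \<tau> \<in> Y"
  shows "complex_on dm a Y"
proof -
  have fin: "finite X" by (rule complex_on_finite[OF cx])
  have "(\<Sum>\<tau>\<in>Y. a \<sigma> \<tau> * a \<tau> \<rho>) = 0" if "\<sigma> \<in> Y" "\<rho> \<in> Y" for \<sigma> \<rho>
  proof -
    have "(\<Sum>\<tau>\<in>Y. a \<sigma> \<tau> * a \<tau> \<rho>) = (\<Sum>\<tau>\<in>X. a \<sigma> \<tau> * a \<tau> \<rho>)"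
      by (rule sum.mono_neutral_left[OF fin Y]) (use conv[OF that] in auto)
    also have "\<dots> = 0" by (rule complex_on_square[OF cx]) (use that Y in auto)
    finally show ?thesis .
  qed
  moreover have "dm \<sigma> = Suc (dm \<tau>)" if "\<sigma> \<in> Y" "\<tau> \<in> Y" "a \<sigma> \<tau> \<noteq> 0" for \<sigma> \<tau>
    by (rule complex_on_dim[OF cx]) (use that Y in auto)
  ultimately show ?thesis unfolding complex_on_def using finite_subset[OF Y fin] by blast
qed

text \<open>
  Cancelling two cells of the same degree acts on each convex range \<open>P\<close> of degrees separately;
  this is used for the degrees inside a set and for a single degree.
\<close>

lemma exact_at_cancel_degrees:
  assumes cx: "complex_on dm a C" and deg: "\<And>\<sigma> \<tau>. \<sigma> \<in> C \<Longrightarrow> \<tau> \<in> C \<Longrightarrow> a \<sigma> \<tau> \<noteq> 0 \<Longrightarrow> m \<tau> \<subseteq> m \<sigma>"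
    and in_C: "\<sigma>0 \<in> C" "\<tau>0 \<in> C" and nz: "a \<sigma>0 \<tau>0 \<noteq> 0" and eq: "m \<sigma>0 = m \<tau>0"
    and P: "\<And>x y z. P x \<Longrightarrow> P z \<Longrightarrow> x \<subseteq> y \<Longrightarrow> y \<subseteq> z \<Longrightarrow> P y"
    and ex: "exact_at dm a {\<sigma>\<in>C. P (m \<sigma>)} k"
  shows "exact_at dm (cancel a \<sigma>0 \<tau>0) {\<sigma>\<in>C - {\<sigma>0, \<tau>0}. P (m \<sigma>)} k"
proof (cases "P (m \<sigma>0)")
  case True
  have "complex_on dm a {\<sigma>\<in>C. P (m \<sigma>)}"
  proof (rule complex_on_convex[OF cx])
    fix \<sigma> \<tau> \<rho>
    assume h: "\<sigma> \<in> {\<sigma>\<in>C. P (m \<sigma>)}" "\<rho> \<in> {\<sigma>\<in>C. P (m \<sigma>)}" "\<tau> \<in> C" "a \<sigma> \<tau> \<noteq> 0" "a \<tau> \<rho> \<noteq> 0"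
    hence "m \<tau> \<subseteq> m \<sigma>" "m \<rho> \<subseteq> m \<tau>" using deg by auto
    thus "\<tau> \<in> {\<sigma>\<in>C. P (m \<sigma>)}" using h P[of "m \<rho>" "m \<sigma>" "m \<tau>"] by auto
  qed auto
  hence "exact_at dm (cancel a \<sigma>0 \<tau>0) ({\<sigma>\<in>C. P (m \<sigma>)} - {\<sigma>0, \<tau>0}) k"
    by (rule exact_at_cancel) (use in_C nz True eq ex in auto)
  moreover have "{\<sigma>\<in>C. P (m \<sigma>)} - {\<sigma>0, \<tau>0} = {\<sigma>\<in>C - {\<sigma>0, \<tau>0}. P (m \<sigma>)}" by auto
  ultimately show ?thesis by simp
next
  case False
  hence X: "{\<sigma>\<in>C - {\<sigma>0, \<tau>0}. P (m \<sigma>)} = {\<sigma>\<in>C. P (m \<sigma>)}" using eq by auto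
  \<comment> \<open>A correction term would put the common degree of the two cells between two degrees in \<open>P\<close>.\<close>
  have "cancel a \<sigma>0 \<tau>0 \<sigma> \<tau> = a \<sigma> \<tau>" if "\<sigma> \<in> {\<sigma>\<in>C. P (m \<sigma>)}" "\<tau> \<in> {\<sigma>\<in>C. P (m \<sigma>)}" for \<sigma> \<tau>
  proof (rule ccontr)
    assume "cancel a \<sigma>0 \<tau>0 \<sigma> \<tau> \<noteq> a \<sigma> \<tau>"
    hence "a \<sigma> \<tau>0 \<noteq> 0" "a \<sigma>0 \<tau> \<noteq> 0" by (auto simp: cancel_def)
    hence "m \<tau>0 \<subseteq> m \<sigma>" "m \<tau> \<subseteq> m \<sigma>0" using deg in_C that by auto
    thus False using P[of "m \<tau>" "m \<sigma>" "m \<sigma>0"] that False eq by auto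
  qed
  thus ?thesis unfolding X using ex exact_at_cong[of "{\<sigma>\<in>C. P (m \<sigma>)}" "cancel a \<sigma>0 \<tau>0" a dm k] by simp
qed

text \<open>
  The cell \<open>base\<close> survives because it is the only one of degree \<open>{}\<close>.
\<close>

lemma multigraded_resolution_cancel:
  assumes res: "multigraded_resolution dm m good base C a" and bad: "\<not> good {}"
    and in_C: "\<sigma>0 \<in> C" "\<tau>0 \<in> C" and nz: "a \<sigma>0 \<tau>0 \<noteq> 0" and eq: "m \<sigma>0 = m \<tau>0"
  shows "multigraded_resolution dm m good base (C - {\<sigma>0, \<tau>0}) (cancel a \<sigma>0 \<tau>0)"
    and "exact_at dm a {\<sigma>\<in>C. m \<sigma> = W} k \<Longrightarrow>
      exact_at dm (cancel a \<sigma>0 \<tau>0) {\<sigma>\<in>C - {\<sigma>0, \<tau>0}. m \<sigma> = W} k"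
    and "(\<Sum>\<sigma> | \<sigma> \<in> C - {\<sigma>0, \<tau>0} \<and> m \<sigma> = W. (-1) ^ dm \<sigma>) = (\<Sum>\<sigma> | \<sigma> \<in> C \<and> m \<sigma> = W. (-1) ^ dm \<sigma> :: int)"
proof -
  have cx: "complex_on dm a C" and deg: "\<And>\<sigma> \<tau>. \<sigma> \<in> C \<Longrightarrow> \<tau> \<in> C \<Longrightarrow> a \<sigma> \<tau> \<noteq> 0 \<Longrightarrow> m \<tau> \<subseteq> m \<sigma>"
    and ex: "\<And>U k. good U \<Longrightarrow> exact_at dm a {\<sigma>\<in>C. m \<sigma> \<subseteq> U} k"
    and orig: "base \<in> C" "dm base = 0" "m base = {}" "\<And>\<sigma>. \<sigma> \<in> C \<Longrightarrow> \<sigma> \<noteq> base \<Longrightarrow> dm \<sigma> \<noteq> 0 \<and> good (m \<sigma>)"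
    using res unfolding multigraded_resolution_def by blast+
  have d0: "dm \<sigma>0 = Suc (dm \<tau>0)" by (rule complex_on_dim[OF cx in_C nz])
  have s0: "\<sigma>0 \<noteq> base" using d0 orig by auto
  have t0: "\<tau>0 \<noteq> base" using orig(3) orig(4)[OF in_C(1) s0] eq bad by auto
  have deg': "m \<tau> \<subseteq> m \<sigma>" if "\<sigma> \<in> C" "\<tau> \<in> C" "cancel a \<sigma>0 \<tau>0 \<sigma> \<tau> \<noteq> 0" for \<sigma> \<tau>
  proof (cases "a \<sigma> \<tau> = 0")
    case True
    hence "a \<sigma> \<tau>0 \<noteq> 0" "a \<sigma>0 \<tau> \<noteq> 0" using that by (auto simp: cancel_def)
    hence "m \<tau>0 \<subseteq> m \<sigma>" "m \<tau> \<subseteq> m \<sigma>0" using deg in_C that by auto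
    thus ?thesis using eq by simp
  qed (use deg that in auto)
  have ex': "exact_at dm (cancel a \<sigma>0 \<tau>0) {\<sigma>\<in>C - {\<sigma>0, \<tau>0}. m \<sigma> \<subseteq> U} k" if "good U" for U k
    by (rule exact_at_cancel_degrees[where P = "\<lambda>x. x \<subseteq> U", OF cx deg in_C nz eq _ ex[OF that]]) auto
  show "multigraded_resolution dm m good base (C - {\<sigma>0, \<tau>0}) (cancel a \<sigma>0 \<tau>0)"
    unfolding multigraded_resolution_def
  proof (intro conjI ballI allI impI)
    fix \<sigma> assume "\<sigma> \<in> C - {\<sigma>0, \<tau>0}" "\<sigma> \<noteq> base"
    thus "dm \<sigma> \<noteq> 0" "good (m \<sigma>)" using orig(4)[of \<sigma>] by auto
  qed (use complex_on_cancel[OF cx in_C nz] deg' ex' orig s0 t0 in auto)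
  show "exact_at dm (cancel a \<sigma>0 \<tau>0) {\<sigma>\<in>C - {\<sigma>0, \<tau>0}. m \<sigma> = W} k"
    if "exact_at dm a {\<sigma>\<in>C. m \<sigma> = W} k"
    by (rule exact_at_cancel_degrees[where P = "\<lambda>x. x = W", OF cx deg in_C nz eq _ that]) auto
  show "(\<Sum>\<sigma> | \<sigma> \<in> C - {\<sigma>0, \<tau>0} \<and> m \<sigma> = W. (-1) ^ dm \<sigma>) = (\<Sum>\<sigma> | \<sigma> \<in> C \<and> m \<sigma> = W. (-1) ^ dm \<sigma> :: int)"
  proof (cases "m \<sigma>0 = W")
    case True
    let ?X = "{\<sigma>. \<sigma> \<in> C - {\<sigma>0, \<tau>0} \<and> m \<sigma> = W}"
    have ne: "\<sigma>0 \<noteq> \<tau>0" using d0 by auto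
    have fin: "finite ?X" using complex_on_finite[OF cx] by simp
    have "{\<sigma>. \<sigma> \<in> C \<and> m \<sigma> = W} = insert \<sigma>0 (insert \<tau>0 ?X)" using in_C True eq by auto
    thus ?thesis using fin ne d0 by simp
  next
    case False
    hence "{\<sigma>. \<sigma> \<in> C - {\<sigma>0, \<tau>0} \<and> m \<sigma> = W} = {\<sigma>. \<sigma> \<in> C \<and> m \<sigma> = W}" using eq by auto
    thus ?thesis by simp
  qed
qed

text \<open>
  Cancel until no two cells of the same degree are incident.
\<close>

lemma minimal_multigraded_resolution:
  fixes a :: "'c \<Rightarrow> 'c \<Rightarrow> 'k::field"
  assumes "multigraded_resolution dm m good base C a" and bad: "\<not> good {}"
  shows "\<exists>C' (a' :: 'c \<Rightarrow> 'c \<Rightarrow> 'k). C' \<subseteq> C \<and> multigraded_resolution dm m good base C' a' \<and>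
    (\<forall>\<sigma>\<in>C'. \<forall>\<tau>\<in>C'. a' \<sigma> \<tau> \<noteq> 0 \<longrightarrow> m \<sigma> \<noteq> m \<tau>) \<and>
    (\<forall>W k. exact_at dm a {\<sigma>\<in>C. m \<sigma> = W} k \<longrightarrow> exact_at dm a' {\<sigma>\<in>C'. m \<sigma> = W} k) \<and>
    (\<forall>W. (\<Sum>\<sigma> | \<sigma> \<in> C' \<and> m \<sigma> = W. (-1) ^ dm \<sigma>) = (\<Sum>\<sigma> | \<sigma> \<in> C \<and> m \<sigma> = W. (-1) ^ dm \<sigma> :: int))"
  using assms(1)
proof (induction "card C" arbitrary: C a rule: less_induct)
  case less
  show ?case
  proof (cases "\<forall>\<sigma>\<in>C. \<forall>\<tau>\<in>C. a \<sigma> \<tau> \<noteq> 0 \<longrightarrow> m \<sigma> \<noteq> m \<tau>")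
    case True
    show ?thesis
      by (rule exI[of _ C], rule exI[of _ a], intro conjI allI impI) (use True less.prems in auto)
  next
    case False
    then obtain \<sigma>0 \<tau>0 where st: "\<sigma>0 \<in> C" "\<tau>0 \<in> C" "a \<sigma>0 \<tau>0 \<noteq> 0" "m \<sigma>0 = m \<tau>0" by blast
    let ?C = "C - {\<sigma>0, \<tau>0}" and ?a = "cancel a \<sigma>0 \<tau>0"
    note c = multigraded_resolution_cancel[OF less.prems bad st]
    have "finite C" using less.prems by (auto simp: multigraded_resolution_def complex_on_def)
    hence "card ?C < card C" by (rule psubset_card_mono) (use st in auto)
    from less.hyps[OF this c(1)] obtain C' and a' :: "'c \<Rightarrow> 'c \<Rightarrow> 'k" where h: "C' \<subseteq> ?C" "multigraded_resolution dm m good base C' a'"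
      "\<forall>\<sigma>\<in>C'. \<forall>\<tau>\<in>C'. a' \<sigma> \<tau> \<noteq> 0 \<longrightarrow> m \<sigma> \<noteq> m \<tau>"
      "\<forall>W k. exact_at dm ?a {\<sigma>\<in>?C. m \<sigma> = W} k \<longrightarrow> exact_at dm a' {\<sigma>\<in>C'. m \<sigma> = W} k"
      "\<forall>W. (\<Sum>\<sigma> | \<sigma> \<in> C' \<and> m \<sigma> = W. (-1) ^ dm \<sigma>) = (\<Sum>\<sigma> | \<sigma> \<in> ?C \<and> m \<sigma> = W. (-1) ^ dm \<sigma> :: int)"
      by (elim exE conjE) (rule that)
    show ?thesis
    proof (rule exI[of _ C'], rule exI[of _ a'], intro conjI allI)
      show "C' \<subseteq> C" using h(1) by blast
      show "exact_at dm a {\<sigma>\<in>C. m \<sigma> = W} k \<longrightarrow> exact_at dm a' {\<sigma>\<in>C'. m \<sigma> = W} k" for W k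
        using h(4) c(2)[of W k] by blast
      show "(\<Sum>\<sigma> | \<sigma> \<in> C' \<and> m \<sigma> = W. (-1) ^ dm \<sigma>) = (\<Sum>\<sigma> | \<sigma> \<in> C \<and> m \<sigma> = W. (-1) ^ dm \<sigma> :: int)" for W
        using h(5) c(3)[of W] by simp
      show "multigraded_resolution dm m good base C' a'" by (rule h(2))
      show "\<forall>\<sigma>\<in>C'. \<forall>\<tau>\<in>C'. a' \<sigma> \<tau> \<noteq> 0 \<longrightarrow> m \<sigma> \<noteq> m \<tau>" by (rule h(3))
    qed
  qed
qed

text \<open>In a complex with zero differential the homology is the complex.\<close>

lemma card_cells_zero_differential:
  assumes fin: "finite X" and a: "\<And>\<sigma> \<tau>. \<sigma> \<in> X \<Longrightarrow> \<tau> \<in> X \<Longrightarrow> a \<sigma> \<tau> = (0::'k::field)"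
    and ex: "\<And>l. l \<noteq> k \<Longrightarrow> exact_at dm a X l"
    and euler: "(\<Sum>\<sigma>\<in>X. (-1) ^ dm \<sigma>) = (-1) ^ k * int b"
  shows "card {\<sigma>\<in>X. dm \<sigma> = l} = (if l = k then b else 0)"
proof -
  have dim: "dm \<sigma> = k" if \<sigma>: "\<sigma> \<in> X" for \<sigma>
  proof (rule ccontr)
    assume ne: "dm \<sigma> \<noteq> k"
    \<comment> \<open>The single cell \<open>\<sigma>\<close> is a cycle, but nothing is a boundary.\<close>
    have "\<exists>y. chain_in dm X (Suc (dm \<sigma>)) y \<and> (\<forall>\<tau>\<in>X. (\<Sum>\<rho>\<in>X. y \<rho> * a \<rho> \<tau>) = (if \<tau> = \<sigma> then 1 else 0))"
      by (rule exact_atD[OF ex[OF ne]]) (use \<sigma> a in \<open>auto simp: chain_in_def\<close>)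
    then obtain y where "\<forall>\<tau>\<in>X. (\<Sum>\<rho>\<in>X. y \<rho> * a \<rho> \<tau>) = (if \<tau> = \<sigma> then 1 else 0)" by blast
    thus False using \<sigma> a by force
  qed
  have "(\<Sum>\<sigma>\<in>X. (-1) ^ dm \<sigma>) = (\<Sum>\<sigma>\<in>X. (-1) ^ k :: int)" by (rule sum.cong) (auto simp: dim)
  hence "(-1) ^ k * int (card X) = (-1) ^ k * int b" using euler by (simp add: mult.commute)
  hence "card X = b" by simp
  moreover have "{\<sigma>\<in>X. dm \<sigma> = l} = (if l = k then X else {})" using dim by auto
  ultimately show ?thesis by simp
qed

section \<open>The Taylor complex of the arcs\<close>

text \<open>
  The support of the least common multiple of the generators in \<open>S\<close>; the shift by \<open>Suc\<close> passes from the
  vertices \<open>0, \<dots>, n - 1\<close> to the variables \<open>1, \<dots>, n\<close>.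
\<close>

definition lcm_degree :: "nat \<Rightarrow> nat \<Rightarrow> nat set \<Rightarrow> nat set" where
  "lcm_degree n t S = Suc ` (\<Union>s\<in>S. arc n t s)"

definition contains_arc :: "nat \<Rightarrow> nat \<Rightarrow> nat set \<Rightarrow> bool" where
  "contains_arc n t U \<longleftrightarrow> (\<exists>s<n. Suc ` arc n t s \<subseteq> U)"

text \<open>
  If \<open>U\<close> contains arc \<open>s\<close>, adding \<open>s\<close> to a set of arcs inside \<open>U\<close> does not leave \<open>U\<close>, so the
  cells inside \<open>U\<close> form a cone with apex \<open>s\<close>.
\<close>

lemma taylor_resolution:
  "multigraded_resolution card (lcm_degree n t) (contains_arc n t) {} (Pow {..<n}) (bd :: nat set \<Rightarrow> nat set \<Rightarrow> 'k::field)"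
proof -
  have "convex_family (Pow {..<n})" unfolding convex_family_def using finite_subset by auto
  hence cx: "complex_on card (bd :: nat set \<Rightarrow> nat set \<Rightarrow> 'k) (Pow {..<n})" by (rule complex_on_bd)
  have deg: "lcm_degree n t \<tau> \<subseteq> lcm_degree n t \<sigma>" if "bd \<sigma> \<tau> \<noteq> (0::'k)" for \<sigma> \<tau>
    using that by (auto elim!: bd_nonzeroE simp: lcm_degree_def)
  have ex: "exact_at card (bd :: nat set \<Rightarrow> nat set \<Rightarrow> 'k) {\<sigma>\<in>Pow {..<n}. lcm_degree n t \<sigma> \<subseteq> U} k"
    if U: "contains_arc n t U" for U k
  proof -
    obtain s where s: "s < n" "Suc ` arc n t s \<subseteq> U" using U by (auto simp: contains_arc_def)
    show ?thesis
    proof (rule exact_at_cone[where v = s])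
      fix \<sigma> assume \<sigma>: "\<sigma> \<in> {\<sigma>\<in>Pow {..<n}. lcm_degree n t \<sigma> \<subseteq> U}"
      have "lcm_degree n t (insert s \<sigma>) = Suc ` arc n t s \<union> lcm_degree n t \<sigma>"
        "lcm_degree n t (\<sigma> - {s}) \<subseteq> lcm_degree n t \<sigma>"
        by (auto simp: lcm_degree_def)
      thus "insert s \<sigma> \<in> {\<sigma>\<in>Pow {..<n}. lcm_degree n t \<sigma> \<subseteq> U} \<and> \<sigma> - {s} \<in> {\<sigma>\<in>Pow {..<n}. lcm_degree n t \<sigma> \<subseteq> U}"
        using \<sigma> \<open>s < n\<close> \<open>Suc ` arc n t s \<subseteq> U\<close> by auto
      show "finite \<sigma>" by (rule finite_subset[of _ "{..<n}"]) (use \<sigma> in auto)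
    qed simp
  qed
  have "card \<sigma> \<noteq> 0 \<and> contains_arc n t (lcm_degree n t \<sigma>)" if sig: "\<sigma> \<in> Pow {..<n}" "\<sigma> \<noteq> {}" for \<sigma>
  proof -
    have "finite \<sigma>" by (rule finite_subset[of _ "{..<n}"]) (use sig in auto)
    moreover obtain s where "s \<in> \<sigma>" "s < n" using sig by blast
    hence "contains_arc n t (lcm_degree n t \<sigma>)" unfolding contains_arc_def lcm_degree_def by blast
    ultimately show ?thesis using sig by simp
  qed
  thus ?thesis unfolding multigraded_resolution_def
    using cx deg ex by (auto simp: lcm_degree_def)
qed

text \<open>
  On cells of equal degree the minimal differential is zero, so a strand with concentrated homology has
  exactly its homology as cells.
\<close>

lemma minimal_arc_resolution:
  assumes t: "0 < t"
  shows "\<exists>C (a :: nat set \<Rightarrow> nat set \<Rightarrow> 'k::field). C \<subseteq> Pow {..<n} \<and>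
    multigraded_resolution card (lcm_degree n t) (contains_arc n t) {} C a \<and>
    (\<forall>\<sigma>\<in>C. \<forall>\<tau>\<in>C. a \<sigma> \<tau> \<noteq> 0 \<longrightarrow> lcm_degree n t \<sigma> \<noteq> lcm_degree n t \<tau>) \<and>
    (\<forall>W k b l. concentrated TYPE('k) (strand n t W) k b \<longrightarrow>
       card {\<sigma>\<in>C. lcm_degree n t \<sigma> = Suc ` W \<and> card \<sigma> = l} = (if l = k then b else 0))"
proof -
  let ?m = "lcm_degree n t"
  have bad: "\<not> contains_arc n t {}" using t by (auto simp: contains_arc_def arc_def)
  obtain C and a :: "nat set \<Rightarrow> nat set \<Rightarrow> 'k" where
    "C \<subseteq> Pow {..<n} \<and> multigraded_resolution card ?m (contains_arc n t) {} C a \<and>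
    (\<forall>\<sigma>\<in>C. \<forall>\<tau>\<in>C. a \<sigma> \<tau> \<noteq> 0 \<longrightarrow> ?m \<sigma> \<noteq> ?m \<tau>) \<and>
    (\<forall>W k. exact_at card (bd :: nat set \<Rightarrow> nat set \<Rightarrow> 'k) {\<sigma>\<in>Pow {..<n}. ?m \<sigma> = W} k \<longrightarrow>
       exact_at card a {\<sigma>\<in>C. ?m \<sigma> = W} k) \<and>
    (\<forall>W. (\<Sum>\<sigma> | \<sigma> \<in> C \<and> ?m \<sigma> = W. (-1) ^ card \<sigma>) = (\<Sum>\<sigma> | \<sigma> \<in> Pow {..<n} \<and> ?m \<sigma> = W. (-1) ^ card \<sigma> :: int))"
    using minimal_multigraded_resolution[OF taylor_resolution[of n t, where ?'k = 'k] bad] by (elim exE) (rule that)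
  hence h: "C \<subseteq> Pow {..<n}" "multigraded_resolution card ?m (contains_arc n t) {} C a"
    "\<And>\<sigma> \<tau>. \<sigma> \<in> C \<Longrightarrow> \<tau> \<in> C \<Longrightarrow> a \<sigma> \<tau> \<noteq> 0 \<Longrightarrow> ?m \<sigma> \<noteq> ?m \<tau>"
    "\<And>W k. exact_at card (bd :: nat set \<Rightarrow> nat set \<Rightarrow> 'k) {\<sigma>\<in>Pow {..<n}. ?m \<sigma> = W} k \<Longrightarrow> exact_at card a {\<sigma>\<in>C. ?m \<sigma> = W} k"
    "\<And>W. (\<Sum>\<sigma> | \<sigma> \<in> C \<and> ?m \<sigma> = W. (-1) ^ card \<sigma>) = (\<Sum>\<sigma> | \<sigma> \<in> Pow {..<n} \<and> ?m \<sigma> = W. (-1) ^ card \<sigma> :: int)"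
    by (elim conjE, blast)+
  have str: "{\<sigma>\<in>Pow {..<n}. ?m \<sigma> = Suc ` W} = strand n t W" for W
    unfolding strand_def lcm_degree_def by (auto simp: inj_image_eq_iff)
  have "card {\<sigma>\<in>C. ?m \<sigma> = Suc ` W \<and> card \<sigma> = l} = (if l = k then b else 0)"
    if conc: "concentrated TYPE('k) (strand n t W) k b" for W k b l
  proof -
    have "card {\<sigma>\<in>{\<sigma>\<in>C. ?m \<sigma> = Suc ` W}. card \<sigma> = l} = (if l = k then b else 0)"
    proof (rule card_cells_zero_differential[where a = a])
      have "finite C" by (rule finite_subset[OF h(1)]) simp
      thus "finite {\<sigma>\<in>C. ?m \<sigma> = Suc ` W}" by simp
      show "a \<sigma> \<tau> = 0" if "\<sigma> \<in> {\<sigma>\<in>C. ?m \<sigma> = Suc ` W}" "\<tau> \<in> {\<sigma>\<in>C. ?m \<sigma> = Suc ` W}" for \<sigma> \<tau>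
        using h(3)[of \<sigma> \<tau>] that by auto
      show "exact_at card a {\<sigma>\<in>C. ?m \<sigma> = Suc ` W} l" if "l \<noteq> k" for l
        by (rule h(4), unfold str, rule concentrated_exact[OF conc that])
      show "(\<Sum>\<sigma> | \<sigma> \<in> C \<and> ?m \<sigma> = Suc ` W. (-1) ^ card \<sigma>) = (-1) ^ k * int b"
        unfolding h(5) str by (rule concentrated_euler[OF conc])
    qed
    thus ?thesis by (simp add: conj_assoc)
  qed
  note count = this
  show ?thesis
    by (rule exI[of _ C], rule exI[of _ a], intro conjI ballI allI impI) (rule h(1), rule h(2), erule (2) h(3), rule count)
qed

section \<open>Monomials and the polynomial ring\<close>

lemma poly_mapping_eq_sum_single: "f = (\<Sum>k\<in>Poly_Mapping.keys f. Poly_Mapping.single k (Poly_Mapping.lookup f k))"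
proof (rule poly_mapping_eqI)
  fix x
  have "Poly_Mapping.lookup (\<Sum>k\<in>Poly_Mapping.keys f. Poly_Mapping.single k (Poly_Mapping.lookup f k)) x
      = (\<Sum>k\<in>Poly_Mapping.keys f. if k = x then Poly_Mapping.lookup f x else 0)"
    unfolding lookup_sum by (rule sum.cong) (auto simp: lookup_single when_def)
  also have "\<dots> = Poly_Mapping.lookup f x"
    by (simp add: sum.delta not_in_keys_iff_lookup_eq_zero)
  finally show "Poly_Mapping.lookup f x
      = Poly_Mapping.lookup (\<Sum>k\<in>Poly_Mapping.keys f. Poly_Mapping.single k (Poly_Mapping.lookup f k)) x" ..
qed

lemma single_times: "Poly_Mapping.single x c * f
    = (\<Sum>k\<in>Poly_Mapping.keys f. Poly_Mapping.single (x + k) (c * Poly_Mapping.lookup f k))"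
  for f :: "'k::field mpoly"
proof -
  have "Poly_Mapping.single x c * f
      = (\<Sum>k\<in>Poly_Mapping.keys f. Poly_Mapping.single x c * Poly_Mapping.single k (Poly_Mapping.lookup f k))"
    unfolding sum_distrib_left[symmetric] poly_mapping_eq_sum_single[of f, symmetric] ..
  thus ?thesis by (simp add: mult_single)
qed

lemma lookup_single_times: "Poly_Mapping.lookup (Poly_Mapping.single x c * f) w
    = (\<Sum>k\<in>Poly_Mapping.keys f. if x + k = w then c * Poly_Mapping.lookup f k else 0)"
  for f :: "'k::field mpoly"
  unfolding single_times lookup_sum by (rule sum.cong) (auto simp: lookup_single when_def)

lemma lookup_single_times_add: "Poly_Mapping.lookup (Poly_Mapping.single x c * f) (x + v) = c * Poly_Mapping.lookup f v"
  for f :: "'k::field mpoly"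
  unfolding lookup_single_times by (simp add: sum.delta not_in_keys_iff_lookup_eq_zero)

lemma lookup_single_times_none:
  fixes f :: "'k::field mpoly"
  assumes "\<And>k. x + k \<noteq> w"
  shows "Poly_Mapping.lookup (Poly_Mapping.single x c * f) w = 0"
  unfolding lookup_single_times using assms by simp

definition sq_mon :: "nat set \<Rightarrow> (nat \<Rightarrow>\<^sub>0 nat)" where
  "sq_mon U = (\<Sum>i\<in>U. Poly_Mapping.single i 1)"

lemma lookup_sq_mon: "finite U \<Longrightarrow> Poly_Mapping.lookup (sq_mon U) i = (if i \<in> U then 1 else 0)"
  unfolding sq_mon_def lookup_sum by (simp add: lookup_single when_def sum.delta)

lemma keys_sq_mon: "finite U \<Longrightarrow> Poly_Mapping.keys (sq_mon U) = U"
  by (auto simp: in_keys_iff lookup_sq_mon split: if_splits)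

lemma mon_deg_sq_mon: "finite U \<Longrightarrow> mon_deg (sq_mon U) = card U"
  by (simp add: mon_deg_def keys_sq_mon lookup_sq_mon)

lemma sq_mon_empty [simp]: "sq_mon {} = 0"
  by (simp add: sq_mon_def)

lemma keys_add_nat: "Poly_Mapping.keys (u + v) = Poly_Mapping.keys u \<union> Poly_Mapping.keys v"
  for u v :: "nat \<Rightarrow>\<^sub>0 nat"
  by (auto simp: in_keys_iff lookup_add)

lemma keys_diff_nat: "Poly_Mapping.keys (u - v) \<subseteq> Poly_Mapping.keys u"
  for u v :: "nat \<Rightarrow>\<^sub>0 nat"
  by (auto simp: in_keys_iff lookup_minus)

lemma sq_mon_add_diff:
  assumes "finite U" "U \<subseteq> Poly_Mapping.keys u"
  shows "sq_mon U + (u - sq_mon U) = u"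
proof (rule poly_mapping_eqI)
  fix i
  have "1 \<le> Poly_Mapping.lookup u i" if "i \<in> U" using assms(2) that in_keys_iff[of i u] by auto
  thus "Poly_Mapping.lookup (sq_mon U + (u - sq_mon U)) i = Poly_Mapping.lookup u i"
    using assms(1) by (simp add: lookup_add lookup_minus lookup_sq_mon)
qed

text \<open>
  This is how multidegrees compose: from \<open>V\<close> to \<open>U\<close> and on to \<open>u\<close>.
\<close>

lemma sq_mon_diff_add:
  assumes "finite U" "V \<subseteq> U" "U \<subseteq> Poly_Mapping.keys u"
  shows "sq_mon (U - V) + (u - sq_mon U) = u - sq_mon V"
proof (rule poly_mapping_eqI)
  fix i
  have "1 \<le> Poly_Mapping.lookup u i" if "i \<in> U" using assms(3) that in_keys_iff[of i u] by auto
  thus "Poly_Mapping.lookup (sq_mon (U - V) + (u - sq_mon U)) i = Poly_Mapping.lookup (u - sq_mon V) i"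
    using assms(1,2) finite_subset[OF assms(2,1)]
    by (auto simp: lookup_add lookup_minus lookup_sq_mon)
qed

lemma sq_mon_add: "finite U \<Longrightarrow> finite V \<Longrightarrow> U \<inter> V = {} \<Longrightarrow> sq_mon U + sq_mon V = sq_mon (U \<union> V)"
  by (simp add: sq_mon_def sum.union_disjoint)

lemma poly_ringI: "(\<And>m. m \<in> Poly_Mapping.keys f \<Longrightarrow> Poly_Mapping.keys m \<subseteq> {1..n}) \<Longrightarrow> f \<in> poly_ring n"
  by (simp add: poly_ring_def)

lemma poly_ring_zero [simp]: "0 \<in> poly_ring n"
  by (simp add: poly_ring_def)

lemma poly_ring_single: "Poly_Mapping.keys u \<subseteq> {1..n} \<Longrightarrow> Poly_Mapping.single u c \<in> poly_ring n"
  by (auto simp: poly_ring_def split: if_splits)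

lemma poly_ring_one [simp]: "1 \<in> poly_ring n"
  by (auto simp: poly_ring_def)

lemma poly_ring_add: "f \<in> poly_ring n \<Longrightarrow> g \<in> poly_ring n \<Longrightarrow> f + g \<in> poly_ring n"
  using keys_add[of f g] by (auto simp: poly_ring_def)

lemma poly_ring_uminus: "f \<in> poly_ring n \<Longrightarrow> - f \<in> poly_ring n"
  by (auto simp: poly_ring_def in_keys_iff)

lemma poly_ring_diff: "f \<in> poly_ring n \<Longrightarrow> g \<in> poly_ring n \<Longrightarrow> f - g \<in> poly_ring n"
  using poly_ring_add[of f n "- g"] poly_ring_uminus[of g n] by simp

lemma poly_ring_times: "f \<in> poly_ring n \<Longrightarrow> g \<in> poly_ring n \<Longrightarrow> f * g \<in> poly_ring n"
proof (rule poly_ringI)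
  fix m assume f: "f \<in> poly_ring n" and g: "g \<in> poly_ring n" and "m \<in> Poly_Mapping.keys (f * g)"
  then obtain x y where "x \<in> Poly_Mapping.keys f" "y \<in> Poly_Mapping.keys g" "m = x + y"
    using keys_mult[of f g] by blast
  thus "Poly_Mapping.keys m \<subseteq> {1..n}" using f g by (simp add: keys_add_nat poly_ring_def)
qed

lemma poly_ring_sum: "(\<And>x. x \<in> A \<Longrightarrow> f x \<in> poly_ring n) \<Longrightarrow> sum f A \<in> poly_ring n"
  by (induction A rule: infinite_finite_induct) (auto intro: poly_ring_add)

section \<open>Resolutions in terms of matrix entries\<close>

lemma mult_mat_vec_entry:
  assumes "A \<in> carrier_mat nr nc" "v \<in> carrier_vec nc" "b < nr"
  shows "(A *\<^sub>v v) $ b = (\<Sum>a<nc. A $$ (b, a) * v $ a)"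
  using assms by (auto simp: scalar_prod_def lessThan_atLeast0 intro!: sum.cong)

text \<open>
  Exactness at \<open>F\<^sub>i\<^sub>+\<^sub>1\<close> in terms of the matrix entries \<open>e i b a\<close>; vectors are functions of which only the
  values below the rank matter, so no dimensions have to be tracked.
\<close>

definition kernel_is_image :: "nat \<Rightarrow> (nat \<Rightarrow> nat) \<Rightarrow> (nat \<Rightarrow> nat \<Rightarrow> nat \<Rightarrow> 'k::field mpoly) \<Rightarrow> nat \<Rightarrow> bool" where
  "kernel_is_image n r e i \<longleftrightarrow> (\<forall>v. (\<forall>a<r (i + 1). v a \<in> poly_ring n) \<longrightarrow>
     ((\<forall>b<r i. (\<Sum>a<r (i + 1). e i b a * v a) = 0) \<longleftrightarrow>
      (\<exists>w. (\<forall>c<r (i + 2). w c \<in> poly_ring n) \<and> (\<forall>a<r (i + 1). v a = (\<Sum>c<r (i + 2). e (i + 1) a c * w c)))))"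

lemma kernel_is_image_iff:
  fixes \<phi> :: "nat \<Rightarrow> 'k::field mpoly mat"
  assumes "\<phi> i \<in> carrier_mat (r i) (r (i + 1))" "\<phi> (i + 1) \<in> carrier_mat (r (i + 1)) (r (i + 2))"
    and ring: "\<And>a c. a < r (i + 1) \<Longrightarrow> c < r (i + 2) \<Longrightarrow> \<phi> (i + 1) $$ (a, c) \<in> poly_ring n"
  shows "{v \<in> free_module n (r (i + 1)). \<phi> i *\<^sub>v v = 0\<^sub>v (r i)} = {\<phi> (i + 1) *\<^sub>v w | w. w \<in> free_module n (r (i + 2))}
     \<longleftrightarrow> kernel_is_image n r (\<lambda>i b a. \<phi> i $$ (b, a)) i"
proof -
  let ?L = "{v \<in> free_module n (r (i + 1)). \<phi> i *\<^sub>v v = 0\<^sub>v (r i)}"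
    and ?R = "{\<phi> (i + 1) *\<^sub>v w | w. w \<in> free_module n (r (i + 2))}"
  let ?P = "\<lambda>v. \<forall>b<r i. (\<Sum>a<r (i + 1). \<phi> i $$ (b, a) * v a) = 0"
  let ?Q = "\<lambda>v. \<exists>w. (\<forall>c<r (i + 2). w c \<in> poly_ring n) \<and> (\<forall>a<r (i + 1). v a = (\<Sum>c<r (i + 2). \<phi> (i + 1) $$ (a, c) * w c))"
  have fm: "vec k f \<in> free_module n k \<longleftrightarrow> (\<forall>a<k. f a \<in> poly_ring n)" for k and f :: "nat \<Rightarrow> 'k mpoly"
    by (auto simp: free_module_def)
  have L: "vec (r (i + 1)) v \<in> ?L \<longleftrightarrow> (\<forall>a<r (i + 1). v a \<in> poly_ring n) \<and> ?P v" for v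
  proof -
    have "\<phi> i *\<^sub>v vec (r (i + 1)) v = 0\<^sub>v (r i) \<longleftrightarrow> ?P v"
    proof
      assume h: "\<phi> i *\<^sub>v vec (r (i + 1)) v = 0\<^sub>v (r i)"
      show "?P v"
      proof (intro allI impI)
        fix b assume b: "b < r i"
        have "(\<phi> i *\<^sub>v vec (r (i + 1)) v) $ b = (\<Sum>a<r (i + 1). \<phi> i $$ (b, a) * vec (r (i + 1)) v $ a)"
          by (rule mult_mat_vec_entry[OF assms(1) _ b]) simp
        thus "(\<Sum>a<r (i + 1). \<phi> i $$ (b, a) * v a) = 0" unfolding h using b by simp
      qed
    next
      assume h: "?P v"
      show "\<phi> i *\<^sub>v vec (r (i + 1)) v = 0\<^sub>v (r i)"
      proof (rule eq_vecI)
        fix b assume "b < dim_vec (0\<^sub>v (r i) :: 'k mpoly vec)"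
        hence b: "b < r i" by simp
        have "(\<phi> i *\<^sub>v vec (r (i + 1)) v) $ b = (\<Sum>a<r (i + 1). \<phi> i $$ (b, a) * vec (r (i + 1)) v $ a)"
          by (rule mult_mat_vec_entry[OF assms(1) _ b]) simp
        thus "(\<phi> i *\<^sub>v vec (r (i + 1)) v) $ b = 0\<^sub>v (r i) $ b" using h b by simp
      qed (use assms(1) in simp)
    qed
    thus ?thesis using fm by simp
  qed
  have R: "vec (r (i + 1)) v \<in> ?R \<longleftrightarrow> ?Q v" for v
  proof
    assume "vec (r (i + 1)) v \<in> ?R"
    then obtain w where w: "w \<in> free_module n (r (i + 2))" "vec (r (i + 1)) v = \<phi> (i + 1) *\<^sub>v w" by blast
    have wc: "w \<in> carrier_vec (r (i + 2))" "\<forall>c<r (i + 2). w $ c \<in> poly_ring n"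
      using w(1) by (auto simp: free_module_def)
    have "v a = (\<Sum>c<r (i + 2). \<phi> (i + 1) $$ (a, c) * w $ c)" if a: "a < r (i + 1)" for a
      using mult_mat_vec_entry[OF assms(2) wc(1) a] a unfolding w(2)[symmetric] by simp
    thus "?Q v" using wc(2) by (intro exI[of _ "\<lambda>c. w $ c"]) auto
  next
    assume "?Q v"
    then obtain w where w: "\<forall>c<r (i + 2). w c \<in> poly_ring n"
      "\<forall>a<r (i + 1). v a = (\<Sum>c<r (i + 2). \<phi> (i + 1) $$ (a, c) * w c)" by blast
    have "vec (r (i + 1)) v = \<phi> (i + 1) *\<^sub>v vec (r (i + 2)) w"
    proof (rule eq_vecI)
      fix a assume "a < dim_vec (\<phi> (i + 1) *\<^sub>v vec (r (i + 2)) w)"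
      hence a: "a < r (i + 1)" using assms(2) by simp
      have "(\<phi> (i + 1) *\<^sub>v vec (r (i + 2)) w) $ a = (\<Sum>c<r (i + 2). \<phi> (i + 1) $$ (a, c) * vec (r (i + 2)) w $ c)"
        by (rule mult_mat_vec_entry[OF assms(2) _ a]) simp
      thus "vec (r (i + 1)) v $ a = (\<phi> (i + 1) *\<^sub>v vec (r (i + 2)) w) $ a" using w a by simp
    qed (use assms(2) in simp)
    thus "vec (r (i + 1)) v \<in> ?R" using fm w(1) by blast
  qed
  have vecs: "\<exists>f. v = vec (r (i + 1)) f" if "v \<in> ?L \<union> ?R" for v
  proof -
    have "dim_vec v = r (i + 1)" using that assms(2) by (auto simp: free_module_def)
    thus ?thesis by (intro exI[of _ "\<lambda>a. v $ a"]) auto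
  qed
  have Rring: "\<forall>a<r (i + 1). v a \<in> poly_ring n" if "?Q v" for v
    using that ring by (auto intro!: poly_ring_sum poly_ring_times)
  have "?L = ?R \<longleftrightarrow> (\<forall>v. vec (r (i + 1)) v \<in> ?L \<longleftrightarrow> vec (r (i + 1)) v \<in> ?R)"
  proof
    assume h: "\<forall>v. vec (r (i + 1)) v \<in> ?L \<longleftrightarrow> vec (r (i + 1)) v \<in> ?R"
    show "?L = ?R"
    proof (intro Set.set_eqI)
      fix v show "v \<in> ?L \<longleftrightarrow> v \<in> ?R"
      proof (cases "v \<in> ?L \<union> ?R")
        case True
        then obtain f where f: "v = vec (r (i + 1)) f" using vecs by blast
        show ?thesis unfolding f using h by blast
      qed blast
    qed
  qed (simp only: simp_thms)
  also have "\<dots> \<longleftrightarrow> (\<forall>v. (\<forall>a<r (i + 1). v a \<in> poly_ring n) \<and> ?P v \<longleftrightarrow> ?Q v)" by (simp only: L R)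
  also have "\<dots> \<longleftrightarrow> kernel_is_image n r (\<lambda>i b a. \<phi> i $$ (b, a)) i"
    unfolding kernel_is_image_def using Rring by (intro iff_allI) blast
  finally show ?thesis .
qed

text \<open>
  Matrices and vectors are replaced by functions of their indices, for which sums over cells can be used
  without carrier conditions.
\<close>

lemma min_graded_free_resolution_iff:
  fixes \<phi> :: "nat \<Rightarrow> 'k::field mpoly mat" and D :: "nat \<Rightarrow> int list"
  defines "e \<equiv> \<lambda>i b a. \<phi> i $$ (b, a)" and "r \<equiv> \<lambda>i. length (D i)"
  shows "min_graded_free_resolution n I D \<phi> \<longleftrightarrow>
     D 0 = [0] \<and> (\<forall>i. \<phi> i \<in> carrier_mat (r i) (r (i + 1))) \<and>
     (\<forall>i. \<forall>b<r i. \<forall>a<r (i + 1). e i b a \<in> poly_ring n \<and>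
        homogeneous_of_degree (D (i + 1) ! a - D i ! b) (e i b a) \<and> e i b a \<in> irrelevant_ideal n) \<and>
     {\<Sum>a<r 1. e 0 0 a * w a | w. \<forall>a<r 1. w a \<in> poly_ring n} = I \<and>
     (\<forall>i. kernel_is_image n r e i)"
proof -
  have img: "{(\<phi> 0 *\<^sub>v w) $ 0 | w. w \<in> free_module n (r 1)} = {\<Sum>a<r 1. e 0 0 a * w a | w. \<forall>a<r 1. w a \<in> poly_ring n}"
    if "\<phi> 0 \<in> carrier_mat (r 0) (r 1)" "0 < r 0"
  proof (intro Set.set_eqI iffI)
    fix f assume "f \<in> {(\<phi> 0 *\<^sub>v w) $ 0 | w. w \<in> free_module n (r 1)}"
    then obtain w where w: "f = (\<phi> 0 *\<^sub>v w) $ 0" "w \<in> carrier_vec (r 1)" "\<forall>a<r 1. w $ a \<in> poly_ring n"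
      by (auto simp: free_module_def)
    have "f = (\<Sum>a<r 1. e 0 0 a * w $ a)"
      unfolding w(1) e_def by (rule mult_mat_vec_entry[OF that(1) w(2) that(2)])
    thus "f \<in> {\<Sum>a<r 1. e 0 0 a * w a | w. \<forall>a<r 1. w a \<in> poly_ring n}" using w(3)
      by (intro CollectI exI[of _ "\<lambda>a. w $ a"]) auto
  next
    fix f assume "f \<in> {\<Sum>a<r 1. e 0 0 a * w a | w. \<forall>a<r 1. w a \<in> poly_ring n}"
    then obtain w where w: "f = (\<Sum>a<r 1. e 0 0 a * w a)" "\<forall>a<r 1. w a \<in> poly_ring n" by blast
    have "(\<phi> 0 *\<^sub>v vec (r 1) w) $ 0 = (\<Sum>a<r 1. \<phi> 0 $$ (0, a) * vec (r 1) w $ a)"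
      by (rule mult_mat_vec_entry[OF that(1) _ that(2)]) simp
    also have "\<dots> = f" unfolding w(1) e_def by (rule sum.cong) auto
    finally have "f = (\<phi> 0 *\<^sub>v vec (r 1) w) $ 0" ..
    moreover have "vec (r 1) w \<in> free_module n (r 1)" using w(2) by (simp add: free_module_def)
    ultimately show "f \<in> {(\<phi> 0 *\<^sub>v w) $ 0 | w. w \<in> free_module n (r 1)}" by blast
  qed
  have ker: "(\<forall>i. {v \<in> free_module n (r (i + 1)). \<phi> i *\<^sub>v v = 0\<^sub>v (r i)} = {\<phi> (i + 1) *\<^sub>v w | w. w \<in> free_module n (r (i + 2))})
      \<longleftrightarrow> (\<forall>i. kernel_is_image n r e i)"
    if "\<forall>i. \<phi> i \<in> carrier_mat (r i) (r (i + 1))" "\<forall>i. \<forall>b<r i. \<forall>a<r (i + 1). e i b a \<in> poly_ring n"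
  proof (rule iff_allI)
    fix i
    have "\<phi> (i + 1) \<in> carrier_mat (r (i + 1)) (r (i + 2))" using that(1)[rule_format, of "i + 1"] by (simp add: numeral_2_eq_2)
    moreover have "\<phi> (i + 1) $$ (a, c) \<in> poly_ring n" if "a < r (i + 1)" "c < r (i + 2)" for a c
      using \<open>\<forall>i. \<forall>b<r i. \<forall>a<r (i + 1). e i b a \<in> poly_ring n\<close>[rule_format, of a "i + 1" c] that
      by (simp add: e_def numeral_2_eq_2)
    ultimately show "({v \<in> free_module n (r (i + 1)). \<phi> i *\<^sub>v v = 0\<^sub>v (r i)} = {\<phi> (i + 1) *\<^sub>v w | w. w \<in> free_module n (r (i + 2))})
        = kernel_is_image n r e i"
      unfolding e_def using kernel_is_image_iff[of \<phi> i r n] that(1) by blast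
  qed
  have r0: "0 < r 0" if "D 0 = [0]" using that by (simp add: r_def)
  show ?thesis
  proof
    assume h: "min_graded_free_resolution n I D \<phi>"
    have D0: "D 0 = [0]" and car: "\<forall>i. \<phi> i \<in> carrier_mat (r i) (r (i + 1))"
      and ent: "\<forall>i. \<forall>b<r i. \<forall>a<r (i + 1). e i b a \<in> poly_ring n \<and>
        homogeneous_of_degree (D (i + 1) ! a - D i ! b) (e i b a) \<and> e i b a \<in> irrelevant_ideal n"
      and im: "{(\<phi> 0 *\<^sub>v w) $ 0 | w. w \<in> free_module n (r 1)} = I"
      and k: "\<forall>i. {v \<in> free_module n (r (i + 1)). \<phi> i *\<^sub>v v = 0\<^sub>v (r i)} = {\<phi> (i + 1) *\<^sub>v w | w. w \<in> free_module n (r (i + 2))}"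
      using h unfolding min_graded_free_resolution_def e_def r_def by - (elim conjE, assumption)+
    have "\<phi> 0 \<in> carrier_mat (r 0) (r 1)" using car[rule_format, of 0] by simp
    hence "{\<Sum>a<r 1. e 0 0 a * w a | w. \<forall>a<r 1. w a \<in> poly_ring n} = I" using img r0[OF D0] im by simp
    moreover have "\<forall>i. kernel_is_image n r e i" using ker[OF car] ent k by blast
    ultimately show "D 0 = [0] \<and> (\<forall>i. \<phi> i \<in> carrier_mat (r i) (r (i + 1))) \<and>
     (\<forall>i. \<forall>b<r i. \<forall>a<r (i + 1). e i b a \<in> poly_ring n \<and>
        homogeneous_of_degree (D (i + 1) ! a - D i ! b) (e i b a) \<and> e i b a \<in> irrelevant_ideal n) \<and>
     {\<Sum>a<r 1. e 0 0 a * w a | w. \<forall>a<r 1. w a \<in> poly_ring n} = I \<and>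
     (\<forall>i. kernel_is_image n r e i)" using D0 car ent by (intro conjI)
  next
    assume h: "D 0 = [0] \<and> (\<forall>i. \<phi> i \<in> carrier_mat (r i) (r (i + 1))) \<and>
     (\<forall>i. \<forall>b<r i. \<forall>a<r (i + 1). e i b a \<in> poly_ring n \<and>
        homogeneous_of_degree (D (i + 1) ! a - D i ! b) (e i b a) \<and> e i b a \<in> irrelevant_ideal n) \<and>
     {\<Sum>a<r 1. e 0 0 a * w a | w. \<forall>a<r 1. w a \<in> poly_ring n} = I \<and>
     (\<forall>i. kernel_is_image n r e i)"
    have D0: "D 0 = [0]" and car: "\<forall>i. \<phi> i \<in> carrier_mat (r i) (r (i + 1))"
      and ent: "\<forall>i. \<forall>b<r i. \<forall>a<r (i + 1). e i b a \<in> poly_ring n \<and>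
        homogeneous_of_degree (D (i + 1) ! a - D i ! b) (e i b a) \<and> e i b a \<in> irrelevant_ideal n"
      and im: "{\<Sum>a<r 1. e 0 0 a * w a | w. \<forall>a<r 1. w a \<in> poly_ring n} = I"
      and k: "\<forall>i. kernel_is_image n r e i"
      using h by - (elim conjE, assumption)+
    have "\<phi> 0 \<in> carrier_mat (r 0) (r 1)" using car[rule_format, of 0] by simp
    hence "{(\<phi> 0 *\<^sub>v w) $ 0 | w. w \<in> free_module n (r 1)} = I" using img r0[OF D0] im by simp
    moreover have "\<forall>i. {v \<in> free_module n (r (i + 1)). \<phi> i *\<^sub>v v = 0\<^sub>v (r i)} = {\<phi> (i + 1) *\<^sub>v w | w. w \<in> free_module n (r (i + 2))}"
      using ker[OF car] ent k by blast
    ultimately show "min_graded_free_resolution n I D \<phi>"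
      unfolding min_graded_free_resolution_def
      using D0 car ent unfolding e_def r_def by (intro conjI)
  qed
qed

section \<open>Homogenisation\<close>

text \<open>
  The homogeneous matrix entry with coefficient \<open>a \<sigma> \<tau>\<close>: the degrees of the two cells leave no choice
  for the monomial.
\<close>

definition entry :: "('c \<Rightarrow> nat set) \<Rightarrow> ('c \<Rightarrow> 'c \<Rightarrow> 'k::field) \<Rightarrow> 'c \<Rightarrow> 'c \<Rightarrow> 'k mpoly" where
  "entry m a \<sigma> \<tau> = Poly_Mapping.single (sq_mon (m \<sigma> - m \<tau>)) (a \<sigma> \<tau>)"

lemma entry_entry:
  assumes "a \<rho> \<sigma> \<noteq> 0 \<Longrightarrow> m \<sigma> \<subseteq> m \<rho>" "a \<sigma> \<tau> \<noteq> 0 \<Longrightarrow> m \<tau> \<subseteq> m \<sigma>" "finite (m \<rho>)"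
  shows "entry m a \<sigma> \<tau> * entry m a \<rho> \<sigma> = Poly_Mapping.single (sq_mon (m \<rho> - m \<tau>)) (a \<rho> \<sigma> * a \<sigma> \<tau>)"
proof (cases "a \<rho> \<sigma> = 0 \<or> a \<sigma> \<tau> = 0")
  case True thus ?thesis by (auto simp: entry_def)
next
  case False
  hence s: "m \<sigma> \<subseteq> m \<rho>" "m \<tau> \<subseteq> m \<sigma>" using assms by auto
  have "sq_mon (m \<sigma> - m \<tau>) + sq_mon (m \<rho> - m \<sigma>) = sq_mon ((m \<sigma> - m \<tau>) \<union> (m \<rho> - m \<sigma>))"
    by (rule sq_mon_add) (use s assms(3) finite_subset[OF s(1) assms(3)] in auto)
  also have "(m \<sigma> - m \<tau>) \<union> (m \<rho> - m \<sigma>) = m \<rho> - m \<tau>" using s by auto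
  finally show ?thesis by (simp add: entry_def mult_single mult.commute add.commute)
qed

lemma single_sum: "Poly_Mapping.single k (\<Sum>x\<in>B. f x) = (\<Sum>x\<in>B. Poly_Mapping.single k (f x))"
  by (induction B rule: infinite_finite_induct) (auto simp: single_add)

text \<open>
  Exactness is checked monomial by monomial: the part of a cycle in the multidegree of a monomial
  \<open>u\<close> is a cycle of the coefficient complex inside the support of \<open>u\<close>.
\<close>

lemma multigraded_lift:
  fixes a :: "'c \<Rightarrow> 'c \<Rightarrow> 'k::field" and v :: "'c \<Rightarrow> 'k mpoly"
  assumes res: "multigraded_resolution dm m good base C a"
    and mC: "\<And>\<sigma>. \<sigma> \<in> C \<Longrightarrow> m \<sigma> \<subseteq> {1..n}" and up: "\<And>U V. good U \<Longrightarrow> U \<subseteq> V \<Longrightarrow> good V"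
    and vR: "\<And>\<sigma>. \<sigma> \<in> C \<Longrightarrow> dm \<sigma> = i \<Longrightarrow> v \<sigma> \<in> poly_ring n"
    and cyc: "\<And>\<tau>. \<tau> \<in> C \<Longrightarrow> (\<Sum>\<sigma> | \<sigma> \<in> C \<and> dm \<sigma> = i. entry m a \<sigma> \<tau> * v \<sigma>) = 0"
    and v0: "\<And>u. i = 0 \<Longrightarrow> u \<in> Poly_Mapping.keys (v base) \<Longrightarrow> good (Poly_Mapping.keys u)"
  shows "\<exists>w. (\<forall>\<rho>. w \<rho> \<in> poly_ring n) \<and>
    (\<forall>\<sigma>\<in>C. dm \<sigma> = i \<longrightarrow> v \<sigma> = (\<Sum>\<rho> | \<rho> \<in> C \<and> dm \<rho> = Suc i. entry m a \<rho> \<sigma> * w \<rho>))"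
proof -
  have cx: "complex_on dm a C" and deg: "\<And>\<sigma> \<tau>. \<sigma> \<in> C \<Longrightarrow> \<tau> \<in> C \<Longrightarrow> a \<sigma> \<tau> \<noteq> 0 \<Longrightarrow> m \<tau> \<subseteq> m \<sigma>"
    and ex: "\<And>U k. good U \<Longrightarrow> exact_at dm a {\<sigma>\<in>C. m \<sigma> \<subseteq> U} k"
    and orig: "m base = {}" "\<And>\<sigma>. \<sigma> \<in> C \<Longrightarrow> \<sigma> \<noteq> base \<Longrightarrow> dm \<sigma> \<noteq> 0 \<and> good (m \<sigma>)" "dm base = 0"
    using res unfolding multigraded_resolution_def by blast+
  have finC: "finite C" by (rule complex_on_finite[OF cx])
  have finm: "finite (m \<sigma>)" if "\<sigma> \<in> C" for \<sigma> using mC[OF that] finite_subset by blast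
  \<comment> \<open>The coefficients of \<open>v\<close> in multidegree \<open>u\<close>: cell \<open>\<sigma>\<close> contributes the monomial \<open>u / m \<sigma>\<close>.\<close>
  define x where "x = (\<lambda>u \<sigma>. if \<sigma> \<in> C \<and> dm \<sigma> = i \<and> m \<sigma> \<subseteq> Poly_Mapping.keys u
    then Poly_Mapping.lookup (v \<sigma>) (u - sq_mon (m \<sigma>)) else 0)"
  let ?CU = "\<lambda>u. {\<sigma>\<in>C. m \<sigma> \<subseteq> Poly_Mapping.keys u}"
  have chain: "chain_in dm (?CU u) i (x u)" for u by (auto simp: chain_in_def x_def)
  have cycle: "(\<Sum>\<sigma>\<in>?CU u. x u \<sigma> * a \<sigma> \<tau>) = 0" if \<tau>: "\<tau> \<in> ?CU u" for u \<tau>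
  proof -
    have \<tau>C: "\<tau> \<in> C" "m \<tau> \<subseteq> Poly_Mapping.keys u" using \<tau> by auto
    have trm: "Poly_Mapping.lookup (entry m a \<sigma> \<tau> * v \<sigma>) (u - sq_mon (m \<tau>)) = x u \<sigma> * a \<sigma> \<tau>"
      if \<sigma>: "\<sigma> \<in> C" "dm \<sigma> = i" for \<sigma>
    proof (cases "a \<sigma> \<tau> = 0")
      case True thus ?thesis by (simp add: entry_def)
    next
      case False
      hence sub: "m \<tau> \<subseteq> m \<sigma>" using deg \<sigma> \<tau>C by blast
      show ?thesis
      proof (cases "m \<sigma> \<subseteq> Poly_Mapping.keys u")
        case True
        have "u - sq_mon (m \<tau>) = sq_mon (m \<sigma> - m \<tau>) + (u - sq_mon (m \<sigma>))"
          by (rule sq_mon_diff_add[OF finm[OF \<sigma>(1)] sub True, symmetric])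
        thus ?thesis unfolding entry_def using lookup_single_times_add \<sigma> True by (simp add: x_def mult.commute)
      next
        case False
        then obtain p where p: "p \<in> m \<sigma>" "p \<notin> Poly_Mapping.keys u" by blast
        have "sq_mon (m \<sigma> - m \<tau>) + k \<noteq> u - sq_mon (m \<tau>)" for k
        proof
          assume e: "sq_mon (m \<sigma> - m \<tau>) + k = u - sq_mon (m \<tau>)"
          have "p \<in> Poly_Mapping.keys (sq_mon (m \<sigma> - m \<tau>) + k)"
            using p \<tau>C(2) finm[OF \<sigma>(1)] by (auto simp: keys_add_nat keys_sq_mon)
          thus False unfolding e using keys_diff_nat[of u "sq_mon (m \<tau>)"] p by blast
        qed
        hence "Poly_Mapping.lookup (entry m a \<sigma> \<tau> * v \<sigma>) (u - sq_mon (m \<tau>)) = 0"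
          unfolding entry_def by (rule lookup_single_times_none)
        thus ?thesis using False by (simp add: x_def)
      qed
    qed
    have "(\<Sum>\<sigma>\<in>?CU u. x u \<sigma> * a \<sigma> \<tau>) = (\<Sum>\<sigma> | \<sigma> \<in> C \<and> dm \<sigma> = i. x u \<sigma> * a \<sigma> \<tau>)"
      by (rule sum.mono_neutral_cong) (use finC in \<open>auto simp: x_def\<close>)
    also have "\<dots> = (\<Sum>\<sigma> | \<sigma> \<in> C \<and> dm \<sigma> = i. Poly_Mapping.lookup (entry m a \<sigma> \<tau> * v \<sigma>) (u - sq_mon (m \<tau>)))"
      by (rule sum.cong) (use trm in auto)
    also have "\<dots> = 0" unfolding lookup_sum[symmetric] cyc[OF \<tau>C(1)] by simp
    finally show ?thesis .
  qed
  \<comment> \<open>If the monomial \<open>u\<close> is not in the ideal, only \<open>base\<close> could contribute to \<open>x u\<close>, and \<open>v0\<close> excludes it.\<close>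
  let ?fills = "\<lambda>u y. chain_in dm (?CU u) (Suc i) y \<and> (\<forall>\<tau>\<in>?CU u. (\<Sum>\<sigma>\<in>?CU u. y \<sigma> * a \<sigma> \<tau>) = x u \<tau>)"
  have "\<exists>y. ?fills u y" for u
  proof (cases "good (Poly_Mapping.keys u)")
    case True
    show ?thesis by (rule exact_atD[OF ex[OF True] chain cycle])
  next
    case False
    have "x u \<sigma> = 0" for \<sigma>
    proof (rule ccontr)
      assume nz: "x u \<sigma> \<noteq> 0"
      hence \<sigma>: "\<sigma> \<in> C" "dm \<sigma> = i" "m \<sigma> \<subseteq> Poly_Mapping.keys u" "Poly_Mapping.lookup (v \<sigma>) (u - sq_mon (m \<sigma>)) \<noteq> 0"
        by (auto simp: x_def split: if_splits)
      show False
      proof (cases "\<sigma> = base")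
        case True
        hence "u \<in> Poly_Mapping.keys (v base)" "i = 0" using \<sigma> orig by (auto simp: in_keys_iff)
        thus False using v0 False by blast
      next
        case ne: False
        thus False using orig(2)[OF \<sigma>(1) ne] up \<sigma>(3) False by blast
      qed
    qed
    thus ?thesis by (intro exI[of _ "\<lambda>_. 0"]) (auto simp: chain_in_def)
  qed
  hence "\<exists>Y. \<forall>u. ?fills u (Y u)" by (intro choice) blast
  then obtain Y where fills: "\<forall>u. ?fills u (Y u)" by blast
  have Y: "\<And>u. chain_in dm (?CU u) (Suc i) (Y u)" using fills by blast
  have bY: "\<And>u \<tau>. \<tau> \<in> ?CU u \<Longrightarrow> (\<Sum>\<sigma>\<in>?CU u. Y u \<sigma> * a \<sigma> \<tau>) = x u \<tau>" using fills by blast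
  let ?Ci = "{\<sigma>. \<sigma> \<in> C \<and> dm \<sigma> = i}" and ?Cs = "{\<sigma>. \<sigma> \<in> C \<and> dm \<sigma> = Suc i}"
  \<comment> \<open>The finitely many multidegrees that occur in \<open>v\<close>.\<close>
  define Us where "Us = (\<Union>\<sigma>\<in>?Ci. (\<lambda>k. sq_mon (m \<sigma>) + k) ` Poly_Mapping.keys (v \<sigma>))"
  have finU: "finite Us" unfolding Us_def using finC by auto
  have UR: "Poly_Mapping.keys u \<subseteq> {1..n}" if uU: "u \<in> Us" for u
  proof -
    obtain \<sigma> k where \<sigma>: "\<sigma> \<in> C" "dm \<sigma> = i" "k \<in> Poly_Mapping.keys (v \<sigma>)" "u = sq_mon (m \<sigma>) + k"
      using uU unfolding Us_def by blast
    have "Poly_Mapping.keys k \<subseteq> {1..n}" using vR[OF \<sigma>(1,2)] \<sigma>(3) by (simp add: poly_ring_def)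
    thus ?thesis unfolding \<sigma>(4) keys_add_nat keys_sq_mon[OF finm[OF \<sigma>(1)]] using mC[OF \<sigma>(1)] by blast
  qed
  define w where "w = (\<lambda>\<rho>. \<Sum>u\<in>Us. Poly_Mapping.single (u - sq_mon (m \<rho>)) (Y u \<rho>))"
  have wR: "w \<rho> \<in> poly_ring n" for \<rho>
    unfolding w_def by (intro poly_ring_sum poly_ring_single) (use UR keys_diff_nat in blast)
  have vexp: "v \<sigma> = (\<Sum>u\<in>Us. Poly_Mapping.single (u - sq_mon (m \<sigma>)) (x u \<sigma>))" if \<sigma>: "\<sigma> \<in> C" "dm \<sigma> = i" for \<sigma>
  proof -
    let ?h = "\<lambda>k. sq_mon (m \<sigma>) + k"
    have inj: "inj_on ?h (Poly_Mapping.keys (v \<sigma>))" by (simp add: inj_on_def)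
    have sub: "m \<sigma> \<subseteq> Poly_Mapping.keys (?h k)" for k
      using finm[OF \<sigma>(1)] by (auto simp: keys_add_nat keys_sq_mon)
    have "(\<Sum>u\<in>Us. Poly_Mapping.single (u - sq_mon (m \<sigma>)) (x u \<sigma>))
        = (\<Sum>u\<in>?h ` Poly_Mapping.keys (v \<sigma>). Poly_Mapping.single (u - sq_mon (m \<sigma>)) (x u \<sigma>))"
    proof (rule sum.mono_neutral_right[OF finU])
      show "?h ` Poly_Mapping.keys (v \<sigma>) \<subseteq> Us" unfolding Us_def using \<sigma> by blast
      show "\<forall>u\<in>Us - ?h ` Poly_Mapping.keys (v \<sigma>). Poly_Mapping.single (u - sq_mon (m \<sigma>)) (x u \<sigma>) = 0"
      proof
        fix u assume u: "u \<in> Us - ?h ` Poly_Mapping.keys (v \<sigma>)"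
        have "x u \<sigma> = 0"
        proof (rule ccontr)
          assume "x u \<sigma> \<noteq> 0"
          hence h: "m \<sigma> \<subseteq> Poly_Mapping.keys u" "u - sq_mon (m \<sigma>) \<in> Poly_Mapping.keys (v \<sigma>)"
            by (auto simp: x_def in_keys_iff split: if_splits)
          have "u = ?h (u - sq_mon (m \<sigma>))" by (rule sq_mon_add_diff[OF finm[OF \<sigma>(1)] h(1), symmetric])
          thus False using u h(2) by blast
        qed
        thus "Poly_Mapping.single (u - sq_mon (m \<sigma>)) (x u \<sigma>) = 0" by simp
      qed
    qed
    also have "\<dots> = (\<Sum>k\<in>Poly_Mapping.keys (v \<sigma>). Poly_Mapping.single k (Poly_Mapping.lookup (v \<sigma>) k))"
      unfolding sum.reindex[OF inj] by (rule sum.cong) (use \<sigma> sub in \<open>auto simp: x_def\<close>)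
    also have "\<dots> = v \<sigma>" by (rule poly_mapping_eq_sum_single[symmetric])
    finally show ?thesis ..
  qed
  have "v \<sigma> = (\<Sum>\<rho>\<in>?Cs. entry m a \<rho> \<sigma> * w \<rho>)" if \<sigma>: "\<sigma> \<in> C" "dm \<sigma> = i" for \<sigma>
  proof -
    have trm: "entry m a \<rho> \<sigma> * Poly_Mapping.single (u - sq_mon (m \<rho>)) (Y u \<rho>)
        = Poly_Mapping.single (u - sq_mon (m \<sigma>)) (Y u \<rho> * a \<rho> \<sigma>)" if \<rho>: "\<rho> \<in> C" for u \<rho>
    proof (cases "a \<rho> \<sigma> = 0 \<or> Y u \<rho> = 0")
      case True thus ?thesis by (auto simp: entry_def)
    next
      case False
      hence "m \<sigma> \<subseteq> m \<rho>" "m \<rho> \<subseteq> Poly_Mapping.keys u"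
        using deg \<rho> \<sigma> Y[of u] unfolding chain_in_def by blast+
      hence "sq_mon (m \<rho> - m \<sigma>) + (u - sq_mon (m \<rho>)) = u - sq_mon (m \<sigma>)"
        by (rule sq_mon_diff_add[OF finm[OF \<rho>]])
      thus ?thesis unfolding entry_def mult_single by (simp add: mult.commute)
    qed
    have bd: "(\<Sum>\<rho>\<in>?Cs. Y u \<rho> * a \<rho> \<sigma>) = x u \<sigma>" for u
    proof -
      have "(\<Sum>\<rho>\<in>?Cs. Y u \<rho> * a \<rho> \<sigma>) = (\<Sum>\<rho>\<in>?CU u. Y u \<rho> * a \<rho> \<sigma>)"
      proof (rule sum.mono_neutral_cong)
        show "Y u \<rho> * a \<rho> \<sigma> = 0" if "\<rho> \<in> ?CU u - ?Cs" for \<rho>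
          using that Y[of u] unfolding chain_in_def by auto
        show "Y u \<rho> * a \<rho> \<sigma> = 0" if "\<rho> \<in> ?Cs - ?CU u" for \<rho>
          using that Y[of u] unfolding chain_in_def by auto
      qed (use finC in auto)
      also have "\<dots> = x u \<sigma>"
      proof (cases "m \<sigma> \<subseteq> Poly_Mapping.keys u")
        case True thus ?thesis using bY \<sigma> by simp
      next
        case False
        have "a \<rho> \<sigma> = 0" if "\<rho> \<in> ?CU u" for \<rho> using deg[of \<rho> \<sigma>] that \<sigma> False by blast
        thus ?thesis using False by (simp add: x_def)
      qed
      finally show ?thesis .
    qed
    have "(\<Sum>\<rho>\<in>?Cs. entry m a \<rho> \<sigma> * w \<rho>)
        = (\<Sum>\<rho>\<in>?Cs. \<Sum>u\<in>Us. Poly_Mapping.single (u - sq_mon (m \<sigma>)) (Y u \<rho> * a \<rho> \<sigma>))"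
      unfolding w_def sum_distrib_left by (intro sum.cong refl) (use trm in auto)
    also have "\<dots> = (\<Sum>u\<in>Us. \<Sum>\<rho>\<in>?Cs. Poly_Mapping.single (u - sq_mon (m \<sigma>)) (Y u \<rho> * a \<rho> \<sigma>))"
      by (rule sum.swap)
    also have "\<dots> = (\<Sum>u\<in>Us. Poly_Mapping.single (u - sq_mon (m \<sigma>)) (x u \<sigma>))"
    proof (rule sum.cong[OF refl])
      fix u
      show "(\<Sum>\<rho>\<in>?Cs. Poly_Mapping.single (u - sq_mon (m \<sigma>)) (Y u \<rho> * a \<rho> \<sigma>)) = Poly_Mapping.single (u - sq_mon (m \<sigma>)) (x u \<sigma>)"
        unfolding single_sum[symmetric] bd ..
    qed
    also have "\<dots> = v \<sigma>" by (rule vexp[OF \<sigma>, symmetric])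
    finally show ?thesis ..
  qed
  thus ?thesis using wR by blast
qed

lemma kernel_is_image_cong:
  fixes e e' :: "nat \<Rightarrow> nat \<Rightarrow> nat \<Rightarrow> 'k::field mpoly"
  assumes "\<And>i b c. b < r i \<Longrightarrow> c < r (i + 1) \<Longrightarrow> e i b c = e' i b c"
  shows "kernel_is_image n r e i \<longleftrightarrow> kernel_is_image n r e' i"
proof -
  have s: "(\<Sum>c<r (i + 1). e i b c * v c) = (\<Sum>c<r (i + 1). e' i b c * v c)" if "b < r i" for i b v
    by (rule sum.cong) (use that assms in auto)
  have 1: "(\<forall>b<r i. (\<Sum>c<r (i + 1). e i b c * v c) = 0) \<longleftrightarrow> (\<forall>b<r i. (\<Sum>c<r (i + 1). e' i b c * v c) = 0)" for v
    using s[of _ i v] by auto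
  have "i + 2 = (i + 1) + 1" by simp
  hence 2: "(\<forall>b<r (i + 1). v b = (\<Sum>c<r (i + 2). e (i + 1) b c * w c)) \<longleftrightarrow>
      (\<forall>b<r (i + 1). v b = (\<Sum>c<r (i + 2). e' (i + 1) b c * w c))" for v w
    using s[of _ "i + 1" w] by auto
  show ?thesis unfolding kernel_is_image_def 1 2 ..
qed

lemma single_in_irrelevant_ideal:
  fixes c :: "'k::field"
  assumes "U \<noteq> {}" "U \<subseteq> {1..n}"
  shows "Poly_Mapping.single (sq_mon U) c \<in> irrelevant_ideal n"
proof -
  obtain p where p: "p \<in> U" using assms(1) by blast
  have fin: "finite U" by (rule finite_subset[OF assms(2)]) simp
  let ?f = "Poly_Mapping.single (sq_mon (U - {p})) c" and ?x = "var p :: 'k mpoly"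
  have "sq_mon (U - {p}) + Poly_Mapping.single p 1 = sq_mon U"
    unfolding sq_mon_def sum.remove[OF fin p] by (rule add.commute)
  hence "Poly_Mapping.single (sq_mon U) c = ?f * ?x"
    by (simp add: var_def mult_single)
  hence prod: "Poly_Mapping.single (sq_mon U) c = (\<Sum>g\<in>{?x}. ?f * g)" by simp
  have f: "?f \<in> poly_ring n"
    by (rule poly_ring_single) (use assms fin in \<open>auto simp: keys_sq_mon\<close>)
  have x: "?x \<in> var ` {1..n}" using p assms(2) by blast
  show ?thesis
    unfolding irrelevant_ideal_def ideal_gen_def
    by (rule CollectI, rule exI[of _ "{?x}"], rule exI[of _ "\<lambda>_. ?f"]) (use prod f x in simp)
qed

lemma count_list_distinct_map: "distinct xs \<Longrightarrow> count_list (map f xs) y = card {x \<in> set xs. f x = y}"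
proof (induction xs)
  case (Cons x xs)
  have "{z \<in> set (x # xs). f z = y} = (if f x = y then insert x {z \<in> set xs. f z = y} else {z \<in> set xs. f z = y})" by auto
  thus ?case using Cons by simp
qed simp

text \<open>
  Listing the cells of each dimension turns the coefficient complex into matrices.  The entries lie in the
  irrelevant ideal because incident cells have different degrees.
\<close>

lemma resolution_of_multigraded:
  fixes a :: "'c \<Rightarrow> 'c \<Rightarrow> 'k::field"
  assumes res: "multigraded_resolution dm m good base C a"
    and min: "\<And>\<sigma> \<tau>. \<sigma> \<in> C \<Longrightarrow> \<tau> \<in> C \<Longrightarrow> a \<sigma> \<tau> \<noteq> 0 \<Longrightarrow> m \<sigma> \<noteq> m \<tau>"
    and mC: "\<And>\<sigma>. \<sigma> \<in> C \<Longrightarrow> m \<sigma> \<subseteq> {1..n}" and up: "\<And>U V. good U \<Longrightarrow> U \<subseteq> V \<Longrightarrow> good V"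
  shows "\<exists>D \<phi>. min_graded_free_resolution n {f \<in> poly_ring n. \<forall>u\<in>Poly_Mapping.keys f. good (Poly_Mapping.keys u)} D (\<phi> :: nat \<Rightarrow> 'k mpoly mat) \<and>
     (\<forall>i j. count_list (D i) j = card {\<sigma>\<in>C. dm \<sigma> = i \<and> int (card (m \<sigma>)) = j})"
proof -
  let ?I = "{f \<in> poly_ring n. \<forall>u\<in>Poly_Mapping.keys f. good (Poly_Mapping.keys u)} :: 'k mpoly set"
  have cx: "complex_on dm a C" and deg: "\<And>\<sigma> \<tau>. \<sigma> \<in> C \<Longrightarrow> \<tau> \<in> C \<Longrightarrow> a \<sigma> \<tau> \<noteq> 0 \<Longrightarrow> m \<tau> \<subseteq> m \<sigma>"
    and orig: "base \<in> C" "m base = {}" "dm base = 0" "\<And>\<sigma>. \<sigma> \<in> C \<Longrightarrow> \<sigma> \<noteq> base \<Longrightarrow> dm \<sigma> \<noteq> 0 \<and> good (m \<sigma>)"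
    using res unfolding multigraded_resolution_def by blast+
  have finC: "finite C" by (rule complex_on_finite[OF cx])
  have finm: "finite (m \<sigma>)" if "\<sigma> \<in> C" for \<sigma> using mC[OF that] finite_subset by blast
  let ?C = "\<lambda>i. {\<sigma>. \<sigma> \<in> C \<and> dm \<sigma> = i}"
  have "\<exists>xs. set xs = ?C i \<and> distinct xs" for i using finite_distinct_list[of "?C i"] finC by auto
  then obtain cs where cs: "\<And>i. set (cs i) = ?C i" "\<And>i. distinct (cs i)" by metis
  have C0: "?C 0 = {base}"
  proof (intro Set.set_eqI iffI)
    fix \<sigma> assume "\<sigma> \<in> ?C 0"
    thus "\<sigma> \<in> {base}" using orig(4)[of \<sigma>] by auto
  qed (use orig in auto)
  have cs0: "cs 0 = [base]"
  proof -
    have s: "set (cs 0) = {base}" "distinct (cs 0)" using cs(1)[of 0] cs(2)[of 0] C0 by simp_all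
    hence "length (cs 0) = 1" using distinct_card[OF s(2)] by simp
    then obtain z where "cs 0 = [z]" by (auto simp: length_Suc_conv)
    thus ?thesis using s(1) by simp
  qed
  define r where "r = (\<lambda>i. length (cs i))"
  define D where "D = (\<lambda>i. map (\<lambda>\<sigma>. int (card (m \<sigma>))) (cs i))"
  have rD: "length (D i) = r i" for i by (simp add: D_def r_def)
  define e where "e = (\<lambda>i b c. entry m a (cs (i + 1) ! c) (cs i ! b))"
  define \<phi> where "\<phi> = (\<lambda>i. mat (r i) (r (i + 1)) (\<lambda>(b, c). e i b c))"
  have csC: "cs i ! b \<in> C" "dm (cs i ! b) = i" if "b < r i" for i b
    using nth_mem[of b "cs i"] that cs(1)[of i] by (auto simp: r_def)
  have bij: "bij_betw (\<lambda>b. cs i ! b) {..<r i} (?C i)" for i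
    using bij_betw_nth[OF cs(2) _ cs(1)[symmetric]] unfolding r_def by blast
  have sumC: "(\<Sum>c<r i. f (cs i ! c)) = (\<Sum>\<sigma>\<in>?C i. f \<sigma>)" for i and f :: "'c \<Rightarrow> 'k mpoly"
    by (rule sum.reindex_bij_betw[OF bij])
  \<comment> \<open>Passing from vectors indexed by positions to vectors indexed by cells.\<close>
  have lift: "\<exists>v'. \<forall>b<r i. v' (cs i ! b) = v b" for i and v :: "nat \<Rightarrow> 'k mpoly"
    using bij_betw_inv_into_left[OF bij[of i]]
    by (intro exI[of _ "\<lambda>\<sigma>. v (inv_into {..<r i} (\<lambda>b. cs i ! b) \<sigma>)"]) auto
  have surj: "\<exists>b<r i. \<sigma> = cs i ! b" if "\<sigma> \<in> ?C i" for i \<sigma>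
    using bij_betw_imp_surj_on[OF bij[of i]] that by blast
  have zero: "entry m a \<sigma> \<tau> = 0" if "\<sigma> \<in> C" "\<tau> \<in> C" "dm \<sigma> \<noteq> Suc (dm \<tau>)" for \<sigma> \<tau>
  proof -
    have "a \<sigma> \<tau> = 0" using complex_on_dim[OF cx that(1,2)] that(3) by blast
    thus ?thesis by (simp add: entry_def)
  qed
  have sq: "(\<Sum>\<sigma>\<in>?C (i + 1). entry m a \<sigma> \<tau> * entry m a \<rho> \<sigma>) = 0" if h: "\<tau> \<in> C" "\<rho> \<in> C" "dm \<rho> = i + 2" for i \<tau> \<rho>
  proof -
    have "(\<Sum>\<sigma>\<in>?C (i + 1). entry m a \<sigma> \<tau> * entry m a \<rho> \<sigma>) = (\<Sum>\<sigma>\<in>C. entry m a \<sigma> \<tau> * entry m a \<rho> \<sigma>)"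
    proof (rule sum.mono_neutral_left)
      show "\<forall>\<sigma>\<in>C - ?C (i + 1). entry m a \<sigma> \<tau> * entry m a \<rho> \<sigma> = 0"
      proof
        fix \<sigma> assume "\<sigma> \<in> C - ?C (i + 1)"
        hence "entry m a \<rho> \<sigma> = 0" by (intro zero[OF h(2)]) (use h(3) in auto)
        thus "entry m a \<sigma> \<tau> * entry m a \<rho> \<sigma> = 0" by simp
      qed
    qed (use finC in auto)
    also have "\<dots> = (\<Sum>\<sigma>\<in>C. Poly_Mapping.single (sq_mon (m \<rho> - m \<tau>)) (a \<rho> \<sigma> * a \<sigma> \<tau>))"
    proof (rule sum.cong[OF refl])
      fix \<sigma> assume "\<sigma> \<in> C"
      thus "entry m a \<sigma> \<tau> * entry m a \<rho> \<sigma> = Poly_Mapping.single (sq_mon (m \<rho> - m \<tau>)) (a \<rho> \<sigma> * a \<sigma> \<tau>)"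
        by (intro entry_entry deg[OF h(2)] deg[OF _ h(1)] finm[OF h(2)])
    qed
    also have "\<dots> = Poly_Mapping.single (sq_mon (m \<rho> - m \<tau>)) (\<Sum>\<sigma>\<in>C. a \<rho> \<sigma> * a \<sigma> \<tau>)"
      by (rule single_sum[symmetric])
    also have "\<dots> = 0" using complex_on_square[OF cx h(2) h(1)] by simp
    finally show ?thesis .
  qed
  have ering: "entry m a \<sigma> \<tau> \<in> poly_ring n" if "\<sigma> \<in> C" for \<sigma> \<tau>
    unfolding entry_def by (rule poly_ring_single) (use mC[OF that] finm[OF that] in \<open>auto simp: keys_sq_mon\<close>)
  have kernel: "kernel_is_image n r e i" for i
    unfolding kernel_is_image_def
  proof (intro allI impI iffI)
    fix v assume vR: "\<forall>c<r (i + 1). v c \<in> poly_ring n" and ker: "\<forall>b<r i. (\<Sum>c<r (i + 1). e i b c * v c) = 0"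
    obtain v' where v': "\<forall>b<r (i + 1). v' (cs (i + 1) ! b) = v b" using lift by blast
    have "\<exists>w. (\<forall>\<rho>. w \<rho> \<in> poly_ring n) \<and>
      (\<forall>\<sigma>\<in>C. dm \<sigma> = i + 1 \<longrightarrow> v' \<sigma> = (\<Sum>\<rho> | \<rho> \<in> C \<and> dm \<rho> = Suc (i + 1). entry m a \<rho> \<sigma> * w \<rho>))"
    proof (rule multigraded_lift[OF res mC up])
      fix \<sigma> assume "\<sigma> \<in> C" "dm \<sigma> = i + 1"
      then obtain b where "b < r (i + 1)" "\<sigma> = cs (i + 1) ! b" using surj[of \<sigma> "i + 1"] by blast
      thus "v' \<sigma> \<in> poly_ring n" using v' vR by simp
    next
      fix \<tau> assume \<tau>: "\<tau> \<in> C"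
      show "(\<Sum>\<sigma>\<in>?C (i + 1). entry m a \<sigma> \<tau> * v' \<sigma>) = 0"
      proof (cases "dm \<tau> = i")
        case True
        then obtain b where b: "b < r i" "\<tau> = cs i ! b" using surj[of \<tau> i] \<tau> by blast
        have "(\<Sum>c<r (i + 1). e i b c * v c) = (\<Sum>c<r (i + 1). entry m a (cs (i + 1) ! c) \<tau> * v' (cs (i + 1) ! c))"
          by (rule sum.cong) (use v' b in \<open>auto simp: e_def\<close>)
        thus ?thesis using ker b sumC[of "\<lambda>\<sigma>. entry m a \<sigma> \<tau> * v' \<sigma>" "i + 1"] by simp
      next
        case False
        thus ?thesis by (intro sum.neutral) (use zero[OF _ \<tau>] in auto)
      qed
    qed simp_all
    then obtain w where w: "\<forall>\<rho>. w \<rho> \<in> poly_ring n"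
      "\<forall>\<sigma>\<in>C. dm \<sigma> = i + 1 \<longrightarrow> v' \<sigma> = (\<Sum>\<rho>\<in>?C (i + 2). entry m a \<rho> \<sigma> * w \<rho>)" by auto
    have "v b = (\<Sum>c<r (i + 2). e (i + 1) b c * w (cs (i + 2) ! c))" if b: "b < r (i + 1)" for b
    proof -
      have "v b = v' (cs (i + 1) ! b)" using v' b by simp
      also have "\<dots> = (\<Sum>\<rho>\<in>?C (i + 2). entry m a \<rho> (cs (i + 1) ! b) * w \<rho>)"
        using w(2) csC[OF b] by blast
      also have "\<dots> = (\<Sum>c<r (i + 2). entry m a (cs (i + 2) ! c) (cs (i + 1) ! b) * w (cs (i + 2) ! c))"
        by (rule sumC[symmetric])
      finally show ?thesis by (simp add: e_def numeral_2_eq_2)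
    qed
    thus "\<exists>w. (\<forall>c<r (i + 2). w c \<in> poly_ring n) \<and> (\<forall>b<r (i + 1). v b = (\<Sum>c<r (i + 2). e (i + 1) b c * w c))"
      using w(1) by (intro exI[of _ "\<lambda>c. w (cs (i + 2) ! c)"]) auto
  next
    fix v b assume vR: "\<forall>c<r (i + 1). v c \<in> poly_ring n" and b: "b < r i"
      and "\<exists>w. (\<forall>c<r (i + 2). w c \<in> poly_ring n) \<and> (\<forall>b<r (i + 1). v b = (\<Sum>c<r (i + 2). e (i + 1) b c * w c))"
    then obtain w where w: "\<forall>c<r (i + 1). v c = (\<Sum>f<r (i + 2). e (i + 1) c f * w f)" by blast
    have "(\<Sum>c<r (i + 1). e i b c * v c) = (\<Sum>c<r (i + 1). \<Sum>f<r (i + 2). e i b c * (e (i + 1) c f * w f))"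
      by (rule sum.cong) (use w in \<open>auto simp: sum_distrib_left\<close>)
    also have "\<dots> = (\<Sum>f<r (i + 2). (\<Sum>c<r (i + 1). e i b c * e (i + 1) c f) * w f)"
      by (subst sum.swap) (simp add: sum_distrib_right mult.assoc)
    also have "\<dots> = 0"
    proof (rule sum.neutral, rule ballI)
      fix f assume "f \<in> {..<r (i + 2)}"
      hence f: "f < r (i + 2)" by simp
      have "(\<Sum>c<r (i + 1). e i b c * e (i + 1) c f)
          = (\<Sum>c<r (i + 1). entry m a (cs (i + 1) ! c) (cs i ! b) * entry m a (cs (i + 2) ! f) (cs (i + 1) ! c))"
        by (simp add: e_def numeral_2_eq_2)
      also have "\<dots> = (\<Sum>\<sigma>\<in>?C (i + 1). entry m a \<sigma> (cs i ! b) * entry m a (cs (i + 2) ! f) \<sigma>)" by (rule sumC)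
      also have "\<dots> = 0" by (rule sq) (use csC[OF b] csC[OF f] in auto)
      finally show "(\<Sum>c<r (i + 1). e i b c * e (i + 1) c f) * w f = 0" by simp
    qed
    finally show "(\<Sum>c<r (i + 1). e i b c * v c) = 0" .
  qed
  \<comment> \<open>The image of the first matrix is the ideal: again one monomial at a time, with \<open>i = 0\<close> in the lifting.\<close>
  have image: "{\<Sum>c<r 1. e 0 0 c * w c | w. \<forall>c<r 1. w c \<in> poly_ring n} = ?I"
  proof (intro Set.set_eqI iffI)
    fix f assume "f \<in> {\<Sum>c<r 1. e 0 0 c * w c | w. \<forall>c<r 1. w c \<in> poly_ring n}"
    then obtain w where w: "f = (\<Sum>c<r 1. e 0 0 c * w c)" "\<forall>c<r 1. w c \<in> poly_ring n" by blast
    have "f \<in> poly_ring n" unfolding w(1)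
      by (intro poly_ring_sum poly_ring_times) (use w(2) csC(1)[of _ 1] ering in \<open>auto simp: e_def\<close>)
    moreover have "good (Poly_Mapping.keys u)" if u: "u \<in> Poly_Mapping.keys f" for u
    proof -
      obtain c where c: "c < r 1" "u \<in> Poly_Mapping.keys (e 0 0 c * w c)"
        using u keys_sum[of "\<lambda>c. e 0 0 c * w c" "{..<r 1}"] unfolding w(1) by blast
      let ?\<sigma> = "cs 1 ! c"
      have \<sigma>: "?\<sigma> \<in> C" "dm ?\<sigma> = 1" using csC[OF c(1)] by auto
      obtain k1 k2 where k: "k1 \<in> Poly_Mapping.keys (e 0 0 c)" "u = k1 + k2"
        using c(2) keys_mult[of "e 0 0 c" "w c"] by blast
      have "k1 = sq_mon (m ?\<sigma>)" using k(1) cs0 orig(2) by (auto simp: e_def entry_def split: if_splits)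
      hence "m ?\<sigma> \<subseteq> Poly_Mapping.keys u" using k(2) finm[OF \<sigma>(1)] by (auto simp: keys_add_nat keys_sq_mon)
      moreover have "?\<sigma> \<noteq> base" using \<sigma> orig(3) by auto
      ultimately show ?thesis using orig(4)[OF \<sigma>(1)] up by blast
    qed
    ultimately show "f \<in> ?I" by blast
  next
    fix f assume f: "f \<in> ?I"
    have "\<exists>w. (\<forall>\<rho>. w \<rho> \<in> poly_ring n) \<and>
      (\<forall>\<sigma>\<in>C. dm \<sigma> = 0 \<longrightarrow> f = (\<Sum>\<rho> | \<rho> \<in> C \<and> dm \<rho> = Suc 0. entry m a \<rho> \<sigma> * w \<rho>))"
    proof (rule multigraded_lift[OF res mC up])
      fix \<tau> assume \<tau>: "\<tau> \<in> C"
      show "(\<Sum>\<sigma>\<in>?C 0. entry m a \<sigma> \<tau> * f) = 0"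
        by (intro sum.neutral) (use zero[OF _ \<tau>] in auto)
    qed (use f in auto)
    then obtain w where w: "\<forall>\<rho>. w \<rho> \<in> poly_ring n" "f = (\<Sum>\<rho>\<in>?C 1. entry m a \<rho> base * w \<rho>)"
      using orig(1,3) by auto
    have "f = (\<Sum>c<r 1. entry m a (cs 1 ! c) base * w (cs 1 ! c))" unfolding w(2) by (rule sumC[symmetric])
    also have "\<dots> = (\<Sum>c<r 1. e 0 0 c * w (cs 1 ! c))" by (simp add: e_def cs0)
    finally have "f = (\<Sum>c<r 1. e 0 0 c * w (cs 1 ! c))" .
    thus "f \<in> {\<Sum>c<r 1. e 0 0 c * w c | w. \<forall>c<r 1. w c \<in> poly_ring n}"
      using w(1) by (intro CollectI exI[of _ "\<lambda>c. w (cs 1 ! c)"]) simp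
  qed
  have \<phi>e: "\<phi> i $$ (b, c) = e i b c" if "b < r i" "c < r (i + 1)" for i b c
    using that by (simp add: \<phi>_def)
  have ent: "e i b c \<in> poly_ring n \<and> homogeneous_of_degree (D (i + 1) ! c - D i ! b) (e i b c) \<and> e i b c \<in> irrelevant_ideal n"
    if b: "b < r i" and c: "c < r (i + 1)" for i b c
  proof (cases "a (cs (i + 1) ! c) (cs i ! b) = 0")
    case True
    hence "e i b c = 0" by (simp add: e_def entry_def)
    moreover have "0 \<in> irrelevant_ideal n"
      unfolding irrelevant_ideal_def ideal_gen_def by (intro CollectI exI[of _ "{}"]) simp
    ultimately show ?thesis by (simp add: homogeneous_of_degree_def)
  next
    case False
    let ?\<sigma> = "cs (i + 1) ! c" and ?\<tau> = "cs i ! b"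
    have C: "?\<sigma> \<in> C" "?\<tau> \<in> C" using csC(1)[OF b] csC(1)[OF c] by auto
    have sub: "m ?\<tau> \<subseteq> m ?\<sigma>" by (rule deg[OF C False])
    have ne: "m ?\<sigma> \<noteq> m ?\<tau>" by (rule min[OF C False])
    have "card (m ?\<sigma> - m ?\<tau>) = card (m ?\<sigma>) - card (m ?\<tau>)" "card (m ?\<tau>) \<le> card (m ?\<sigma>)"
      using sub finm[OF C(1)] finm[OF C(2)] by (auto simp: card_Diff_subset card_mono)
    hence "int (card (m ?\<sigma> - m ?\<tau>)) = int (card (m ?\<sigma>)) - int (card (m ?\<tau>))" by simp
    moreover have "D (i + 1) ! c = int (card (m ?\<sigma>))" "D i ! b = int (card (m ?\<tau>))"
      using b c by (simp_all add: D_def r_def)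
    moreover have "mon_deg (sq_mon (m ?\<sigma> - m ?\<tau>)) = card (m ?\<sigma> - m ?\<tau>)"
      by (rule mon_deg_sq_mon) (use finm[OF C(1)] in simp)
    ultimately have "homogeneous_of_degree (D (i + 1) ! c - D i ! b) (e i b c)"
      by (simp add: homogeneous_of_degree_def e_def entry_def)
    moreover have "e i b c \<in> irrelevant_ideal n"
      unfolding e_def entry_def by (rule single_in_irrelevant_ideal) (use sub ne mC[OF C(1)] in auto)
    ultimately show ?thesis using ering[OF C(1)] by (simp add: e_def)
  qed
  have k\<phi>: "kernel_is_image n r (\<lambda>i b c. \<phi> i $$ (b, c)) i" for i
    using kernel[of i] kernel_is_image_cong[of r "\<lambda>i b c. \<phi> i $$ (b, c)" e n i] \<phi>e by blast
  have minres: "min_graded_free_resolution n ?I D \<phi>"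
    unfolding min_graded_free_resolution_iff rD
  proof (intro conjI allI impI)
    show "D 0 = [0]" using cs0 orig by (simp add: D_def)
    show "\<phi> i \<in> carrier_mat (r i) (r (i + 1))" for i by (simp add: \<phi>_def)
    have "r 0 = 1" by (simp add: r_def cs0)
    hence "{\<Sum>c<r 1. \<phi> 0 $$ (0, c) * w c | w. \<forall>c<r 1. w c \<in> poly_ring n} = {\<Sum>c<r 1. e 0 0 c * w c | w. \<forall>c<r 1. w c \<in> poly_ring n}"
      using \<phi>e[of 0 0] by simp
    thus "{\<Sum>c<r 1. \<phi> 0 $$ (0, c) * w c | w. \<forall>c<r 1. w c \<in> poly_ring n} = ?I" unfolding image .
    show "kernel_is_image n r (\<lambda>i b c. \<phi> i $$ (b, c)) i" for i by (rule k\<phi>)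
    fix i b c assume bc: "b < r i" "c < r (i + 1)"
    show "\<phi> i $$ (b, c) \<in> poly_ring n" "\<phi> i $$ (b, c) \<in> irrelevant_ideal n"
      "homogeneous_of_degree (D (i + 1) ! c - D i ! b) (\<phi> i $$ (b, c))"
      unfolding \<phi>e[OF bc] using ent[OF bc] by simp_all
  qed
  have count: "count_list (D i) j = card {\<sigma>\<in>C. dm \<sigma> = i \<and> int (card (m \<sigma>)) = j}" for i j
    unfolding D_def count_list_distinct_map[OF cs(2)] cs(1) by (simp add: conj_assoc)
  show ?thesis
    by (rule exI[of _ D], rule exI[of _ \<phi>], intro conjI allI, rule minres, rule count)
qed

section \<open>Homogeneous components and constant terms\<close>

lemma mon_deg_superset:
  assumes "finite A" "Poly_Mapping.keys m \<subseteq> A"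
  shows "mon_deg m = (\<Sum>i\<in>A. Poly_Mapping.lookup m i)"
  unfolding mon_deg_def by (rule sum.mono_neutral_left[OF assms]) (auto simp: in_keys_iff)

lemma mon_deg_add: "mon_deg (u + v) = mon_deg u + mon_deg v"
proof -
  let ?A = "Poly_Mapping.keys u \<union> Poly_Mapping.keys v"
  have "mon_deg (u + v) = (\<Sum>i\<in>?A. Poly_Mapping.lookup (u + v) i)"
    by (rule mon_deg_superset) (auto simp: keys_add_nat)
  also have "\<dots> = (\<Sum>i\<in>?A. Poly_Mapping.lookup u i) + (\<Sum>i\<in>?A. Poly_Mapping.lookup v i)"
    by (simp add: lookup_add sum.distrib)
  finally show ?thesis using mon_deg_superset[of ?A u] mon_deg_superset[of ?A v] by simp
qed

definition hom_component :: "int \<Rightarrow> 'k::field mpoly \<Rightarrow> 'k mpoly" where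
  "hom_component d f = (\<Sum>k | k \<in> Poly_Mapping.keys f \<and> int (mon_deg k) = d. Poly_Mapping.single k (Poly_Mapping.lookup f k))"

lemma lookup_hom_component:
  "Poly_Mapping.lookup (hom_component d f) x = (if int (mon_deg x) = d then Poly_Mapping.lookup f x else 0)"
proof -
  have "Poly_Mapping.lookup (hom_component d f) x
      = (\<Sum>k | k \<in> Poly_Mapping.keys f \<and> int (mon_deg k) = d. if k = x then Poly_Mapping.lookup f x else 0)"
    unfolding hom_component_def lookup_sum by (rule sum.cong) (auto simp: lookup_single when_def)
  also have "\<dots> = (if int (mon_deg x) = d then Poly_Mapping.lookup f x else 0)"
    by (simp add: sum.delta not_in_keys_iff_lookup_eq_zero)
  finally show ?thesis .
qed

lemma homogeneous_hom_component: "homogeneous_of_degree d (hom_component d f)"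
  by (auto simp: homogeneous_of_degree_def in_keys_iff lookup_hom_component split: if_splits)

lemma hom_component_homogeneous: "homogeneous_of_degree d f \<Longrightarrow> hom_component d f = f"
  by (rule poly_mapping_eqI) (auto simp: homogeneous_of_degree_def lookup_hom_component in_keys_iff)

lemma hom_component_ring: "f \<in> poly_ring n \<Longrightarrow> hom_component d f \<in> poly_ring n"
  by (auto simp: poly_ring_def in_keys_iff lookup_hom_component split: if_splits)

lemma hom_component_sum: "hom_component d (\<Sum>x\<in>A. f x) = (\<Sum>x\<in>A. hom_component d (f x))"
  by (rule poly_mapping_eqI) (simp add: lookup_hom_component lookup_sum)

text \<open>
  Used to replace an arbitrary preimage of a homogeneous vector by a homogeneous one.
\<close>

lemma hom_component_times:
  assumes "homogeneous_of_degree d g"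
  shows "hom_component (d + d') (g * f) = g * hom_component d' f"
proof -
  have single: "hom_component (d + d') (Poly_Mapping.single x c * f) = Poly_Mapping.single x c * hom_component d' f"
    if x: "int (mon_deg x) = d" for x c
  proof (rule poly_mapping_eqI)
    fix w
    show "Poly_Mapping.lookup (hom_component (d + d') (Poly_Mapping.single x c * f)) w
        = Poly_Mapping.lookup (Poly_Mapping.single x c * hom_component d' f) w"
    proof (cases "\<exists>k. w = x + k")
      case True
      then obtain k where k: "w = x + k" by blast
      have "int (mon_deg w) = d + d' \<longleftrightarrow> int (mon_deg k) = d'" using x by (simp add: k mon_deg_add)
      thus ?thesis unfolding lookup_hom_component k lookup_single_times_add by (simp add: k)
    next
      case False
      hence "\<And>k. x + k \<noteq> w" by blast
      thus ?thesis by (simp add: lookup_hom_component lookup_single_times_none)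
    qed
  qed
  have "hom_component (d + d') (g * f)
      = hom_component (d + d') (\<Sum>x\<in>Poly_Mapping.keys g. Poly_Mapping.single x (Poly_Mapping.lookup g x) * f)"
    unfolding sum_distrib_right[symmetric] poly_mapping_eq_sum_single[of g, symmetric] ..
  also have "\<dots> = (\<Sum>x\<in>Poly_Mapping.keys g. Poly_Mapping.single x (Poly_Mapping.lookup g x) * hom_component d' f)"
    unfolding hom_component_sum
    by (rule sum.cong[OF refl], rule single) (use assms in \<open>simp add: homogeneous_of_degree_def\<close>)
  also have "\<dots> = g * hom_component d' f"
    unfolding sum_distrib_right[symmetric] poly_mapping_eq_sum_single[of g, symmetric] ..
  finally show ?thesis .
qed

lemma homogeneous_times:
  assumes "homogeneous_of_degree d f" "homogeneous_of_degree d' g"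
  shows "homogeneous_of_degree (d + d') (f * g)"
  using homogeneous_hom_component[of "d + d'" "f * g"]
  unfolding hom_component_times[OF assms(1)] hom_component_homogeneous[OF assms(2)] .

lemma homogeneous_sum:
  assumes "\<And>x. x \<in> A \<Longrightarrow> homogeneous_of_degree d (f x)"
  shows "homogeneous_of_degree d (\<Sum>x\<in>A. f x)"
proof -
  have "hom_component d (\<Sum>x\<in>A. f x) = (\<Sum>x\<in>A. f x)"
    unfolding hom_component_sum by (rule sum.cong) (auto simp: hom_component_homogeneous assms)
  thus ?thesis using homogeneous_hom_component[of d "\<Sum>x\<in>A. f x"] by simp
qed

definition const_coeff :: "'k::field mpoly \<Rightarrow> 'k" where
  "const_coeff f = Poly_Mapping.lookup f 0"

lemma const_coeff_zero [simp]: "const_coeff 0 = 0"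
  by (simp add: const_coeff_def)

lemma const_coeff_one [simp]: "const_coeff 1 = 1"
  by (simp add: const_coeff_def)

lemma const_coeff_add: "const_coeff (f + g) = const_coeff f + const_coeff g"
  by (simp add: const_coeff_def lookup_add)

lemma const_coeff_diff: "const_coeff (f - g) = const_coeff f - const_coeff g"
  by (simp add: const_coeff_def lookup_minus)

lemma const_coeff_sum: "const_coeff (\<Sum>x\<in>A. f x) = (\<Sum>x\<in>A. const_coeff (f x))"
  by (simp add: const_coeff_def lookup_sum)

lemma const_coeff_times: "const_coeff (f * g) = const_coeff f * const_coeff g"
proof -
  have z: "x + k = 0 \<longleftrightarrow> x = 0 \<and> k = 0" for x k :: "nat \<Rightarrow>\<^sub>0 nat"
    by (auto simp: poly_mapping_eq_iff fun_eq_iff lookup_add)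
  have single: "const_coeff (Poly_Mapping.single x c * g) = (if x = 0 then c * const_coeff g else 0)" for x c
  proof (cases "x = 0")
    case True
    have "Poly_Mapping.lookup (Poly_Mapping.single 0 c * g) (0 + 0) = c * Poly_Mapping.lookup g 0"
      by (rule lookup_single_times_add)
    thus ?thesis using True by (simp add: const_coeff_def)
  next
    case False
    thus ?thesis unfolding const_coeff_def by (simp add: lookup_single_times_none z)
  qed
  have "const_coeff (f * g) = const_coeff (\<Sum>x\<in>Poly_Mapping.keys f. Poly_Mapping.single x (Poly_Mapping.lookup f x) * g)"
    unfolding sum_distrib_right[symmetric] poly_mapping_eq_sum_single[of f, symmetric] ..
  also have "\<dots> = (\<Sum>x\<in>Poly_Mapping.keys f. if x = 0 then Poly_Mapping.lookup f 0 * const_coeff g else 0)"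
    unfolding const_coeff_sum single by (rule sum.cong) auto
  also have "\<dots> = const_coeff f * const_coeff g"
    by (simp add: sum.delta const_coeff_def not_in_keys_iff_lookup_eq_zero)
  finally show ?thesis .
qed

lemma const_coeff_homogeneous:
  assumes "homogeneous_of_degree d f" "const_coeff f \<noteq> 0"
  shows "d = 0"
proof -
  have "0 \<in> Poly_Mapping.keys f" using assms(2) by (simp add: const_coeff_def in_keys_iff)
  hence "int (mon_deg 0) = d" using assms(1) unfolding homogeneous_of_degree_def by blast
  thus ?thesis by (simp add: mon_deg_def)
qed

lemma const_coeff_irrelevant_ideal:
  assumes "f \<in> irrelevant_ideal n"
  shows "const_coeff f = 0"
proof -
  obtain T c where f: "f = (\<Sum>g\<in>T. c g * g)" and T: "T \<subseteq> var ` {1..n}"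
    using assms unfolding irrelevant_ideal_def ideal_gen_def by blast
  have "const_coeff (var i :: 'a mpoly) = 0" for i
  proof -
    have "Poly_Mapping.single i (1::nat) \<noteq> 0"
    proof
      assume "Poly_Mapping.single i (1::nat) = 0"
      from arg_cong[OF this, of "\<lambda>m. Poly_Mapping.lookup m i"] show False by simp
    qed
    thus ?thesis by (simp add: const_coeff_def var_def lookup_single when_def)
  qed
  hence "const_coeff g = 0" if "g \<in> T" for g using that T by auto
  thus ?thesis unfolding f const_coeff_sum const_coeff_times by simp
qed

section \<open>Comparison of resolutions\<close>

text \<open>
  Matrix multiplication with an explicit inner dimension \<open>k\<close>; associativity then holds without any
  condition on the outer dimensions.
\<close>

definition mp :: "nat \<Rightarrow> (nat \<Rightarrow> nat \<Rightarrow> 'r::comm_ring_1) \<Rightarrow> (nat \<Rightarrow> nat \<Rightarrow> 'r) \<Rightarrow> nat \<Rightarrow> nat \<Rightarrow> 'r" where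
  "mp k A B = (\<lambda>i j. \<Sum>l<k. A i l * B l j)"

lemma mp_assoc: "mp k A (mp l B C) = mp l (mp k A B) C"
proof (intro ext)
  fix i j
  have "mp k A (mp l B C) i j = (\<Sum>x<k. \<Sum>y<l. A i x * B x y * C y j)"
    by (simp add: mp_def sum_distrib_left mult.assoc)
  also have "\<dots> = (\<Sum>y<l. \<Sum>x<k. A i x * B x y * C y j)" by (rule sum.swap)
  also have "\<dots> = mp l (mp k A B) C i j" by (simp add: mp_def sum_distrib_right)
  finally show "mp k A (mp l B C) i j = mp l (mp k A B) C i j" .
qed

lemma mp_cong:
  assumes "\<And>l. l < k \<Longrightarrow> A i l = A' i l" "\<And>l. l < k \<Longrightarrow> B l j = B' l j"
  shows "mp k A B i j = mp k A' B' i j"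
  unfolding mp_def by (rule sum.cong) (use assms in auto)

lemma mp_diff_right: "mp k A (\<lambda>i j. B i j - C i j) i j = mp k A B i j - mp k A C i j"
  by (simp add: mp_def right_diff_distrib sum_subtractf)

lemma mp_diff_left: "mp k (\<lambda>i j. A i j - B i j) C i j = mp k A C i j - mp k B C i j"
  by (simp add: mp_def left_diff_distrib sum_subtractf)

lemma mp_zero_right: "(\<And>l. l < k \<Longrightarrow> B l j = 0) \<Longrightarrow> mp k A B i j = 0"
  by (simp add: mp_def)

lemma mp_id_left: "i < k \<Longrightarrow> mp k (\<lambda>i j. if i = j then 1 else 0) B i j = B i j"
  by (simp add: mp_def if_distrib[of "\<lambda>x. x * _"] cong: if_cong)

lemma mp_id_right: "j < k \<Longrightarrow> mp k A (\<lambda>i j. if i = j then 1 else 0) i j = A i j"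
  by (simp add: mp_def if_distrib[of "\<lambda>x. _ * x"] cong: if_cong)

definition in_ring :: "nat \<Rightarrow> nat \<Rightarrow> nat \<Rightarrow> (nat \<Rightarrow> nat \<Rightarrow> 'k::field mpoly) \<Rightarrow> bool" where
  "in_ring n p q A \<longleftrightarrow> (\<forall>b<p. \<forall>a<q. A b a \<in> poly_ring n)"

definition graded_matrix :: "nat \<Rightarrow> (nat \<Rightarrow> int) \<Rightarrow> nat \<Rightarrow> (nat \<Rightarrow> int) \<Rightarrow> (nat \<Rightarrow> nat \<Rightarrow> 'k::field mpoly) \<Rightarrow> bool" where
  "graded_matrix p \<delta>' q \<delta> A \<longleftrightarrow> (\<forall>b<p. \<forall>a<q. homogeneous_of_degree (\<delta> a - \<delta>' b) (A b a))"

lemma in_ring_mp: "in_ring n p k A \<Longrightarrow> in_ring n k q B \<Longrightarrow> in_ring n p q (mp k A B)"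
  unfolding in_ring_def mp_def by (auto intro!: poly_ring_sum poly_ring_times)

lemma graded_matrix_mp:
  assumes "graded_matrix p \<delta>'' k \<delta>' A" "graded_matrix k \<delta>' q \<delta> B"
  shows "graded_matrix p \<delta>'' q \<delta> (mp k A B)"
  unfolding graded_matrix_def mp_def
proof (intro allI impI homogeneous_sum)
  fix b a l assume "b < p" "a < q" "l \<in> {..<k}"
  hence "homogeneous_of_degree ((\<delta>' l - \<delta>'' b) + (\<delta> a - \<delta>' l)) (A b l * B l a)"
    using assms unfolding graded_matrix_def by (intro homogeneous_times) auto
  thus "homogeneous_of_degree (\<delta> a - \<delta>'' b) (A b l * B l a)" by simp
qed

text \<open>Being a cycle of \<open>F\<^sub>i\<close>; for \<open>i = 0\<close> the ideal is the kernel of the augmentation \<open>R \<rightarrow> R/I\<close>.\<close>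

definition cycles :: "'k::field mpoly set \<Rightarrow> (nat \<Rightarrow> nat) \<Rightarrow> (nat \<Rightarrow> nat \<Rightarrow> nat \<Rightarrow> 'k mpoly) \<Rightarrow> nat \<Rightarrow> nat \<Rightarrow> (nat \<Rightarrow> nat \<Rightarrow> 'k mpoly) \<Rightarrow> bool" where
  "cycles I r e i q V \<longleftrightarrow> (case i of 0 \<Rightarrow> \<forall>a<q. V 0 a \<in> I | Suc k \<Rightarrow> \<forall>b<r k. \<forall>a<q. mp (r i) (e k) V b a = 0)"

lemma cycles_0: "cycles I r e 0 q V \<longleftrightarrow> (\<forall>a<q. V 0 a \<in> I)"
  by (simp add: cycles_def)

lemma cycles_Suc: "cycles I r e (Suc k) q V \<longleftrightarrow> (\<forall>b<r k. \<forall>a<q. mp (r (Suc k)) (e k) V b a = 0)"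
  by (simp add: cycles_def)

text \<open>
  A minimal resolution seen through its matrices.  Minimality enters only through the vanishing of the
  constant terms, and \<open>V\<close> collects several vectors as columns.
\<close>

definition graded_res :: "nat \<Rightarrow> 'k::field mpoly set \<Rightarrow> (nat \<Rightarrow> nat) \<Rightarrow> (nat \<Rightarrow> nat \<Rightarrow> int) \<Rightarrow> (nat \<Rightarrow> nat \<Rightarrow> nat \<Rightarrow> 'k mpoly) \<Rightarrow> bool" where
  "graded_res n I r \<delta> e \<longleftrightarrow> r 0 = 1 \<and> \<delta> 0 0 = 0 \<and>
     (\<forall>i. in_ring n (r i) (r (Suc i)) (e i) \<and> graded_matrix (r i) (\<delta> i) (r (Suc i)) (\<delta> (Suc i)) (e i) \<and>
        (\<forall>b<r i. \<forall>a<r (Suc i). const_coeff (e i b a) = 0)) \<and>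
     (\<forall>i q V. in_ring n (r i) q V \<longrightarrow> (cycles I r e i q V \<longleftrightarrow>
        (\<exists>W. in_ring n (r (Suc i)) q W \<and> (\<forall>b<r i. \<forall>a<q. V b a = mp (r (Suc i)) (e i) W b a))))"

lemma graded_resD:
  assumes "graded_res n I r \<delta> e"
  shows "r 0 = 1" "\<delta> 0 0 = 0" "in_ring n (r i) (r (Suc i)) (e i)"
    "graded_matrix (r i) (\<delta> i) (r (Suc i)) (\<delta> (Suc i)) (e i)"
    "b < r i \<Longrightarrow> a < r (Suc i) \<Longrightarrow> const_coeff (e i b a) = 0"
    "in_ring n (r i) q V \<Longrightarrow> cycles I r e i q V \<Longrightarrow>
       \<exists>W. in_ring n (r (Suc i)) q W \<and> (\<forall>b<r i. \<forall>a<q. V b a = mp (r (Suc i)) (e i) W b a)"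
    "in_ring n (r i) q V \<Longrightarrow> in_ring n (r (Suc i)) q W \<Longrightarrow> (\<And>b a. b < r i \<Longrightarrow> a < q \<Longrightarrow> V b a = mp (r (Suc i)) (e i) W b a) \<Longrightarrow>
       cycles I r e i q V"
  using assms unfolding graded_res_def by blast+

lemma graded_res_of_resolution:
  fixes \<phi> :: "nat \<Rightarrow> 'k::field mpoly mat" and D :: "nat \<Rightarrow> int list"
  assumes "min_graded_free_resolution n I D \<phi>"
  shows "graded_res n I (\<lambda>i. length (D i)) (\<lambda>i a. D i ! a) (\<lambda>i b a. \<phi> i $$ (b, a))"
proof -
  let ?r = "\<lambda>i. length (D i)" and ?e = "\<lambda>i b a. \<phi> i $$ (b, a)"
  have D0: "D 0 = [0]" and ent: "\<forall>i. \<forall>b<?r i. \<forall>a<?r (i + 1). ?e i b a \<in> poly_ring n \<and>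
        homogeneous_of_degree (D (i + 1) ! a - D i ! b) (?e i b a) \<and> ?e i b a \<in> irrelevant_ideal n"
    and img: "{\<Sum>a<?r 1. ?e 0 0 a * w a | w. \<forall>a<?r 1. w a \<in> poly_ring n} = I"
    and ker: "\<forall>i. kernel_is_image n ?r ?e i"
    using assms unfolding min_graded_free_resolution_iff by - (elim conjE, assumption)+
  have vec: "cycles I ?r ?e i 1 (\<lambda>b _. v b) \<longleftrightarrow>
      (\<exists>w. (\<forall>c<?r (Suc i). w c \<in> poly_ring n) \<and> (\<forall>b<?r i. v b = (\<Sum>c<?r (Suc i). ?e i b c * w c)))"
    if v: "\<forall>b<?r i. v b \<in> poly_ring n" for i v
  proof (cases i)
    case 0
    have "cycles I ?r ?e i 1 (\<lambda>b _. v b) \<longleftrightarrow> v 0 \<in> {\<Sum>a<?r 1. ?e 0 0 a * w a | w. \<forall>a<?r 1. w a \<in> poly_ring n}"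
      unfolding 0 cycles_0 img by simp
    thus ?thesis using 0 D0 by auto
  next
    case (Suc k)
    have "(\<forall>b<?r k. (\<Sum>a<?r (k + 1). ?e k b a * v a) = 0) \<longleftrightarrow>
      (\<exists>w. (\<forall>c<?r (k + 2). w c \<in> poly_ring n) \<and> (\<forall>a<?r (k + 1). v a = (\<Sum>c<?r (k + 2). ?e (k + 1) a c * w c)))"
      using ker[rule_format, of k] v Suc unfolding kernel_is_image_def by simp
    thus ?thesis unfolding Suc cycles_Suc mp_def by (simp add: numeral_2_eq_2)
  qed
  have cols: "cycles I ?r ?e i q V \<longleftrightarrow> (\<forall>a<q. cycles I ?r ?e i 1 (\<lambda>b _. V b a))" for i q V
    by (cases i) (auto simp: cycles_0 cycles_Suc mp_def)
  have "cycles I ?r ?e i q V \<longleftrightarrow>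
        (\<exists>W. in_ring n (?r (Suc i)) q W \<and> (\<forall>b<?r i. \<forall>a<q. V b a = mp (?r (Suc i)) (?e i) W b a))"
    if V: "in_ring n (?r i) q V" for i q V
  proof -
    have "cycles I ?r ?e i q V \<longleftrightarrow> (\<forall>a<q. \<exists>w. (\<forall>c<?r (Suc i). w c \<in> poly_ring n) \<and>
        (\<forall>b<?r i. V b a = (\<Sum>c<?r (Suc i). ?e i b c * w c)))"
      unfolding cols[of i q V]
    proof (intro all_cong)
      fix a assume "a < q"
      hence "\<forall>b<?r i. V b a \<in> poly_ring n" using V by (simp add: in_ring_def)
      thus "cycles I ?r ?e i 1 (\<lambda>b _. V b a) \<longleftrightarrow> (\<exists>w. (\<forall>c<?r (Suc i). w c \<in> poly_ring n) \<and>
        (\<forall>b<?r i. V b a = (\<Sum>c<?r (Suc i). ?e i b c * w c)))" by (rule vec)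
    qed
    also have "\<dots> \<longleftrightarrow> (\<exists>w. \<forall>a<q. (\<forall>c<?r (Suc i). w a c \<in> poly_ring n) \<and>
        (\<forall>b<?r i. V b a = (\<Sum>c<?r (Suc i). ?e i b c * w a c)))"
    proof
      assume h: "\<forall>a<q. \<exists>w. (\<forall>c<?r (Suc i). w c \<in> poly_ring n) \<and> (\<forall>b<?r i. V b a = (\<Sum>c<?r (Suc i). ?e i b c * w c))"
      hence "\<forall>a. \<exists>w. a < q \<longrightarrow> (\<forall>c<?r (Suc i). w c \<in> poly_ring n) \<and> (\<forall>b<?r i. V b a = (\<Sum>c<?r (Suc i). ?e i b c * w c))"
        by blast
      thus "\<exists>w. \<forall>a<q. (\<forall>c<?r (Suc i). w a c \<in> poly_ring n) \<and> (\<forall>b<?r i. V b a = (\<Sum>c<?r (Suc i). ?e i b c * w a c))"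
        by (rule choice)
    next
      assume "\<exists>w. \<forall>a<q. (\<forall>c<?r (Suc i). w a c \<in> poly_ring n) \<and> (\<forall>b<?r i. V b a = (\<Sum>c<?r (Suc i). ?e i b c * w a c))"
      then obtain w where "\<forall>a<q. (\<forall>c<?r (Suc i). w a c \<in> poly_ring n) \<and> (\<forall>b<?r i. V b a = (\<Sum>c<?r (Suc i). ?e i b c * w a c))" ..
      thus "\<forall>a<q. \<exists>w. (\<forall>c<?r (Suc i). w c \<in> poly_ring n) \<and> (\<forall>b<?r i. V b a = (\<Sum>c<?r (Suc i). ?e i b c * w c))" by blast
    qed
    also have "\<dots> \<longleftrightarrow> (\<exists>W. in_ring n (?r (Suc i)) q W \<and> (\<forall>b<?r i. \<forall>a<q. V b a = mp (?r (Suc i)) (?e i) W b a))"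
    proof
      assume "\<exists>w. \<forall>a<q. (\<forall>c<?r (Suc i). w a c \<in> poly_ring n) \<and> (\<forall>b<?r i. V b a = (\<Sum>c<?r (Suc i). ?e i b c * w a c))"
      then obtain w where "\<forall>a<q. (\<forall>c<?r (Suc i). w a c \<in> poly_ring n) \<and> (\<forall>b<?r i. V b a = (\<Sum>c<?r (Suc i). ?e i b c * w a c))" ..
      thus "\<exists>W. in_ring n (?r (Suc i)) q W \<and> (\<forall>b<?r i. \<forall>a<q. V b a = mp (?r (Suc i)) (?e i) W b a)"
        by (intro exI[of _ "\<lambda>c a. w a c"]) (simp add: in_ring_def mp_def)
    next
      assume "\<exists>W. in_ring n (?r (Suc i)) q W \<and> (\<forall>b<?r i. \<forall>a<q. V b a = mp (?r (Suc i)) (?e i) W b a)"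
      then obtain W where "in_ring n (?r (Suc i)) q W \<and> (\<forall>b<?r i. \<forall>a<q. V b a = mp (?r (Suc i)) (?e i) W b a)" ..
      thus "\<exists>w. \<forall>a<q. (\<forall>c<?r (Suc i). w a c \<in> poly_ring n) \<and> (\<forall>b<?r i. V b a = (\<Sum>c<?r (Suc i). ?e i b c * w a c))"
        by (intro exI[of _ "\<lambda>a c. W c a"]) (simp add: in_ring_def mp_def)
    qed
    finally show ?thesis .
  qed
  moreover have "in_ring n (?r i) (?r (Suc i)) (?e i) \<and> graded_matrix (?r i) (\<lambda>a. D i ! a) (?r (Suc i)) (\<lambda>a. D (Suc i) ! a) (?e i) \<and>
        (\<forall>b<?r i. \<forall>a<?r (Suc i). const_coeff (?e i b a) = 0)" for i
    using ent[rule_format, of _ i] const_coeff_irrelevant_ideal unfolding in_ring_def graded_matrix_def by auto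
  ultimately show ?thesis unfolding graded_res_def using D0 by simp
qed

lemma graded_res_square:
  assumes res: "graded_res n I r \<delta> e" and "b < r i" "a < r (Suc (Suc i))"
  shows "mp (r (Suc i)) (e i) (e (Suc i)) b a = 0"
proof -
  have "cycles I r e (Suc i) (r (Suc (Suc i))) (e (Suc i))"
  proof (rule graded_resD(7)[OF res])
    show "in_ring n (r (Suc i)) (r (Suc (Suc i))) (e (Suc i))" by (rule graded_resD(3)[OF res])
    show "in_ring n (r (Suc (Suc i))) (r (Suc (Suc i))) (\<lambda>b a. if b = a then 1 else 0)" by (simp add: in_ring_def)
    show "e (Suc i) b a = mp (r (Suc (Suc i))) (e (Suc i)) (\<lambda>b a. if b = a then 1 else 0) b a"
      if "b < r (Suc i)" "a < r (Suc (Suc i))" for b a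
      by (rule mp_id_right[OF that(2), symmetric])
  qed
  thus ?thesis using assms unfolding cycles_Suc by blast
qed

text \<open>
  Taking homogeneous components of any preimage keeps it a preimage, because the matrix is graded.
\<close>

lemma graded_lift:
  assumes res: "graded_res n I r \<delta> e" and V: "in_ring n (r i) q V" "graded_matrix (r i) (\<delta> i) q s V"
    and cyc: "cycles I r e i q V"
  shows "\<exists>W. in_ring n (r (Suc i)) q W \<and> graded_matrix (r (Suc i)) (\<delta> (Suc i)) q s W \<and>
    (\<forall>b<r i. \<forall>a<q. V b a = mp (r (Suc i)) (e i) W b a)"
proof -
  obtain W where W: "in_ring n (r (Suc i)) q W" "\<forall>b<r i. \<forall>a<q. V b a = mp (r (Suc i)) (e i) W b a"
    using graded_resD(6)[OF res V(1) cyc] by blast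
  define W' where "W' = (\<lambda>c a. hom_component (s a - \<delta> (Suc i) c) (W c a))"
  have "V b a = mp (r (Suc i)) (e i) W' b a" if b: "b < r i" and a: "a < q" for b a
  proof -
    have "V b a = hom_component (s a - \<delta> i b) (mp (r (Suc i)) (e i) W b a)"
      using V(2) W(2) a b hom_component_homogeneous[of "s a - \<delta> i b" "V b a"] unfolding graded_matrix_def by simp
    also have "\<dots> = (\<Sum>c<r (Suc i). e i b c * W' c a)"
      unfolding mp_def hom_component_sum
    proof (rule sum.cong[OF refl])
      fix c assume "c \<in> {..<r (Suc i)}"
      hence "homogeneous_of_degree (\<delta> (Suc i) c - \<delta> i b) (e i b c)"
        using graded_resD(4)[OF res, of i] b unfolding graded_matrix_def by blast
      hence "hom_component ((\<delta> (Suc i) c - \<delta> i b) + (s a - \<delta> (Suc i) c)) (e i b c * W c a) = e i b c * W' c a"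
        unfolding W'_def by (rule hom_component_times)
      thus "hom_component (s a - \<delta> i b) (e i b c * W c a) = e i b c * W' c a" by simp
    qed
    finally show ?thesis by (simp add: mp_def)
  qed
  moreover have "in_ring n (r (Suc i)) q W'" using W(1) unfolding in_ring_def W'_def by (simp add: hom_component_ring)
  moreover have "graded_matrix (r (Suc i)) (\<delta> (Suc i)) q s W'"
    unfolding graded_matrix_def W'_def by (simp add: homogeneous_hom_component)
  ultimately show ?thesis by blast
qed

text \<open>The comparison map over the identity of \<open>R/I\<close>, built degree by degree.\<close>

lemma comparison_map:
  fixes e e' :: "nat \<Rightarrow> nat \<Rightarrow> nat \<Rightarrow> 'k::field mpoly"
  assumes res: "graded_res n I r \<delta> e" and res': "graded_res n I r' \<delta>' e'"
  shows "\<exists>f. f 0 0 0 = 1 \<and> (\<forall>i. in_ring n (r' i) (r i) (f i) \<and> graded_matrix (r' i) (\<delta>' i) (r i) (\<delta> i) (f i) \<and>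
     (\<forall>b<r' i. \<forall>a<r (Suc i). mp (r' (Suc i)) (e' i) (f (Suc i)) b a = mp (r i) (f i) (e i) b a))"
proof -
  let ?P = "\<lambda>i (F :: nat \<Rightarrow> nat \<Rightarrow> 'k mpoly). in_ring n (r' i) (r i) F \<and> graded_matrix (r' i) (\<delta>' i) (r i) (\<delta> i) F \<and>
    (i = 0 \<longrightarrow> F 0 0 = 1) \<and>
    (\<forall>q V. in_ring n (r i) q V \<longrightarrow> cycles I r e i q V \<longrightarrow> cycles I r' e' i q (mp (r i) F V))"
  let ?Q = "\<lambda>i F F'. \<forall>b<r' i. \<forall>a<r (Suc i). mp (r' (Suc i)) (e' i) F' b a = mp (r i) F (e i) b a"
  have "\<exists>f. \<forall>i. ?P i (f i) \<and> ?Q i (f i) (f (Suc i))"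
  proof (rule dependent_nat_choice)
    show "\<exists>F. ?P 0 F"
    proof (intro exI conjI allI impI)
      let ?F = "\<lambda>_ _. 1 :: 'k mpoly"
      show "in_ring n (r' 0) (r 0) ?F" by (simp add: in_ring_def)
      show "graded_matrix (r' 0) (\<delta>' 0) (r 0) (\<delta> 0) ?F"
        using graded_resD(1,2)[OF res] graded_resD(1,2)[OF res']
        by (simp add: graded_matrix_def homogeneous_of_degree_def mon_deg_def)
      show "cycles I r' e' 0 q (mp (r 0) ?F V)" if "cycles I r e 0 q V" for q V
        using that graded_resD(1)[OF res] by (simp add: cycles_0 mp_def)
    qed simp
  next
    fix F i assume P: "?P i F"
    have Fe: "in_ring n (r' i) (r (Suc i)) (mp (r i) F (e i))" "graded_matrix (r' i) (\<delta>' i) (r (Suc i)) (\<delta> (Suc i)) (mp (r i) F (e i))"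
      using P graded_resD(3,4)[OF res, of i] by (blast intro: in_ring_mp graded_matrix_mp)+
    have "cycles I r e i (r (Suc i)) (e i)"
    proof (rule graded_resD(7)[OF res])
      show "in_ring n (r (Suc i)) (r (Suc i)) (\<lambda>b a. if b = a then 1 else 0)" by (simp add: in_ring_def)
      show "e i b a = mp (r (Suc i)) (e i) (\<lambda>b a. if b = a then 1 else 0) b a"
        if "b < r i" "a < r (Suc i)" for b a
        by (rule mp_id_right[OF that(2), symmetric])
    qed (rule graded_resD(3)[OF res])
    hence "cycles I r' e' i (r (Suc i)) (mp (r i) F (e i))"
      using P graded_resD(3)[OF res, of i] by blast
    from graded_lift[OF res' Fe this] obtain F' where
      F': "in_ring n (r' (Suc i)) (r (Suc i)) F'" "graded_matrix (r' (Suc i)) (\<delta>' (Suc i)) (r (Suc i)) (\<delta> (Suc i)) F'"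
      and eq: "\<forall>b<r' i. \<forall>a<r (Suc i). mp (r i) F (e i) b a = mp (r' (Suc i)) (e' i) F' b a" by blast
    have "cycles I r' e' (Suc i) q (mp (r (Suc i)) F' V)" if V: "cycles I r e (Suc i) q V" for q V
      unfolding cycles_Suc
    proof (intro allI impI)
      fix b a assume ba: "b < r' i" "a < q"
      have "mp (r' (Suc i)) (e' i) (mp (r (Suc i)) F' V) b a = mp (r (Suc i)) (mp (r' (Suc i)) (e' i) F') V b a"
        by (simp add: mp_assoc)
      also have "\<dots> = mp (r (Suc i)) (mp (r i) F (e i)) V b a" by (rule mp_cong) (use eq ba in auto)
      also have "\<dots> = mp (r i) F (mp (r (Suc i)) (e i) V) b a" by (simp add: mp_assoc)
      also have "\<dots> = 0" by (rule mp_zero_right) (use V ba in \<open>simp add: cycles_Suc\<close>)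
      finally show "mp (r' (Suc i)) (e' i) (mp (r (Suc i)) F' V) b a = 0" .
    qed
    hence "?P (Suc i) F'" using F' by simp
    moreover have "?Q i F F'" using eq by simp
    ultimately show "\<exists>F'. ?P (Suc i) F' \<and> ?Q i F F'" by blast
  qed
  then obtain f where f: "\<forall>i. ?P i (f i) \<and> ?Q i (f i) (f (Suc i))" ..
  show ?thesis
  proof (rule exI[of _ f], rule conjI)
    show "f 0 0 0 = 1" using f by blast
    show "\<forall>i. in_ring n (r' i) (r i) (f i) \<and> graded_matrix (r' i) (\<delta>' i) (r i) (\<delta> i) (f i) \<and>
      (\<forall>b<r' i. \<forall>a<r (Suc i). mp (r' (Suc i)) (e' i) (f (Suc i)) b a = mp (r i) (f i) (e i) b a)"
      using f by blast
  qed
qed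

text \<open>
  A chain map over the zero map of \<open>R/I\<close> is null-homotopic, and the terms of a null-homotopy
  involve the matrices of the resolution, so minimality makes its constant terms vanish.
\<close>

lemma null_homotopic_const_coeff:
  fixes e :: "nat \<Rightarrow> nat \<Rightarrow> nat \<Rightarrow> 'k::field mpoly"
  assumes res: "graded_res n I r \<delta> e" and h0: "h 0 0 0 = 0" and hR: "\<And>i. in_ring n (r i) (r i) (h i)"
    and chain: "\<And>i b a. b < r i \<Longrightarrow> a < r (Suc i) \<Longrightarrow> mp (r (Suc i)) (e i) (h (Suc i)) b a = mp (r i) (h i) (e i) b a"
  shows "\<forall>b<r i. \<forall>a<r i. const_coeff (h i b a) = 0"
proof -
  \<comment> \<open>The homotopy \<open>s\<close> is built along the induction; the map \<open>h i - e i s\<close> kills the image of \<open>e i\<close>.\<close>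
  have "(\<forall>b<r i. \<forall>a<r i. const_coeff (h i b a) = 0) \<and>
    (\<exists>s. in_ring n (r (Suc i)) (r i) s \<and>
      (\<forall>b<r i. \<forall>a<r (Suc i). mp (r i) (\<lambda>b a. h i b a - mp (r (Suc i)) (e i) s b a) (e i) b a = 0))"
  proof (induction i)
    case 0
    have r0: "r 0 = 1" by (rule graded_resD(1)[OF res])
    have "in_ring n (r (Suc 0)) (r 0) (\<lambda>_ _. 0)" by (simp add: in_ring_def)
    moreover have "mp (r 0) (\<lambda>b a. h 0 b a - mp (r (Suc 0)) (e 0) (\<lambda>_ _. 0) b a) (e 0) b a = 0" if "b < r 0" for b a
      using that r0 h0 by (simp add: mp_def)
    ultimately show ?case using r0 h0 by auto
  next
    case (Suc i)
    then obtain s where s: "in_ring n (r (Suc i)) (r i) s"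
      "\<forall>b<r i. \<forall>a<r (Suc i). mp (r i) (\<lambda>b a. h i b a - mp (r (Suc i)) (e i) s b a) (e i) b a = 0" by blast
    let ?V = "\<lambda>b a. h (Suc i) b a - mp (r i) s (e i) b a"
    have se: "in_ring n (r (Suc i)) (r (Suc i)) (mp (r i) s (e i))"
      by (rule in_ring_mp[OF s(1) graded_resD(3)[OF res]])
    have VR: "in_ring n (r (Suc i)) (r (Suc i)) ?V"
      using se hR[of "Suc i"] unfolding in_ring_def by (auto intro: poly_ring_diff)
    have "cycles I r e (Suc i) (r (Suc i)) ?V"
      unfolding cycles_Suc
    proof (intro allI impI)
      fix b a assume ba: "b < r i" "a < r (Suc i)"
      have "mp (r (Suc i)) (e i) ?V b a = mp (r (Suc i)) (e i) (h (Suc i)) b a - mp (r (Suc i)) (e i) (mp (r i) s (e i)) b a"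
        by (rule mp_diff_right)
      also have "\<dots> = mp (r i) (h i) (e i) b a - mp (r i) (mp (r (Suc i)) (e i) s) (e i) b a"
        unfolding chain[OF ba] mp_assoc ..
      also have "\<dots> = mp (r i) (\<lambda>b a. h i b a - mp (r (Suc i)) (e i) s b a) (e i) b a"
        by (rule mp_diff_left[symmetric])
      also have "\<dots> = 0" using s(2) ba by blast
      finally show "mp (r (Suc i)) (e i) ?V b a = 0" .
    qed
    then obtain s' where s': "in_ring n (r (Suc (Suc i))) (r (Suc i)) s'"
      and eq: "\<forall>b<r (Suc i). \<forall>a<r (Suc i). ?V b a = mp (r (Suc (Suc i))) (e (Suc i)) s' b a"
      using graded_resD(6)[OF res VR] by blast
    have "const_coeff (h (Suc i) b a) = 0" if ba: "b < r (Suc i)" "a < r (Suc i)" for b a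
    proof -
      have "h (Suc i) b a = mp (r (Suc (Suc i))) (e (Suc i)) s' b a + mp (r i) s (e i) b a"
        using eq ba by (simp add: algebra_simps)
      moreover have "const_coeff (mp (r (Suc (Suc i))) (e (Suc i)) s' b a) = 0"
        unfolding mp_def const_coeff_sum const_coeff_times
        by (rule sum.neutral) (use graded_resD(5)[OF res] ba in auto)
      moreover have "const_coeff (mp (r i) s (e i) b a) = 0"
        unfolding mp_def const_coeff_sum const_coeff_times
        by (rule sum.neutral) (use graded_resD(5)[OF res] ba in auto)
      ultimately show ?thesis by (simp add: const_coeff_add)
    qed
    moreover have "mp (r (Suc i)) (\<lambda>b a. h (Suc i) b a - mp (r (Suc (Suc i))) (e (Suc i)) s' b a) (e (Suc i)) b a = 0"
      if ba: "b < r (Suc i)" "a < r (Suc (Suc i))" for b a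
    proof -
      have "mp (r (Suc i)) (\<lambda>b a. h (Suc i) b a - mp (r (Suc (Suc i))) (e (Suc i)) s' b a) (e (Suc i)) b a
          = mp (r (Suc i)) (mp (r i) s (e i)) (e (Suc i)) b a"
      proof (rule mp_cong)
        fix l assume "l < r (Suc i)"
        hence "?V b l = mp (r (Suc (Suc i))) (e (Suc i)) s' b l" using eq ba by blast
        thus "h (Suc i) b l - mp (r (Suc (Suc i))) (e (Suc i)) s' b l = mp (r i) s (e i) b l" by (simp add: algebra_simps)
      qed simp
      also have "\<dots> = mp (r i) s (mp (r (Suc i)) (e i) (e (Suc i))) b a" by (simp add: mp_assoc)
      also have "\<dots> = 0" by (rule mp_zero_right) (rule graded_res_square[OF res _ ba(2)])
      finally show ?thesis .
    qed
    ultimately show ?case using s' by blast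
  qed
  thus ?thesis by blast
qed

section \<open>Uniqueness of graded Betti numbers\<close>

text \<open>
  Gaussian elimination: solve one equation for one unknown and recurse.
\<close>

lemma underdetermined_system:
  fixes P :: "'b \<Rightarrow> 'a \<Rightarrow> 'k::field"
  assumes "finite B" "finite A" "card B < card A"
  shows "\<exists>x. (\<exists>a\<in>A. x a \<noteq> 0) \<and> (\<forall>b\<in>B. (\<Sum>a\<in>A. P b a * x a) = 0)"
  using assms
proof (induction B arbitrary: A P rule: finite_induct)
  case empty
  then obtain a where "a \<in> A" by fastforce
  thus ?case by (intro exI[of _ "\<lambda>_. 1"]) auto
next
  case (insert b0 B)
  show ?case
  proof (cases "\<forall>a\<in>A. P b0 a = 0")
    case True
    have "card B < card A" using insert by simp
    then obtain x where "\<exists>a\<in>A. x a \<noteq> 0" "\<forall>b\<in>B. (\<Sum>a\<in>A. P b a * x a) = 0"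
      using insert.IH[OF insert.prems(1), of P] by blast
    thus ?thesis using True by (intro exI[of _ x]) auto
  next
    case False
    then obtain a0 where a0: "a0 \<in> A" "P b0 a0 \<noteq> 0" by blast
    let ?A = "A - {a0}"
    have "card B < card ?A" using insert a0 by simp
    then obtain x where x: "\<exists>a\<in>?A. x a \<noteq> 0"
      "\<forall>b\<in>B. (\<Sum>a\<in>?A. (P b a - P b a0 * (P b0 a / P b0 a0)) * x a) = 0"
      using insert.IH[of ?A "\<lambda>b a. P b a - P b a0 * (P b0 a / P b0 a0)"] insert.prems by blast
    define t where "t = (\<Sum>a\<in>?A. P b0 a * x a) / P b0 a0"
    define y where "y = (\<lambda>a. if a = a0 then - t else x a)"
    have sum: "(\<Sum>a\<in>A. P b a * y a) = (\<Sum>a\<in>?A. P b a * x a) - P b a0 * t" for b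
    proof -
      have "(\<Sum>a\<in>A. P b a * y a) = P b a0 * y a0 + (\<Sum>a\<in>?A. P b a * y a)"
        by (rule sum.remove[OF insert.prems(1) a0(1)])
      also have "(\<Sum>a\<in>?A. P b a * y a) = (\<Sum>a\<in>?A. P b a * x a)" by (rule sum.cong) (auto simp: y_def)
      finally show ?thesis by (simp add: y_def)
    qed
    have "(\<Sum>a\<in>A. P b a * y a) = 0" if b: "b \<in> insert b0 B" for b
    proof (cases "b = b0")
      case True thus ?thesis unfolding sum using a0 by (simp add: t_def)
    next
      case False
      have "(\<Sum>a\<in>?A. (P b a - P b a0 * (P b0 a / P b0 a0)) * x a)
          = (\<Sum>a\<in>?A. P b a * x a) - P b a0 * t"
        unfolding t_def sum_divide_distrib sum_distrib_left sum_subtractf[symmetric]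
        by (rule sum.cong) (auto simp: left_diff_distrib)
      thus ?thesis unfolding sum using x(2) b False by simp
    qed
    moreover have "\<exists>a\<in>A. y a \<noteq> 0" using x(1) by (auto simp: y_def)
    ultimately show ?thesis by blast
  qed
qed

lemma card_le_of_left_inverse:
  fixes P :: "'b \<Rightarrow> 'a \<Rightarrow> 'k::field" and Q :: "'a \<Rightarrow> 'b \<Rightarrow> 'k"
  assumes fin: "finite A" "finite B" and QP: "\<And>a a'. a \<in> A \<Longrightarrow> a' \<in> A \<Longrightarrow> (\<Sum>b\<in>B. Q a' b * P b a) = (if a' = a then 1 else 0)"
  shows "card A \<le> card B"
proof (rule ccontr)
  assume "\<not> card A \<le> card B"
  then obtain x a' where x: "a' \<in> A" "x a' \<noteq> 0" "\<forall>b\<in>B. (\<Sum>a\<in>A. P b a * x a) = 0"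
    using underdetermined_system[OF fin(2,1), of P] by auto
  have "x a' = (\<Sum>a\<in>A. (if a' = a then 1 else 0) * x a)" using fin x(1) by (simp add: if_distrib[of "\<lambda>z. z * _"] cong: if_cong)
  also have "\<dots> = (\<Sum>a\<in>A. (\<Sum>b\<in>B. Q a' b * P b a) * x a)" by (rule sum.cong) (use QP x in auto)
  also have "\<dots> = (\<Sum>b\<in>B. Q a' b * (\<Sum>a\<in>A. P b a * x a))"
    unfolding sum_distrib_left sum_distrib_right by (subst sum.swap) (simp add: mult.assoc)
  also have "\<dots> = 0" using x(3) by simp
  finally show False using x(2) by simp
qed

text \<open>
  The comparison maps \<open>f\<close> and \<open>g\<close> satisfy \<open>g f = 1\<close> on constant terms.  As \<open>f\<close> is homogeneous, its
  constant terms connect basis elements of equal degree only, so \<open>f\<close> has a left inverse in each degree.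
\<close>

lemma graded_res_card_le:
  fixes e e' :: "nat \<Rightarrow> nat \<Rightarrow> nat \<Rightarrow> 'k::field mpoly"
  assumes res: "graded_res n I r \<delta> e" and res': "graded_res n I r' \<delta>' e'"
  shows "card {a. a < r i \<and> \<delta> i a = j} \<le> card {b. b < r' i \<and> \<delta>' i b = j}"
proof -
  obtain f where f0: "f 0 0 0 = 1" and fR: "\<And>i. in_ring n (r' i) (r i) (f i)"
    and fg: "\<And>i. graded_matrix (r' i) (\<delta>' i) (r i) (\<delta> i) (f i)"
    and fc: "\<And>i b a. b < r' i \<Longrightarrow> a < r (Suc i) \<Longrightarrow> mp (r' (Suc i)) (e' i) (f (Suc i)) b a = mp (r i) (f i) (e i) b a"
    using comparison_map[OF res res'] by blast
  obtain g where g0: "g 0 0 0 = 1" and gR: "\<And>i. in_ring n (r i) (r' i) (g i)"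
    and gc: "\<And>i b a. b < r i \<Longrightarrow> a < r' (Suc i) \<Longrightarrow> mp (r (Suc i)) (e i) (g (Suc i)) b a = mp (r' i) (g i) (e' i) b a"
    using comparison_map[OF res' res] by blast
  \<comment> \<open>The chain map \<open>g f - 1\<close> lies over the zero map of \<open>R/I\<close>.\<close>
  define h where "h = (\<lambda>i b a. mp (r' i) (g i) (f i) b a - (if b = a then 1 else 0))"
  have r0: "r 0 = 1" "r' 0 = 1" using graded_resD(1)[OF res] graded_resD(1)[OF res'] by auto
  have hz: "\<forall>b<r i. \<forall>a<r i. const_coeff (h i b a) = 0"
  proof (rule null_homotopic_const_coeff[OF res])
    show "h 0 0 0 = 0" using f0 g0 r0 by (simp add: h_def mp_def)
    show "in_ring n (r i) (r i) (h i)" for i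
      using in_ring_mp[OF gR fR, of i] unfolding in_ring_def h_def by (auto intro!: poly_ring_diff)
    show "mp (r (Suc i)) (e i) (h (Suc i)) b a = mp (r i) (h i) (e i) b a" if ba: "b < r i" "a < r (Suc i)" for i b a
    proof -
      have "mp (r (Suc i)) (e i) (mp (r' (Suc i)) (g (Suc i)) (f (Suc i))) b a
          = mp (r' (Suc i)) (mp (r (Suc i)) (e i) (g (Suc i))) (f (Suc i)) b a" by (simp add: mp_assoc)
      also have "\<dots> = mp (r' (Suc i)) (mp (r' i) (g i) (e' i)) (f (Suc i)) b a"
        by (rule mp_cong) (use gc ba in auto)
      also have "\<dots> = mp (r' i) (g i) (mp (r' (Suc i)) (e' i) (f (Suc i))) b a" by (simp add: mp_assoc)
      also have "\<dots> = mp (r' i) (g i) (mp (r i) (f i) (e i)) b a" by (rule mp_cong) (use fc ba in auto)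
      also have "\<dots> = mp (r i) (mp (r' i) (g i) (f i)) (e i) b a" by (simp add: mp_assoc)
      finally have gf: "mp (r (Suc i)) (e i) (mp (r' (Suc i)) (g (Suc i)) (f (Suc i))) b a = mp (r i) (mp (r' i) (g i) (f i)) (e i) b a" .
      show ?thesis unfolding h_def mp_diff_right mp_diff_left gf mp_id_right[OF ba(2)] mp_id_left[OF ba(1)] ..
    qed
  qed
  show ?thesis
  proof (rule card_le_of_left_inverse[where P = "\<lambda>b a. const_coeff (f i b a)" and Q = "\<lambda>a b. const_coeff (g i a b)"])
    fix a a' assume a: "a \<in> {a. a < r i \<and> \<delta> i a = j}" "a' \<in> {a. a < r i \<and> \<delta> i a = j}"
    have "(\<Sum>b | b < r' i \<and> \<delta>' i b = j. const_coeff (g i a' b) * const_coeff (f i b a))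
        = (\<Sum>b<r' i. const_coeff (g i a' b) * const_coeff (f i b a))"
    proof (rule sum.mono_neutral_left)
      show "\<forall>b\<in>{..<r' i} - {b. b < r' i \<and> \<delta>' i b = j}. const_coeff (g i a' b) * const_coeff (f i b a) = 0"
      proof
        fix b assume b: "b \<in> {..<r' i} - {b. b < r' i \<and> \<delta>' i b = j}"
        have "homogeneous_of_degree (\<delta> i a - \<delta>' i b) (f i b a)"
          using fg[of i] a b unfolding graded_matrix_def by auto
        moreover have "\<delta> i a - \<delta>' i b \<noteq> 0" using a b by auto
        ultimately have "const_coeff (f i b a) = 0" using const_coeff_homogeneous by blast
        thus "const_coeff (g i a' b) * const_coeff (f i b a) = 0" by simp
      qed
    qed auto
    also have "\<dots> = const_coeff (mp (r' i) (g i) (f i) a' a)"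
      by (simp add: mp_def const_coeff_sum const_coeff_times)
    also have "\<dots> = const_coeff (if a' = a then 1 else 0 :: 'k mpoly)"
      using hz a by (auto simp: h_def const_coeff_diff)
    finally show "(\<Sum>b | b < r' i \<and> \<delta>' i b = j. const_coeff (g i a' b) * const_coeff (f i b a)) = (if a' = a then 1 else 0)"
      by simp
  qed auto
qed

text \<open>
  The definite description in the definition of the Betti numbers is justified by comparing any two minimal
  resolutions in both directions.
\<close>

theorem graded_betti_eqI:
  fixes I :: "'k::field mpoly set"
  assumes "min_graded_free_resolution n I D \<phi>"
  shows "graded_betti n I i j = count_list (D i) j"
proof -
  have cnt: "count_list xs j = card {a. a < length xs \<and> xs ! a = j}" for xs :: "int list"
    by (simp add: count_list_eq_length_filter length_filter_conv_card eq_commute)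
  have "count_list (D' i) j = count_list (D i) j" if "min_graded_free_resolution n I D' \<phi>'" for D' \<phi>'
    unfolding cnt
    using graded_res_card_le[OF graded_res_of_resolution[OF assms] graded_res_of_resolution[OF that], of i j]
      graded_res_card_le[OF graded_res_of_resolution[OF that] graded_res_of_resolution[OF assms], of i j]
    by (rule le_antisym[rotated])
  thus ?thesis unfolding graded_betti_def using assms by (intro the_equality) blast+
qed

section \<open>The path ideal of the cycle\<close>

text \<open>
  For the nontrivial inclusion, every monomial of \<open>f\<close> is divided by one of the generators below it, and
  the quotients with the same generator are collected.
\<close>

lemma ideal_gen_monomials:
  fixes Us :: "nat set set"
  assumes Us: "\<And>U. U \<in> Us \<Longrightarrow> U \<subseteq> {1..n}"
  shows "ideal_gen n ((\<lambda>U. Poly_Mapping.single (sq_mon U) (1 :: 'k::field)) ` Us)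
    = {f \<in> poly_ring n. \<forall>u\<in>Poly_Mapping.keys f. \<exists>U\<in>Us. U \<subseteq> Poly_Mapping.keys u}"
    (is "ideal_gen n ?S = ?I")
proof (intro Set.set_eqI iffI)
  have fin: "finite U" if "U \<in> Us" for U by (rule finite_subset[OF Us[OF that]]) simp
  fix f :: "'k mpoly" assume "f \<in> ideal_gen n ?S"
  then obtain T c where f: "f = (\<Sum>g\<in>T. c g * g)" and T: "T \<subseteq> ?S" "\<forall>g\<in>T. c g \<in> poly_ring n"
    unfolding ideal_gen_def by blast
  have "g \<in> poly_ring n" if "g \<in> T" for g
  proof -
    obtain U where U: "U \<in> Us" "g = Poly_Mapping.single (sq_mon U) 1" using \<open>g \<in> T\<close> T by blast
    show ?thesis unfolding U(2) by (rule poly_ring_single) (use Us[OF U(1)] fin[OF U(1)] in \<open>simp add: keys_sq_mon\<close>)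
  qed
  hence "f \<in> poly_ring n" unfolding f using T by (intro poly_ring_sum poly_ring_times) auto
  moreover have "\<exists>U\<in>Us. U \<subseteq> Poly_Mapping.keys u" if u: "u \<in> Poly_Mapping.keys f" for u
  proof -
    obtain g where g: "g \<in> T" "u \<in> Poly_Mapping.keys (c g * g)"
      using u keys_sum[of "\<lambda>g. c g * g" T] unfolding f by blast
    obtain U where U: "U \<in> Us" "g = Poly_Mapping.single (sq_mon U) 1" using g(1) T by blast
    obtain x y where "y \<in> Poly_Mapping.keys g" "u = x + y" using g(2) keys_mult[of "c g" g] by blast
    hence "U \<subseteq> Poly_Mapping.keys u" using fin[OF U(1)] by (auto simp: U(2) keys_add_nat keys_sq_mon)
    thus ?thesis using U(1) by blast
  qed
  ultimately show "f \<in> ?I" by blast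
next
  have fin: "finite U" if "U \<in> Us" for U by (rule finite_subset[OF Us[OF that]]) simp
  fix f :: "'k mpoly" assume f: "f \<in> ?I"
  hence "\<forall>u. \<exists>U. u \<in> Poly_Mapping.keys f \<longrightarrow> U \<in> Us \<and> U \<subseteq> Poly_Mapping.keys u" by blast
  hence "\<exists>V. \<forall>u. u \<in> Poly_Mapping.keys f \<longrightarrow> V u \<in> Us \<and> V u \<subseteq> Poly_Mapping.keys u" by (rule choice)
  then obtain V where V: "\<And>u. u \<in> Poly_Mapping.keys f \<Longrightarrow> V u \<in> Us" "\<And>u. u \<in> Poly_Mapping.keys f \<Longrightarrow> V u \<subseteq> Poly_Mapping.keys u"
    by blast
  define G where "G = (\<lambda>u. Poly_Mapping.single (sq_mon (V u)) (1 :: 'k))"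
  define c where "c = (\<lambda>g. \<Sum>u | u \<in> Poly_Mapping.keys f \<and> G u = g. Poly_Mapping.single (u - sq_mon (V u)) (Poly_Mapping.lookup f u))"
  have "f = (\<Sum>u\<in>Poly_Mapping.keys f. Poly_Mapping.single u (Poly_Mapping.lookup f u))" by (rule poly_mapping_eq_sum_single)
  also have "\<dots> = (\<Sum>u\<in>Poly_Mapping.keys f. Poly_Mapping.single (u - sq_mon (V u)) (Poly_Mapping.lookup f u) * G u)"
  proof (rule sum.cong[OF refl])
    fix u assume u: "u \<in> Poly_Mapping.keys f"
    have "u - sq_mon (V u) + sq_mon (V u) = u"
      using sq_mon_add_diff[OF fin[OF V(1)[OF u]] V(2)[OF u]] by (simp add: add.commute)
    thus "Poly_Mapping.single u (Poly_Mapping.lookup f u) = Poly_Mapping.single (u - sq_mon (V u)) (Poly_Mapping.lookup f u) * G u"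
      by (simp add: G_def mult_single)
  qed
  also have "\<dots> = (\<Sum>g\<in>G ` Poly_Mapping.keys f. \<Sum>u | u \<in> Poly_Mapping.keys f \<and> G u = g. Poly_Mapping.single (u - sq_mon (V u)) (Poly_Mapping.lookup f u) * G u)"
    by (rule sum.image_gen) simp
  also have "\<dots> = (\<Sum>g\<in>G ` Poly_Mapping.keys f. c g * g)"
    unfolding c_def sum_distrib_right by (intro sum.cong refl) auto
  finally have fs: "f = (\<Sum>g\<in>G ` Poly_Mapping.keys f. c g * g)" .
  have cR: "c g \<in> poly_ring n" for g
    unfolding c_def
  proof (intro poly_ring_sum poly_ring_single)
    fix u assume "u \<in> {u. u \<in> Poly_Mapping.keys f \<and> G u = g}"
    hence "Poly_Mapping.keys u \<subseteq> {1..n}" using f by (auto simp: poly_ring_def)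
    thus "Poly_Mapping.keys (u - sq_mon (V u)) \<subseteq> {1..n}" using keys_diff_nat by blast
  qed
  have sub: "G ` Poly_Mapping.keys f \<subseteq> ?S" using V(1) by (auto simp: G_def)
  show "f \<in> ideal_gen n ?S"
    unfolding ideal_gen_def
    by (rule CollectI, rule exI[of _ "G ` Poly_Mapping.keys f"], rule exI[of _ c]) (use fs cR sub in simp)
qed

lemma prod_list_var: "distinct xs \<Longrightarrow> prod_list (map var xs) = Poly_Mapping.single (sq_mon (set xs)) (1 :: 'k::field)"
proof (induction xs)
  case Nil
  show ?case by (simp add: single_one)
next
  case (Cons x xs)
  have "sq_mon (set (x # xs)) = Poly_Mapping.single x 1 + sq_mon (set xs)"
    using Cons.prems by (simp add: sq_mon_def)
  thus ?case using Cons by (simp add: var_def mult_single)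
qed

text \<open>
  For \<open>n = 2\<close> both alternatives describe the single edge.
\<close>

lemma cycle_edge_iff:
  assumes n: "2 \<le> n" and xy: "x < n" "y < n"
  shows "{Suc x, Suc y} \<in> cycle_edges n \<longleftrightarrow> y = Suc x mod n \<or> x = Suc y mod n"
proof
  assume "{Suc x, Suc y} \<in> cycle_edges n"
  then consider i where "1 \<le> i" "i < n" "{Suc x, Suc y} = {i, i + 1}" | "{Suc x, Suc y} = {n, 1}"
    unfolding cycle_edges_def by blast
  thus "y = Suc x mod n \<or> x = Suc y mod n"
  proof cases
    case 1 thus ?thesis by (auto simp: doubleton_eq_iff)
  next
    case 2 thus ?thesis by (auto simp: doubleton_eq_iff)
  qed
next
  have one: "{Suc x, Suc (Suc x mod n)} \<in> cycle_edges n" if "x < n" for x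
  proof (cases "Suc x = n")
    case True thus ?thesis unfolding cycle_edges_def by simp
  next
    case False
    hence "Suc x < n" using that by simp
    thus ?thesis unfolding cycle_edges_def by auto
  qed
  assume "y = Suc x mod n \<or> x = Suc y mod n"
  thus "{Suc x, Suc y} \<in> cycle_edges n" using one[OF xy(1)] one[OF xy(2)] by (auto simp: insert_commute)
qed

text \<open>
  As its vertices are distinct, a path cannot turn back; so it keeps the direction of its first step and runs
  along an arc.
\<close>

lemma path_vertices_arc:
  assumes n: "2 \<le> n" and t: "1 \<le> t" and path: "is_path n (cycle_edges n) xs" "length xs = t"
  shows "\<exists>s<n. set xs = Suc ` arc n t s"
proof -
  have sub: "set xs \<subseteq> {1..n}" and dist: "distinct xs" and adj: "\<And>k. k + 1 < t \<Longrightarrow> {xs ! k, xs ! (k + 1)} \<in> cycle_edges n"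
    using path by (auto simp: is_path_def)
  \<comment> \<open>Vertices shifted to \<open>0, \<dots>, n - 1\<close>.\<close>
  define y where "y = (\<lambda>k. xs ! k - 1)"
  have xy: "xs ! k = Suc (y k)" "y k < n" if k: "k < t" for k
  proof -
    have "xs ! k \<in> {1..n}" using sub nth_mem[of k xs] k path(2) by blast
    thus "xs ! k = Suc (y k)" "y k < n" by (auto simp: y_def)
  qed
  have inj: "y k = y l \<longleftrightarrow> k = l" if "k < t" "l < t" for k l
    using xy[OF that(1)] xy[OF that(2)] dist that path(2) by (metis nth_eq_iff_index_eq)
  have Suc_inj: "u = v" if "u < n" "v < n" "Suc u mod n = Suc v mod n" for u v
    using that by (auto simp: mod_Suc split: if_splits)
  have step: "y (Suc k) = Suc (y k) mod n \<or> y k = Suc (y (Suc k)) mod n" if "Suc k < t" for k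
    using adj[of k] xy[of k] xy[of "Suc k"] that cycle_edge_iff[OF n] by simp
  have keep_up: "y (Suc (Suc k)) = Suc (y (Suc k)) mod n" if "Suc (Suc k) < t" "y (Suc k) = Suc (y k) mod n" for k
  proof (rule ccontr)
    assume "\<not> ?thesis"
    hence "Suc (y k) mod n = Suc (y (Suc (Suc k))) mod n" using step[OF that(1)] that(2) by simp
    hence "y k = y (Suc (Suc k))" by (rule Suc_inj[rotated 2]) (use xy(2) that(1) in simp_all)
    thus False using inj[of k "Suc (Suc k)"] that by simp
  qed
  have keep_down: "y (Suc k) = Suc (y (Suc (Suc k))) mod n" if "Suc (Suc k) < t" "y k = Suc (y (Suc k)) mod n" for k
  proof (rule ccontr)
    assume "\<not> ?thesis"
    hence "y k = y (Suc (Suc k))" using step[OF that(1)] that(2) by simp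
    thus False using inj[of k "Suc (Suc k)"] that by simp
  qed
  have set: "set xs = Suc ` y ` {..<t}"
  proof -
    have "set xs = (\<lambda>k. xs ! k) ` {..<t}" using path(2) by (auto simp: set_conv_nth)
    also have "\<dots> = (\<lambda>k. Suc (y k)) ` {..<t}" by (rule image_cong) (use xy in auto)
    finally show ?thesis by (simp add: image_image)
  qed
  consider "\<forall>k. Suc k < t \<longrightarrow> y (Suc k) = Suc (y k) mod n" | "\<forall>k. Suc k < t \<longrightarrow> y k = Suc (y (Suc k)) mod n"
  proof (cases "1 < t")
    case False
    thus ?thesis using that(1) by simp
  next
    case True
    from step[of 0] True have "y 1 = Suc (y 0) mod n \<or> y 0 = Suc (y 1) mod n" by simp
    thus ?thesis
    proof
      assume up: "y 1 = Suc (y 0) mod n"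
      have "y (Suc k) = Suc (y k) mod n" if "Suc k < t" for k
        using that by (induction k) (use up keep_up in auto)
      thus ?thesis using that(1) by blast
    next
      assume down: "y 0 = Suc (y 1) mod n"
      have "y k = Suc (y (Suc k)) mod n" if "Suc k < t" for k
        using that by (induction k) (use down keep_down in auto)
      thus ?thesis using that(2) by blast
    qed
  qed
  thus ?thesis
  proof cases
    case 1
    have fwd: "y k = (y 0 + k) mod n" if "k < t" for k
      using that
    proof (induction k)
      case 0 thus ?case using xy(2)[of 0] by simp
    next
      case (Suc k)
      hence "y (Suc k) = Suc ((y 0 + k) mod n) mod n" using 1 by simp
      thus ?case by (simp add: mod_Suc_eq)
    qed
    have "y ` {..<t} = arc n t (y 0)"
      unfolding arc_def by (rule image_cong[OF refl]) (simp add: fwd[symmetric])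
    moreover have "y 0 < n" using xy t by simp
    ultimately show ?thesis using set by auto
  next
    case 2
    \<comment> \<open>The arc starts at the last vertex of a descending path.\<close>
    define s where "s = y (t - 1)"
    have rev: "y (t - 1 - k) = (s + k) mod n" if "k < t" for k
      using that
    proof (induction k)
      case 0 thus ?case using xy(2)[of "t - 1"] by (simp add: s_def)
    next
      case (Suc k)
      have e: "Suc (t - 1 - Suc k) = t - 1 - k" using Suc.prems by simp
      have "y (t - 1 - Suc k) = Suc (y (Suc (t - 1 - Suc k))) mod n"
        using 2[rule_format, of "t - 1 - Suc k"] e Suc.prems by simp
      also have "\<dots> = Suc ((s + k) mod n) mod n" unfolding e using Suc by simp
      finally show ?case by (simp add: mod_Suc_eq)
    qed
    have "y ` {..<t} = arc n t s"
    proof (intro Set.set_eqI iffI)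
      fix v assume "v \<in> y ` {..<t}"
      then obtain k where k: "k < t" "v = y k" by blast
      hence "v = (s + (t - 1 - k)) mod n" using rev[of "t - 1 - k"] by simp
      moreover have "t - 1 - k < t" using k by simp
      ultimately show "v \<in> arc n t s" unfolding arc_def by blast
    next
      fix v assume "v \<in> arc n t s"
      then obtain k where k: "k < t" "v = (s + k) mod n" unfolding arc_def by blast
      hence "v = y (t - 1 - k)" using rev[of k] by simp
      moreover have "t - 1 - k < t" using k by simp
      ultimately show "v \<in> y ` {..<t}" by blast
    qed
    moreover have "s < n" using xy t by (simp add: s_def)
    ultimately show ?thesis using set by auto
  qed
qed

lemma arc_is_path:
  assumes n: "2 \<le> n" and t: "t \<le> n" and s: "s < n"
  shows "\<exists>xs. is_path n (cycle_edges n) xs \<and> length xs = t \<and> set xs = Suc ` arc n t s"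
proof -
  let ?xs = "map (\<lambda>u. Suc ((s + u) mod n)) [0..<t]"
  have "inj_on (\<lambda>u. Suc ((s + u) mod n)) {0..<t}"
  proof (rule inj_onI)
    fix u v assume uv: "u \<in> {0..<t}" "v \<in> {0..<t}" "Suc ((s + u) mod n) = Suc ((s + v) mod n)"
    have m: "(s + w) mod n = (if s + w < n then s + w else s + w - n)" if "w < n" for w
      using that s by (simp add: mod_if)
    show "u = v" using uv t m[of u] m[of v] s by (auto split: if_splits)
  qed
  hence "distinct ?xs" by (simp add: distinct_map)
  moreover have "set ?xs = Suc ` arc n t s" unfolding arc_def by (auto simp: image_image)
  moreover have "set ?xs \<subseteq> {1..n}" using n by (auto simp: Suc_le_eq)
  moreover have "{?xs ! k, ?xs ! (k + 1)} \<in> cycle_edges n" if "k + 1 < length ?xs" for k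
  proof -
    have "(s + Suc k) mod n = Suc ((s + k) mod n) mod n" by (simp add: mod_Suc_eq)
    thus ?thesis using that n cycle_edge_iff[OF n, of "(s + k) mod n" "(s + Suc k) mod n"] by simp
  qed
  ultimately show ?thesis unfolding is_path_def by (intro exI[of _ ?xs]) auto
qed

lemma path_ideal_cycle:
  assumes n: "2 \<le> n" and t: "1 \<le> t" "t \<le> n"
  shows "path_ideal n (cycle_edges n) t
    = {f \<in> poly_ring n. \<forall>u\<in>Poly_Mapping.keys f. contains_arc n t (Poly_Mapping.keys u)}"
proof -
  let ?Us = "(\<lambda>s. Suc ` arc n t s) ` {..<n}"
  have "{prod_list (map var xs) | xs. is_path n (cycle_edges n) xs \<and> length xs = t}
      = (\<lambda>U. Poly_Mapping.single (sq_mon U) (1 :: 'a)) ` ?Us"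
  proof (intro Set.set_eqI iffI)
    fix g :: "'a mpoly" assume "g \<in> {prod_list (map var xs) | xs. is_path n (cycle_edges n) xs \<and> length xs = t}"
    then obtain xs where xs: "g = prod_list (map var xs)" "is_path n (cycle_edges n) xs" "length xs = t" by blast
    obtain s where s: "s < n" "set xs = Suc ` arc n t s" using path_vertices_arc[OF n t(1) xs(2,3)] by blast
    have "g = Poly_Mapping.single (sq_mon (Suc ` arc n t s)) 1"
      unfolding xs(1) using prod_list_var[of xs] xs(2) by (simp add: is_path_def s(2))
    thus "g \<in> (\<lambda>U. Poly_Mapping.single (sq_mon U) (1 :: 'a)) ` ?Us" using s(1) by blast
  next
    fix g :: "'a mpoly" assume "g \<in> (\<lambda>U. Poly_Mapping.single (sq_mon U) (1 :: 'a)) ` ?Us"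
    then obtain s where s: "s < n" "g = Poly_Mapping.single (sq_mon (Suc ` arc n t s)) 1" by blast
    obtain xs where xs: "is_path n (cycle_edges n) xs" "length xs = t" "set xs = Suc ` arc n t s"
      using arc_is_path[OF n t(2) s(1)] by blast
    have "g = prod_list (map var xs)" unfolding s(2) using prod_list_var[of xs, where ?'k = 'a] xs by (simp add: is_path_def)
    thus "g \<in> {prod_list (map var xs) | xs. is_path n (cycle_edges n) xs \<and> length xs = t}" using xs by blast
  qed
  hence "path_ideal n (cycle_edges n) t = ideal_gen n ((\<lambda>U. Poly_Mapping.single (sq_mon U) (1 :: 'a)) ` ?Us)"
    by (simp add: path_ideal_def)
  also have "\<dots> = {f \<in> poly_ring n. \<forall>u\<in>Poly_Mapping.keys f. \<exists>U\<in>?Us. U \<subseteq> Poly_Mapping.keys u}"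
  proof (rule ideal_gen_monomials)
    fix U assume "U \<in> ?Us"
    thus "U \<subseteq> {1..n}" using n by (auto simp: arc_def Suc_le_eq)
  qed
  also have "\<dots> = {f \<in> poly_ring n. \<forall>u\<in>Poly_Mapping.keys f. contains_arc n t (Poly_Mapping.keys u)}"
    unfolding contains_arc_def by (simp add: Bex_def)
  finally show ?thesis .
qed

section \<open>Counting the cells by degree\<close>

text \<open>
  A word with \<open>a\<close> long letters, \<open>b\<close> of them full, is recovered from the homological degree \<open>i\<close> and the
  degree \<open>j\<close> by solving two linear equations.
\<close>

lemma tilings_parameters:
  fixes t i j a b :: nat
  assumes t: "2 \<le> t" and "i = a + b" "j = t * a + b"
  shows "i \<le> j \<and> j \<le> t * i \<and> (t - 1) dvd (j - i) \<and> (j - i) div (t - 1) = a \<and> (t * i - j) div (t - 1) = b"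
proof -
  obtain q where q: "t = Suc q" "q \<noteq> 0" using t by (cases t) auto
  have j: "j = i + q * a" and ti: "t * i = j + q * b"
    unfolding assms(2,3) q(1) by (simp_all add: algebra_simps)
  have "j - i = q * a" "t * i - j = q * b" "i \<le> j" "j \<le> t * i" using j ti by linarith+
  thus ?thesis using q by simp
qed

lemma tilings_parameters_converse:
  fixes t i j :: nat
  assumes t: "2 \<le> t" and h: "i \<le> j" "j \<le> t * i" "(t - 1) dvd (j - i)"
  shows "i = (j - i) div (t - 1) + (t * i - j) div (t - 1) \<and> j = t * ((j - i) div (t - 1)) + (t * i - j) div (t - 1)"
proof -
  obtain q where q: "t = Suc q" "q \<noteq> 0" using t by (cases t) auto
  obtain a where a: "j - i = q * a" using h(3) q by auto
  have j: "j = i + q * a" using a h(1) by simp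
  hence "q * a \<le> q * i" using h(2) q by simp
  hence ai: "a \<le> i" using q by simp
  have "t * i - j = q * (i - a)" unfolding j q(1) by (simp add: diff_mult_distrib2)
  hence "(t * i - j) div (t - 1) = i - a" "(j - i) div (t - 1) = a" using a q by auto
  thus ?thesis using ai j q by (simp add: algebra_simps)
qed

text \<open>
  With \<open>L = n - t a\<close> letters in all, the factor \<open>(L - b) / L\<close> is the share of the cyclic rotations of the
  letters in which the last letter is not a full one.
\<close>

lemma tilings_formula:
  fixes n t a b :: nat
  assumes t: "2 \<le> t" and n: "1 \<le> n" and ta: "t * a < n" and j: "t * a + b < n"
  shows "(n - (t * a + b)) * ((a choose b) * ((n - t * a) choose a)) = (n - t * a) * card (tilings t n a b)"
proof -
  define m where "m = n - t * a - 1"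
  have L: "n - t * a = Suc m" "n - (t * a + b) = Suc m - b" "b \<le> m" using ta j by (auto simp: m_def)
  have card: "card (tilings t n a b) = (m choose a) * (a choose b) + (if a = 0 then 0 else (m choose (a - 1)) * ((a - 1) choose b))"
    using card_tilings[OF t n, of a b] ta by (simp add: m_def)
  show ?thesis
  proof (cases "b \<le> a \<and> a \<le> Suc m")
    case False
    hence z1: "(a choose b) * (Suc m choose a) = 0" by (auto simp: binomial_eq_0_iff)
    have z2: "(m choose a) * (a choose b) = 0" using False by (auto simp: binomial_eq_0_iff)
    have z3: "(m choose (a - 1)) * ((a - 1) choose b) = 0" if "a \<noteq> 0" using False that by (auto simp: binomial_eq_0_iff)
    have "card (tilings t n a b) = 0" unfolding card z2 using z3 by (cases "a = 0") simp_all
    thus ?thesis unfolding L z1 by simp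
  next
    case True
    have A: "Suc m * (m choose a) = (Suc m - a) * (Suc m choose a)"
      using binomial_absorb_comp[of "Suc m" a] by simp
    show ?thesis
    proof (cases "a = 0")
      case True
      thus ?thesis using \<open>b \<le> a \<and> a \<le> Suc m\<close> unfolding card L by simp
    next
      case False
      then obtain a' where a': "a = Suc a'" by (cases a) auto
      have B: "Suc m * (m choose a') = a * (Suc m choose a)" unfolding a' by (rule Suc_times_binomial[symmetric])
      have C: "a * (a' choose b) = (a - b) * (a choose b)" using binomial_absorb_comp[of a b] a' by simp
      have "Suc m * card (tilings t n a b) = (Suc m * (m choose a)) * (a choose b) + (Suc m * (m choose a')) * (a' choose b)"
        unfolding card using a' by (simp add: algebra_simps)
      also have "\<dots> = (Suc m - a) * (Suc m choose a) * (a choose b) + (Suc m choose a) * (a * (a' choose b))"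
        unfolding A B by (simp add: algebra_simps)
      also have "\<dots> = ((Suc m - a) + (a - b)) * ((a choose b) * (Suc m choose a))"
        unfolding C by (simp add: algebra_simps)
      also have "(Suc m - a) + (a - b) = Suc m - b" using True by simp
      finally show ?thesis unfolding L by simp
    qed
  qed
qed

text \<open>
  Whether \<open>N\<close> and \<open>N - t\<close> belong to \<open>W\<close> tells the first letter of a word for \<open>W\<close>, and the vertices
  below \<open>N - t\<close> are spelled by the rest of the word.
\<close>

lemma tilings_Suc_cases:
  assumes t: "0 < t" and W: "W \<in> tilings t (Suc N) a b"
  obtains "N \<notin> W" "W \<in> tilings t N a b"
    | "N \<in> W" "N - t \<notin> W" "a \<noteq> 0" "{v\<in>W. v < N - t} \<in> tilings t (N - t) (a - 1) b"
    | "N \<in> W" "N - t \<in> W" "a \<noteq> 0" "b \<noteq> 0" "{v\<in>W. v < N - t} \<in> tilings t (N - t) (a - 1) (b - 1)"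
proof -
  have lt: "v < N - t" if "W' \<in> tilings t (N - t) a' b'" "v \<in> W'" for W' a' b' v
    using tilings_subset[OF that(1)] that(2) by auto
  consider "W \<in> tilings t N a b"
    | W' where "t \<le> N" "a \<noteq> 0" "W' \<in> tilings t (N - t) (a - 1) b" "W = W' \<union> {Suc N - t..N}"
    | W' where "t < N" "a \<noteq> 0" "b \<noteq> 0" "W' \<in> tilings t (N - t) (a - 1) (b - 1)" "W = W' \<union> {N - t..N}"
    using W unfolding tilings.simps by (auto split: if_splits)
  thus thesis
  proof cases
    case 1
    have "N \<notin> W" using tilings_subset[OF 1] by auto
    thus thesis using 1 by (rule that(1))
  next
    case 2
    have "{v\<in>W. v < N - t} = W'" using lt[OF 2(3)] unfolding 2(4) by auto
    moreover have "N \<in> W" "N - t \<notin> W" using lt[OF 2(3)] t 2(1) unfolding 2(4) by auto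
    ultimately show thesis using 2(2,3) that(2) by simp
  next
    case 3
    have "{v\<in>W. v < N - t} = W'" using lt[OF 3(4)] unfolding 3(5) by auto
    moreover have "N \<in> W" "N - t \<in> W" using 3(1) unfolding 3(5) by auto
    ultimately show thesis using 3(2-4) that(3) by simp
  qed
qed

text \<open>
  The word of a set is determined by reading its letters from the top.
\<close>

lemma tilings_unique:
  assumes t: "0 < t"
  shows "W \<in> tilings t N a b \<Longrightarrow> W \<in> tilings t N a' b' \<Longrightarrow> a = a' \<and> b = b'"
proof (induction N arbitrary: W a b a' b' rule: less_induct)
  case (less N)
  show ?case
  proof (cases N)
    case 0
    thus ?thesis using less.prems by (auto simp: tilings.simps split: if_splits)
  next
    case (Suc M)
    have M: "M < N" "M - t < N" using Suc by auto
    show ?thesis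
    proof (rule tilings_Suc_cases[OF t less.prems(1)[unfolded Suc]])
      assume h: "M \<notin> W" "W \<in> tilings t M a b"
      show ?thesis
      proof (rule tilings_Suc_cases[OF t less.prems(2)[unfolded Suc]])
        assume "W \<in> tilings t M a' b'"
        thus ?thesis by (rule less.IH[OF M(1) h(2)])
      next
        assume "M \<in> W" thus ?thesis using h(1) by simp
      next
        assume "M \<in> W" thus ?thesis using h(1) by simp
      qed
    next
      assume h: "M \<in> W" "M - t \<notin> W" "a \<noteq> 0" "{v\<in>W. v < M - t} \<in> tilings t (M - t) (a - 1) b"
      show ?thesis
      proof (rule tilings_Suc_cases[OF t less.prems(2)[unfolded Suc]])
        assume h': "a' \<noteq> 0" "{v\<in>W. v < M - t} \<in> tilings t (M - t) (a' - 1) b'"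
        show ?thesis using less.IH[OF M(2) h(4) h'(2)] h(3) h'(1) by arith
      next
        assume "M \<notin> W" thus ?thesis using h(1) by simp
      next
        assume "M - t \<in> W" thus ?thesis using h(2) by simp
      qed
    next
      assume h: "M \<in> W" "M - t \<in> W" "a \<noteq> 0" "b \<noteq> 0" "{v\<in>W. v < M - t} \<in> tilings t (M - t) (a - 1) (b - 1)"
      show ?thesis
      proof (rule tilings_Suc_cases[OF t less.prems(2)[unfolded Suc]])
        assume h': "a' \<noteq> 0" "b' \<noteq> 0" "{v\<in>W. v < M - t} \<in> tilings t (M - t) (a' - 1) (b' - 1)"
        show ?thesis using less.IH[OF M(2) h(5) h'(3)] h(3,4) h'(1,2) by arith
      next
        assume "M \<notin> W" thus ?thesis using h(1) by simp
      next
        assume "M - t \<notin> W" thus ?thesis using h(2) by simp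
      qed
    qed
  qed
qed

lemma rot_image_inverse:
  assumes "W \<subseteq> {..<n}" "c \<le> n"
  shows "rot n (n - c) ` (rot n c ` W) = W"
proof -
  have "rot n (n - c) (rot n c v) = v" if "v \<in> W" for v
    by (rule rot_inverse) (use that assms in auto)
  thus ?thesis by (simp add: image_image)
qed

lemma rot_image_inverse':
  assumes "W \<subseteq> {..<n}" "c \<le> n"
  shows "rot n c ` (rot n (n - c) ` W) = W"
  using rot_image_inverse[OF assms(1), of "n - c"] assms(2) by simp

lemma rot_image_subset: "0 < n \<Longrightarrow> rot n c ` W \<subseteq> {..<n}"
  by (auto simp: rot_lt)

lemma mem_rot_image:
  assumes "W \<subseteq> {..<n}" "c \<le> n" "v < n"
  shows "rot n c v \<in> rot n c ` W \<longleftrightarrow> v \<in> W"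
proof
  assume "rot n c v \<in> rot n c ` W"
  then obtain w where w: "w \<in> W" "rot n c v = rot n c w" by blast
  have inj: "inj_on (rot n c) {..<n}" using bij_rot[OF assms(2)] by (simp add: bij_betw_def)
  have "v = w" by (rule inj_onD[OF inj w(2)]) (use w(1) assms in auto)
  thus "v \<in> W" using w(1) by simp
qed (rule imageI)

text \<open>
  The strand is described by the word of \<open>W\<close>; the second conjunct says this for all homological
  degrees at once.
\<close>

lemma concentrated_strand_missing_0:
  assumes t: "2 \<le> t" "t \<le> n" and W: "W \<subseteq> {1..<n}"
  shows "\<exists>k b. concentrated K (strand n t W) k b \<and>
    (\<forall>i. (if i = k then b else 0) = (if \<exists>a b. W \<in> tilings t n a b \<and> i = a + b then 1 else 0))"
proof -
  consider a b where "W \<in> tilings t n a b" "concentrated K (strand n t W) (a + b) 1"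
    | "concentrated K (strand n t W) 0 0" "\<forall>a b. W \<notin> tilings t n a b"
    using concentrated_strand_proper[OF t W, of K] by blast
  thus ?thesis
  proof cases
    case 1
    have t0: "0 < t" using t by simp
    have "(\<exists>a' b'. W \<in> tilings t n a' b' \<and> i = a' + b') \<longleftrightarrow> i = a + b" for i
      using tilings_unique[OF t0 1(1)] 1(1) by blast
    thus ?thesis using 1(2) by (intro exI[of _ "a + b"] exI[of _ 1]) simp
  next
    case 2
    thus ?thesis by (intro exI[of _ 0]) simp
  qed
qed

text \<open>
  The cells of the minimal resolution are sorted by multidegree; \<open>c i W\<close> is the multigraded Betti number.
\<close>

lemma graded_betti_cycle:
  assumes n: "2 \<le> n" and t: "2 \<le> t" "t \<le> n"
  shows "\<exists>c. (\<forall>i j. graded_betti n (path_ideal n (cycle_edges n) t :: 'k::field mpoly set) i (int j)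
       = (\<Sum>W | W \<subseteq> {..<n} \<and> card W = j. c i W)) \<and>
    (\<forall>W k b i. concentrated TYPE('k) (strand n t W) k b \<longrightarrow> c i W = (if i = k then b else 0))"
proof -
  let ?m = "lcm_degree n t"
  have t0: "0 < t" using t by simp
  obtain C and a :: "nat set \<Rightarrow> nat set \<Rightarrow> 'k" where
    h: "C \<subseteq> Pow {..<n} \<and> multigraded_resolution card ?m (contains_arc n t) {} C a \<and>
    (\<forall>\<sigma>\<in>C. \<forall>\<tau>\<in>C. a \<sigma> \<tau> \<noteq> 0 \<longrightarrow> ?m \<sigma> \<noteq> ?m \<tau>) \<and>
    (\<forall>W k b l. concentrated TYPE('k) (strand n t W) k b \<longrightarrow>
       card {\<sigma>\<in>C. ?m \<sigma> = Suc ` W \<and> card \<sigma> = l} = (if l = k then b else 0))"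
    using minimal_arc_resolution[OF t0, of n, where ?'k = 'k] by (elim exE) (rule that)
  have C: "C \<subseteq> Pow {..<n}" and res: "multigraded_resolution card ?m (contains_arc n t) {} C a"
    and min: "\<And>\<sigma> \<tau>. \<sigma> \<in> C \<Longrightarrow> \<tau> \<in> C \<Longrightarrow> a \<sigma> \<tau> \<noteq> 0 \<Longrightarrow> ?m \<sigma> \<noteq> ?m \<tau>"
    and cnt: "\<And>W k b l. concentrated TYPE('k) (strand n t W) k b \<Longrightarrow>
       card {\<sigma>\<in>C. ?m \<sigma> = Suc ` W \<and> card \<sigma> = l} = (if l = k then b else 0)"
    using h by blast+
  have finC: "finite C" by (rule finite_subset[OF C]) simp
  let ?V = "\<lambda>\<sigma>. \<Union>s\<in>\<sigma>. arc n t s"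
  have V: "?V \<sigma> \<subseteq> {..<n}" for \<sigma> using n by (auto simp: arc_def)
  have mC: "?m \<sigma> \<subseteq> {1..n}" for \<sigma> using V[of \<sigma>] by (auto simp: lcm_degree_def Suc_le_eq)
  have up: "contains_arc n t U'" if "contains_arc n t U" "U \<subseteq> U'" for U U'
    using that unfolding contains_arc_def by blast
  have "\<exists>D \<phi>. min_graded_free_resolution n {f \<in> poly_ring n. \<forall>u\<in>Poly_Mapping.keys f. contains_arc n t (Poly_Mapping.keys u)} D (\<phi> :: nat \<Rightarrow> 'k mpoly mat) \<and>
     (\<forall>i j. count_list (D i) j = card {\<sigma>\<in>C. card \<sigma> = i \<and> int (card (?m \<sigma>)) = j})"
    by (rule resolution_of_multigraded[OF res min mC up])
  then obtain D and \<phi> :: "nat \<Rightarrow> 'k mpoly mat" where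
    D: "min_graded_free_resolution n {f \<in> poly_ring n. \<forall>u\<in>Poly_Mapping.keys f. contains_arc n t (Poly_Mapping.keys u)} D \<phi>"
    "\<And>i j. count_list (D i) j = card {\<sigma>\<in>C. card \<sigma> = i \<and> int (card (?m \<sigma>)) = j}" by blast
  have t1: "1 \<le> t" using t by simp
  define c where "c = (\<lambda>i W. card {\<sigma>\<in>C. ?m \<sigma> = Suc ` W \<and> card \<sigma> = i})"
  have "graded_betti n (path_ideal n (cycle_edges n) t :: 'k mpoly set) i (int j)
      = (\<Sum>W | W \<subseteq> {..<n} \<and> card W = j. c i W)" for i j
  proof -
    have "graded_betti n (path_ideal n (cycle_edges n) t :: 'k mpoly set) i (int j) = count_list (D i) (int j)"
      unfolding path_ideal_cycle[OF n t1 t(2)] by (rule graded_betti_eqI[OF D(1)])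
    also have "\<dots> = card {\<sigma>\<in>C. card \<sigma> = i \<and> int (card (?m \<sigma>)) = int j}" by (rule D(2))
    also have "{\<sigma>\<in>C. card \<sigma> = i \<and> int (card (?m \<sigma>)) = int j}
        = (\<Union>W\<in>{W. W \<subseteq> {..<n} \<and> card W = j}. {\<sigma>\<in>C. ?m \<sigma> = Suc ` W \<and> card \<sigma> = i})"
    proof (intro Set.set_eqI iffI)
      fix \<sigma> assume \<sigma>: "\<sigma> \<in> {\<sigma>\<in>C. card \<sigma> = i \<and> int (card (?m \<sigma>)) = int j}"
      hence "card (?V \<sigma>) = j" by (simp add: lcm_degree_def card_image)
      thus "\<sigma> \<in> (\<Union>W\<in>{W. W \<subseteq> {..<n} \<and> card W = j}. {\<sigma>\<in>C. ?m \<sigma> = Suc ` W \<and> card \<sigma> = i})"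
        using \<sigma> V[of \<sigma>] by (intro UN_I[of "?V \<sigma>"]) (auto simp: lcm_degree_def)
    qed (auto simp: card_image)
    also have "card \<dots> = (\<Sum>W | W \<subseteq> {..<n} \<and> card W = j. c i W)"
      unfolding c_def
    proof (rule card_UN_disjoint)
      show "finite {W. W \<subseteq> {..<n} \<and> card W = j}" by (rule finite_subset[of _ "Pow {..<n}"]) auto
      show "\<forall>W\<in>{W. W \<subseteq> {..<n} \<and> card W = j}. finite {\<sigma>\<in>C. ?m \<sigma> = Suc ` W \<and> card \<sigma> = i}" using finC by simp
      show "\<forall>W\<in>{W. W \<subseteq> {..<n} \<and> card W = j}. \<forall>W'\<in>{W. W \<subseteq> {..<n} \<and> card W = j}. W \<noteq> W' \<longrightarrow>
          {\<sigma>\<in>C. ?m \<sigma> = Suc ` W \<and> card \<sigma> = i} \<inter> {\<sigma>\<in>C. ?m \<sigma> = Suc ` W' \<and> card \<sigma> = i} = {}"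
        by (auto simp: inj_image_eq_iff)
    qed
    finally show ?thesis .
  qed
  moreover have "c i W = (if i = k then b else 0)" if "concentrated TYPE('k) (strand n t W) k b" for W k b i
    unfolding c_def by (rule cnt[OF that])
  ultimately show ?thesis by (intro exI[of _ c] conjI allI impI)
qed

text \<open>
  Count the pairs of a degree \<open>W\<close> and a vertex outside \<open>W\<close> in two ways: every \<open>W\<close> misses
  \<open>n - j\<close> vertices, and by rotation the degrees that miss a given vertex contribute the same for each
  vertex.
\<close>

lemma sum_strands_missing_0:
  fixes c :: "nat \<Rightarrow> nat set \<Rightarrow> nat"
  assumes t: "2 \<le> t" "t \<le> n" and j: "j < n"
    and conc: "\<And>W k b i. concentrated (K :: 'k::field itself) (strand n t W) k b \<Longrightarrow> c i W = (if i = k then b else 0)"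
  shows "(n - j) * (\<Sum>W | W \<subseteq> {..<n} \<and> card W = j. c i W)
    = n * (\<Sum>W | W \<subseteq> {..<n} \<and> card W = j \<and> 0 \<notin> W. c i W)"
proof -
  have n0: "0 < n" using j by simp
  let ?A = "{W. W \<subseteq> {..<n} \<and> card W = j}"
  have finA: "finite ?A" by (rule finite_subset[of _ "Pow {..<n}"]) auto
  \<comment> \<open>Rotating a missing vertex \<open>v\<close> to \<open>0\<close> shows that the strand is concentrated.\<close>
  have inv: "c i (rot n (n - v) ` W) = c i W" if W: "W \<subseteq> {..<n}" and v: "v < n" "v \<notin> W" for W v
  proof -
    let ?W = "rot n (n - v) ` W"
    have "rot n (n - v) v = 0" using v by (simp add: rot_def)
    hence "0 \<notin> ?W" using mem_rot_image[OF W, of "n - v" v] v by simp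
    moreover have "?W \<subseteq> {..<n}" by (rule rot_image_subset[OF n0])
    ultimately have sub: "?W \<subseteq> {1..<n}"
      by (intro subsetI) (metis One_nat_def Suc_leI atLeastLessThan_iff gr0I lessThan_iff subsetD)
    obtain k b where k: "concentrated K (strand n t ?W) k b"
      using concentrated_strand_missing_0[OF t sub, of K] by blast
    have "concentrated K (strand n t (rot n v ` ?W)) k b"
      by (rule concentrated_rot[OF _ rot_image_subset[OF n0] k]) (use v in simp)
    moreover have "rot n v ` ?W = W" by (rule rot_image_inverse'[OF W]) (use v in simp)
    ultimately have "concentrated K (strand n t W) k b" by simp
    thus ?thesis using conc[OF k] conc[of W k b] by simp
  qed
  have rot: "(\<Sum>W | W \<subseteq> {..<n} \<and> card W = j \<and> v \<notin> W. c i W)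
      = (\<Sum>W | W \<subseteq> {..<n} \<and> card W = j \<and> 0 \<notin> W. c i W)" if v: "v < n" for v
  proof (rule sum.reindex_bij_witness[where j = "\<lambda>W. rot n (n - v) ` W" and i = "\<lambda>W. rot n v ` W"])
    have inj: "inj_on (rot n d) W" if "W \<subseteq> {..<n}" "d \<le> n" for d W
      using bij_rot[OF that(2)] that(1) unfolding bij_betw_def by (blast intro: inj_on_subset)
    have r0: "rot n (n - v) v = 0" "rot n v 0 = v" using v by (simp_all add: rot_def)
    fix W
    {
      assume W: "W \<in> {W. W \<subseteq> {..<n} \<and> card W = j \<and> v \<notin> W}"
      hence s: "W \<subseteq> {..<n}" by simp
      show "rot n v ` (rot n (n - v) ` W) = W" by (rule rot_image_inverse'[OF s]) (use v in simp)
      have "card (rot n (n - v) ` W) = j" using card_image[OF inj[OF s, of "n - v"]] W by simp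
      moreover have "0 \<notin> rot n (n - v) ` W" using mem_rot_image[OF s, of "n - v" v] v r0 W by simp
      ultimately show "rot n (n - v) ` W \<in> {W. W \<subseteq> {..<n} \<and> card W = j \<and> 0 \<notin> W}"
        using rot_image_subset[OF n0] by simp
      show "c i (rot n (n - v) ` W) = c i W" by (rule inv[OF s v]) (use W in simp)
    }
    {
      assume W: "W \<in> {W. W \<subseteq> {..<n} \<and> card W = j \<and> 0 \<notin> W}"
      hence s: "W \<subseteq> {..<n}" by simp
      show "rot n (n - v) ` (rot n v ` W) = W" by (rule rot_image_inverse[OF s]) (use v in simp)
      have "card (rot n v ` W) = j" using card_image[OF inj[OF s, of v]] W v by simp
      moreover have "v \<notin> rot n v ` W" using mem_rot_image[OF s, of v 0] v r0 W n0 by simp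
      ultimately show "rot n v ` W \<in> {W. W \<subseteq> {..<n} \<and> card W = j \<and> v \<notin> W}"
        using rot_image_subset[OF n0] by simp
    }
  qed
  have "(n - j) * (\<Sum>W\<in>?A. c i W) = (\<Sum>W\<in>?A. \<Sum>v<n. if v \<notin> W then c i W else 0)"
    unfolding sum_distrib_left
  proof (rule sum.cong[OF refl])
    fix W assume W: "W \<in> ?A"
    have "(\<Sum>v<n. if v \<notin> W then c i W else 0) = (\<Sum>v\<in>{..<n} - W. c i W)"
      by (rule sum.mono_neutral_cong_right) auto
    also have "\<dots> = (n - j) * c i W" using W finite_subset[of W "{..<n}"] by (simp add: card_Diff_subset)
    finally show "(n - j) * c i W = (\<Sum>v<n. if v \<notin> W then c i W else 0)" ..
  qed
  also have "\<dots> = (\<Sum>v<n. \<Sum>W\<in>?A. if v \<notin> W then c i W else 0)" by (rule sum.swap)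
  also have "\<dots> = (\<Sum>v<n. \<Sum>W | W \<subseteq> {..<n} \<and> card W = j \<and> v \<notin> W. c i W)"
  proof (rule sum.cong[OF refl])
    fix v
    show "(\<Sum>W\<in>?A. if v \<notin> W then c i W else 0) = (\<Sum>W | W \<subseteq> {..<n} \<and> card W = j \<and> v \<notin> W. c i W)"
      by (rule sum.mono_neutral_cong_right[OF finA]) auto
  qed
  also have "\<dots> = (\<Sum>v<n. \<Sum>W | W \<subseteq> {..<n} \<and> card W = j \<and> 0 \<notin> W. c i W)"
    by (rule sum.cong[OF refl], rule rot) simp
  also have "\<dots> = n * (\<Sum>W | W \<subseteq> {..<n} \<and> card W = j \<and> 0 \<notin> W. c i W)" by simp
  finally show ?thesis .
qed

text \<open>
  Each set spelled by a word contributes one, and the word has the parameters fixed by \<open>i\<close> and \<open>j\<close>.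
\<close>

lemma sum_strands_tilings:
  fixes c :: "nat \<Rightarrow> nat set \<Rightarrow> nat"
  assumes t: "2 \<le> t" "t \<le> n"
    and conc: "\<And>W k b i. concentrated (K :: 'k::field itself) (strand n t W) k b \<Longrightarrow> c i W = (if i = k then b else 0)"
  shows "(\<Sum>W | W \<subseteq> {..<n} \<and> card W = j \<and> 0 \<notin> W. c i W)
    = (if i \<le> j \<and> j \<le> t * i \<and> (t - 1) dvd (j - i)
       then card (tilings t n ((j - i) div (t - 1)) ((t * i - j) div (t - 1))) else 0)"
proof -
  let ?B = "{W. W \<subseteq> {..<n} \<and> card W = j \<and> 0 \<notin> W}"
  let ?P = "\<lambda>W. \<exists>a b. W \<in> tilings t n a b \<and> i = a + b"
  have finB: "finite ?B" by (rule finite_subset[of _ "Pow {..<n}"]) auto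
  have c: "c i W = (if ?P W then 1 else 0)" if W: "W \<in> ?B" for W
  proof -
    have "W \<subseteq> {1..<n}"
    proof
      fix v assume "v \<in> W"
      thus "v \<in> {1..<n}" using W by (cases v) auto
    qed
    then obtain k b where k: "concentrated K (strand n t W) k b"
      and e: "\<forall>i. (if i = k then b else 0) = (if \<exists>a b. W \<in> tilings t n a b \<and> i = a + b then 1 else 0)"
      using concentrated_strand_missing_0[OF t, of W K] by blast
    show ?thesis unfolding conc[OF k] using e by blast
  qed
  have "(\<Sum>W\<in>?B. c i W) = (\<Sum>W\<in>?B. if ?P W then 1 else 0)" by (rule sum.cong[OF refl c])
  also have "\<dots> = (\<Sum>W\<in>{W\<in>?B. ?P W}. 1)" by (rule sum.mono_neutral_cong_right[OF finB]) auto
  also have "\<dots> = card {W\<in>?B. ?P W}" by simp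
  also have "{W\<in>?B. ?P W} = (if i \<le> j \<and> j \<le> t * i \<and> (t - 1) dvd (j - i)
       then tilings t n ((j - i) div (t - 1)) ((t * i - j) div (t - 1)) else {})"
  proof (intro Set.set_eqI iffI)
    fix W assume "W \<in> {W\<in>?B. ?P W}"
    then obtain a b where ab: "W \<in> tilings t n a b" "i = a + b" and "card W = j" by blast
    hence j: "j = t * a + b" using card_tilings_element by blast
    show "W \<in> (if i \<le> j \<and> j \<le> t * i \<and> (t - 1) dvd (j - i)
       then tilings t n ((j - i) div (t - 1)) ((t * i - j) div (t - 1)) else {})"
      using tilings_parameters[OF t(1) ab(2) j] ab(1) by simp
  next
    fix W assume W: "W \<in> (if i \<le> j \<and> j \<le> t * i \<and> (t - 1) dvd (j - i)
       then tilings t n ((j - i) div (t - 1)) ((t * i - j) div (t - 1)) else {})"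
    let ?a = "(j - i) div (t - 1)" and ?b = "(t * i - j) div (t - 1)"
    have h: "i \<le> j" "j \<le> t * i" "(t - 1) dvd (j - i)" and T: "W \<in> tilings t n ?a ?b"
      using W by (auto split: if_splits)
    have ij: "i = ?a + ?b" "j = t * ?a + ?b" using tilings_parameters_converse[OF t(1) h] by blast+
    have "W \<subseteq> {1..<n}" by (rule tilings_subset[OF T])
    hence "W \<subseteq> {..<n}" "0 \<notin> W" by auto
    moreover have "card W = j" using card_tilings_element[OF T] ij(2) by simp
    ultimately show "W \<in> {W\<in>?B. ?P W}" using T ij(1) by blast
  qed
  finally show ?thesis by (simp split: if_splits)
qed

text \<open>
  Outside the degrees of the third case the binomial coefficients vanish: \<open>a > p\<close> makes \<open>n - t a < a\<close>,
  and \<open>i > 2 a\<close> means \<open>a < b\<close>.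
\<close>

lemma betti_formula:
  fixes n t p d i j s :: nat and c :: "nat \<Rightarrow> nat set \<Rightarrow> nat"
  assumes n2: "n \<ge> 2" and t: "2 \<le> t" "t \<le> n"
    and np: "n = (t + 1) * p + d" and d: "d \<le> t"
    and conc: "\<And>W k b i. concentrated (K :: 'k::field itself) (strand n t W) k b \<Longrightarrow> c i W = (if i = k then b else 0)"
    and s_def: "s = (\<Sum>W | W \<subseteq> {..<n} \<and> card W = j. c i W)"
  shows "real s =
    (if j = n \<and> d = 0 \<and> i = 2 * (n div (t + 1)) then real t
     else if j = n \<and> d \<noteq> 0 \<and> i = 2 * ((n - d) div (t + 1)) + 1 then 1
     else if j < n \<and> i \<le> j \<and> j \<le> t * i \<and> (t - 1) dvd (j - i)
             \<and> 2 * p \<ge> 2 * (j - i) div (t - 1) \<and> 2 * (j - i) div (t - 1) \<ge> i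
       then real n / (real n - real t * real ((j - i) div (t - 1)))
            * real (((j - i) div (t - 1)) choose ((t * i - j) div (t - 1)))
            * real ((n - t * ((j - i) div (t - 1))) choose ((j - i) div (t - 1)))
     else 0)"
proof -
  consider "n < j" | "j = n" | "j < n" by linarith
  thus ?thesis
  proof cases
    case 1
    have none: "card W \<noteq> j" if "W \<subseteq> {..<n}" for W
    proof -
      have "card W \<le> card {..<n}" by (rule card_mono[OF _ that]) simp
      thus ?thesis using 1 by simp
    qed
    have "s = 0" unfolding s_def by (rule sum.neutral) (use none in blast)
    thus ?thesis using 1 by simp
  next
    case 2
    have full: "W = {..<n}" if "W \<subseteq> {..<n}" "card W = n" for W
      by (rule card_subset_eq) (use that in auto)
    have "{W. W \<subseteq> {..<n} \<and> card W = n} = {{..<n}}"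
    proof (intro Set.set_eqI iffI)
      fix W assume "W \<in> {W. W \<subseteq> {..<n} \<and> card W = n}"
      thus "W \<in> {{..<n}}" using full[of W] by blast
    qed simp
    hence S: "s = c i {..<n}" unfolding s_def using 2 by simp
    have c: "c i {..<n} = (if i = (if d = 0 then 2 * p else 2 * p + 1) then (if d = 0 then t else 1) else 0)"
      by (rule conc[OF concentrated_strand_full[OF t np d]])
    have "n - d = (t + 1) * p" using np by simp
    moreover have "(t + 1) * p div (t + 1) = p" by (rule nonzero_mult_div_cancel_left) simp
    ultimately have nd: "(n - d) div (t + 1) = p" by (simp only:)
    show ?thesis
    proof (cases "d = 0")
      case True
      have "n div (t + 1) = p" using nd unfolding True by (simp only: diff_zero)
      thus ?thesis unfolding S c using 2 True by simp
    next
      case False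
      thus ?thesis unfolding S c nd using 2 by simp
    qed
  next
    case 3
    have ne: "\<not> (j = n \<and> d = 0 \<and> i = 2 * (n div (t + 1)))" "\<not> (j = n \<and> d \<noteq> 0 \<and> i = 2 * ((n - d) div (t + 1)) + 1)"
      using 3 by auto
    define a where "a = (j - i) div (t - 1)"
    define b where "b = (t * i - j) div (t - 1)"
    let ?cond = "i \<le> j \<and> j \<le> t * i \<and> (t - 1) dvd (j - i)"
    have "(n - j) * s = n * (\<Sum>W | W \<subseteq> {..<n} \<and> card W = j \<and> 0 \<notin> W. c i W)"
      unfolding s_def by (rule sum_strands_missing_0[OF t 3, where K = "K" and c = c]) (rule conc)
    also have "(\<Sum>W | W \<subseteq> {..<n} \<and> card W = j \<and> 0 \<notin> W. c i W) = (if ?cond then card (tilings t n a b) else 0)"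
      unfolding a_def b_def
      by (rule sum_strands_tilings[OF t, where K = "K" and c = c]) (rule conc)
    finally have S: "(n - j) * s = n * (if ?cond then card (tilings t n a b) else 0)" .
    show ?thesis
    proof (cases ?cond)
      case False
      have "(n - j) * s = 0" unfolding S if_not_P[OF False] by simp
      hence "s = 0" using 3 by simp
      thus ?thesis using 3 False by auto
    next
      case True
      have ij: "i = a + b" "j = t * a + b"
        using tilings_parameters_converse[OF t(1), of i j] True unfolding a_def b_def by blast+
      \<comment> \<open>As \<open>t - 1\<close> divides \<open>j - i\<close>, the division may be carried out before doubling.\<close>
      have two: "2 * (j - i) div (t - 1) = 2 * a" using True by (auto simp: a_def)
      have ta: "t * a < n" using ij 3 by simp
      define L where "L = n - t * a"
      have L: "real L = real n - real t * real a" "0 < L" using ta by (auto simp: L_def of_nat_diff)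
      have nj: "n - j = L - b" "b < L" using ij 3 by (auto simp: L_def)
      have F: "(L - b) * ((a choose b) * (L choose a)) = L * card (tilings t n a b)"
        using tilings_formula[OF t(1) _ ta, of b] n2 ij 3 nj unfolding L_def by simp
      have "(L - b) * (L * s) = (L - b) * (n * ((a choose b) * (L choose a)))"
      proof -
        have "(L - b) * (L * s) = L * ((n - j) * s)" unfolding nj by (simp add: mult.left_commute)
        also have "\<dots> = n * (L * card (tilings t n a b))" unfolding S using True by (simp add: mult.left_commute)
        also have "\<dots> = (L - b) * (n * ((a choose b) * (L choose a)))" unfolding F[symmetric] by (simp add: mult.left_commute)
        finally show ?thesis .
      qed
      hence LS: "L * s = n * ((a choose b) * (L choose a))" using nj by simp
      have RS: "real s = real n / real L * real (a choose b) * real (L choose a)"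
      proof -
        have "real L * real s = real n * (real (a choose b) * real (L choose a))"
          using arg_cong[OF LS, of real] by simp
        thus ?thesis using L(2) by (simp add: field_simps)
      qed
      show ?thesis
      proof (cases "a \<le> p \<and> i \<le> 2 * a")
        case ok: True
        hence c3: "j < n \<and> i \<le> j \<and> j \<le> t * i \<and> (t - 1) dvd (j - i)
             \<and> 2 * p \<ge> 2 * (j - i) div (t - 1) \<and> 2 * (j - i) div (t - 1) \<ge> i"
          unfolding two using 3 True by simp
        show ?thesis
          unfolding RS if_not_P[OF ne(1)] if_not_P[OF ne(2)] if_P[OF c3] L(1)
          unfolding L_def a_def b_def ..
      next
        case no: False
        have "(a choose b) = 0 \<or> (L choose a) = 0"
        proof (cases "a \<le> p")
          case True
          hence "a < b" using no ij by simp
          thus ?thesis by (simp add: binomial_eq_0)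
        next
          case False
          hence "(t + 1) * Suc p \<le> (t + 1) * a" by (intro mult_le_mono2) simp
          moreover have "(t + 1) * Suc p = (t + 1) * p + (t + 1)" by simp
          moreover have "(t + 1) * a = t * a + a" by simp
          ultimately have "n < t * a + a" using np d by linarith
          hence "L < a" using ta unfolding L_def by linarith
          thus ?thesis by (simp add: binomial_eq_0)
        qed
        hence z: "real s = 0" unfolding RS by auto
        have c3: "\<not> (j < n \<and> i \<le> j \<and> j \<le> t * i \<and> (t - 1) dvd (j - i)
             \<and> 2 * p \<ge> 2 * (j - i) div (t - 1) \<and> 2 * (j - i) div (t - 1) \<ge> i)"
          unfolding two using no by auto
        show ?thesis unfolding z if_not_P[OF ne(1)] if_not_P[OF ne(2)] if_not_P[OF c3] ..
      qed
    qed
  qed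
qed

theorem theorem4p13:
  fixes n t p d i j :: nat
  assumes "n \<ge> 2" and "2 \<le> t" and "t \<le> n"
    and "n = (t + 1) * p + d" and "d \<le> t"
  shows "real (graded_betti n (path_ideal n (cycle_edges n) t :: 'k::field mpoly set) i (int j)) =
    (if j = n \<and> d = 0 \<and> i = 2 * (n div (t + 1)) then real t
     else if j = n \<and> d \<noteq> 0 \<and> i = 2 * ((n - d) div (t + 1)) + 1 then 1
     else if j < n \<and> i \<le> j \<and> j \<le> t * i \<and> (t - 1) dvd (j - i)
             \<and> 2 * p \<ge> 2 * (j - i) div (t - 1) \<and> 2 * (j - i) div (t - 1) \<ge> i
       then real n / (real n - real t * real ((j - i) div (t - 1)))
            * real (((j - i) div (t - 1)) choose ((t * i - j) div (t - 1)))
            * real ((n - t * ((j - i) div (t - 1))) choose ((j - i) div (t - 1)))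
     else 0)"
proof -
  obtain c :: "nat \<Rightarrow> nat set \<Rightarrow> nat" where
    betti: "\<And>i j. graded_betti n (path_ideal n (cycle_edges n) t :: 'k mpoly set) i (int j)
       = (\<Sum>W | W \<subseteq> {..<n} \<and> card W = j. c i W)"
    and conc: "\<And>W k b i. concentrated TYPE('k) (strand n t W) k b \<Longrightarrow> c i W = (if i = k then b else 0)"
    using graded_betti_cycle[OF assms(1-3), where ?'k = 'k] by blast
  show ?thesis
    by (rule betti_formula[OF assms, where K = "TYPE('k)" and c = c]) (erule conc, rule betti)
qed

end
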